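(* Let $m$ and $n$ be positive integers with $m \ge 2$, $n \ge 2$, $d = \gcd(m, n)$, $m = dm'$, and $n = dn'$. Then the greatest possible size of the difference between two (not necessarily distinct) cycles on the $m \times n$ grid with the same signature is $mn - \delta_{m, n}m'n'$, where \[\delta_{m, n} = \begin{cases} 1 & \text{if } d \text{ is odd},\\ 0 & \text{if } d \equiv 0 \pmod 4,\\ 0 & \text{if } d \equiv 2 \pmod 4,\ m \ge 4,\ n \ge 4, \text{ and } mn/d^2 \text{ is even},\\ 4 & \text{otherwise}. \end{cases}\]
   Context: The $m \times n$ grid is the plane graph whose vertices are the integer points $(x, y)$ with $1 \le x \le m$ and $1 \le y \le n$ and whose edges are the unit segments between these points; its finite faces are the unit square cells. The signature of a cycle $C$ on the grid is the function assigning to each cell the number of edges of that cell which belong to $C$. The difference between two cycles is the set of all edges which are part of exactly one of the two cycles (the symmetric difference of their edge sets). The two cycles are allowed to coincide, so the greatest size is $0$ when no two distinct cycles share a signature. *)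

theory Defs
  imports Complex_Main
begin

type_synonym point = "int \<times> int"

definition grid_vertices :: "nat \<Rightarrow> nat \<Rightarrow> point set" where
  "grid_vertices m n = {1..int m} \<times> {1..int n}"

definition unit_adjacent :: "point \<Rightarrow> point \<Rightarrow> bool" where
  "unit_adjacent p q \<longleftrightarrow> \<bar>fst p - fst q\<bar> + \<bar>snd p - snd q\<bar> = 1"

definition grid_edges :: "nat \<Rightarrow> nat \<Rightarrow> point set set" where
  "grid_edges m n =
     {{p, q} | p q. p \<in> grid_vertices m n \<and> q \<in> grid_vertices m n \<and> unit_adjacent p q}"

(* A cell is named by its lower-left corner. *)
definition grid_cells :: "nat \<Rightarrow> nat \<Rightarrow> point set" where
  "grid_cells m n = {1..<int m} \<times> {1..<int n}"

definition cell_edges :: "point \<Rightarrow> point set set" where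
  "cell_edges c = (case c of (x, y) \<Rightarrow>
     {{(x, y), (x + 1, y)}, {(x, y + 1), (x + 1, y + 1)},
      {(x, y), (x, y + 1)}, {(x + 1, y), (x + 1, y + 1)}})"

(* A cycle is a simple closed path, represented by its edge set. *)
definition closed_path_edges :: "'a list \<Rightarrow> 'a set set" where
  "closed_path_edges vs = {{vs ! i, vs ! (Suc i mod length vs)} | i. i < length vs}"

definition is_cycle :: "'a set set \<Rightarrow> 'a set set \<Rightarrow> bool" where
  "is_cycle E C \<longleftrightarrow>
     (\<exists>vs. 3 \<le> length vs \<and> distinct vs \<and> C = closed_path_edges vs \<and> C \<subseteq> E)"

definition signature :: "point set set \<Rightarrow> point \<Rightarrow> nat" where
  "signature C c = card (cell_edges c \<inter> C)"

definition same_signature :: "nat \<Rightarrow> nat \<Rightarrow> point set set \<Rightarrow> point set set \<Rightarrow> bool" where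
  "same_signature m n C D \<longleftrightarrow> (\<forall>c \<in> grid_cells m n. signature C c = signature D c)"

definition difference_sizes :: "nat \<Rightarrow> nat \<Rightarrow> nat set" where
  "difference_sizes m n =
     {card (sym_diff C D) | C D.
        is_cycle (grid_edges m n) C \<and> is_cycle (grid_edges m n) D \<and> same_signature m n C D}"

(* The division below is exact. *)
definition delta :: "nat \<Rightarrow> nat \<Rightarrow> nat" where
  "delta m n = (let d = gcd m n in
     if odd d then 1
     else if d mod 4 = 0 then 0
     else if d mod 4 = 2 \<and> 4 \<le> m \<and> 4 \<le> n \<and> even (m * n div d\<^sup>2) then 0
     else 4)"

end

theory Submission
  imports Defs
begin

text \<open>
  Write a cycle as the boundary of the set of cells inside it, and let \<open>V\<close> be the set of cells that are
  inside exactly one of the two cycles. The difference of the cycles is the boundary of \<open>V\<close>, and modulo 2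
  equality of the signatures says that every cell has an even number of neighbours in \<open>V\<close>. Hence
  \<open>(x, y) \<in> V\<close> iff \<open>F (x + y) \<noteq> F (x - y)\<close> for an even function \<open>F\<close> of period \<open>2 d\<close>. With
  \<open>H t = (F t \<noteq> F (t + 1))\<close>, an edge belongs to the difference iff \<open>H\<close> differs on the two diagonals
  through its midpoint, so the difference has \<open>4 k (d - k) m' n'\<close> edges, where \<open>k\<close> counts the
  \<open>t < d\<close> with \<open>H t\<close>. This gives the bound, except that \<open>k = d / 2\<close> has to be excluded when \<open>\<delta> = 4\<close>.
  If \<open>m' n'\<close> is odd, the size of the difference turns out to be divisible by 8; otherwise one side
  of the grid is 2 and a corner cell would have three neighbours outside.

  For the construction, a pair of cycles on a tile extends to an array of tiles: reflect the tile, exchange the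
  roles of the two cycles at each reflection, and join neighbouring tiles through single cells.
  Two comb-shaped regions on the square of side \<open>a + b\<close>, with \<open>a\<close> even, yield \<open>4 a b\<close> differing
  edges; regions on strips of height 4 yield a difference that covers every vertex.\<close>

text \<open>The values of \<open>delta\<close> are squares: \<open>d * d - 4 * (k * (d - k))\<close>
  is the square of \<open>d - 2 * k\<close>, so \<open>delta\<close> measures how near to
  \<open>d / 2\<close> the number \<open>k\<close> can come. Odd \<open>d\<close> costs at least 1.
  For even \<open>d\<close> the condition modulo 2 never rules out \<open>k = d / 2\<close>; the
  obstruction comes from equality of the signatures as integers, by which exactly half of the
  agreeing neighbours of each cell of \<open>V\<close> lie inside both cycles. The teeth of a comb
  occupy every second diagonal, which forces \<open>a\<close> to be even. Hence
  \<open>a = b = d / 2\<close> is available only if 4 divides \<open>d\<close>; for \<open>d\<close>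
  congruent to 2 modulo 4 the best combs have sides \<open>d / 2 - 1\<close> and
  \<open>d / 2 + 1\<close>, at the cost 4. If in that case \<open>m' * n'\<close> is even, then one
  of \<open>m\<close> and \<open>n\<close> is a multiple of 4, and the strips reach the full value
  by a pattern not tied to squares of side \<open>d\<close>: \<open>V\<close> consists of the cells
  with two odd coordinates, and every vertex is a corner of exactly one of them.\<close>

section \<open>Edges of the grid and boundaries of sets of cells\<close>

definition hedge :: "int \<Rightarrow> int \<Rightarrow> point set" where
  "hedge x y = {(x, y), (x + 1, y)}"

definition vedge :: "int \<Rightarrow> int \<Rightarrow> point set" where
  "vedge x y = {(x, y), (x, y + 1)}"

text \<open>Cells carry the name of their lower-left corner, so \<open>hedge x y\<close> separates
  \<open>(x, y)\<close> from \<open>(x, y - 1)\<close>, and \<open>vedge x y\<close> separates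
  \<open>(x, y)\<close> from \<open>(x - 1, y)\<close>. Cells beyond the grid are simply not in the
  set, so outer edges need no special treatment.\<close>

definition boundary :: "point set \<Rightarrow> point set set" where
  "boundary A = {hedge x y | x y. ((x, y) \<in> A) \<noteq> ((x, y - 1) \<in> A)} \<union>
          {vedge x y | x y. ((x, y) \<in> A) \<noteq> ((x - 1, y) \<in> A)}"

lemma hedge_eq_iff [simp]: "hedge x y = hedge x' y' \<longleftrightarrow> x = x' \<and> y = y'"
  by (auto simp: hedge_def doubleton_eq_iff)

lemma vedge_eq_iff [simp]: "vedge x y = vedge x' y' \<longleftrightarrow> x = x' \<and> y = y'"
  by (auto simp: vedge_def doubleton_eq_iff)

lemma hedge_neq_vedge [simp]: "hedge x y \<noteq> vedge x' y'" "vedge x' y' \<noteq> hedge x y"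
  by (auto simp: hedge_def vedge_def doubleton_eq_iff)

lemma vertex_in_hedge [simp]: "(x, y) \<in> hedge a b \<longleftrightarrow> (a = x \<or> a = x - 1) \<and> b = y"
  by (auto simp: hedge_def)

lemma vertex_in_vedge [simp]: "(x, y) \<in> vedge a b \<longleftrightarrow> a = x \<and> (b = y \<or> b = y - 1)"
  by (auto simp: vedge_def)

lemma hedge_in_boundary [simp]: "hedge x y \<in> boundary A \<longleftrightarrow> ((x, y) \<in> A) \<noteq> ((x, y - 1) \<in> A)"
  by (auto simp: boundary_def)

lemma vedge_in_boundary [simp]: "vedge x y \<in> boundary A \<longleftrightarrow> ((x, y) \<in> A) \<noteq> ((x - 1, y) \<in> A)"
  by (auto simp: boundary_def)

lemma cell_edges_eq: "cell_edges (x, y) = {hedge x y, hedge x (y + 1), vedge x y, vedge (x + 1) y}"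
  by (auto simp: cell_edges_def hedge_def vedge_def)

lemma edge_set_eqI:
  assumes "\<And>e. e \<in> S \<Longrightarrow> (\<exists>x y. e = hedge x y \<or> e = vedge x y)"
    and "\<And>e. e \<in> T \<Longrightarrow> (\<exists>x y. e = hedge x y \<or> e = vedge x y)"
    and "\<And>x y. hedge x y \<in> S \<longleftrightarrow> hedge x y \<in> T"
    and "\<And>x y. vedge x y \<in> S \<longleftrightarrow> vedge x y \<in> T"
  shows "S = T"
  using assms by (metis subsetI subset_antisym)

lemma boundary_is_edge: "e \<in> boundary A \<Longrightarrow> \<exists>x y. e = hedge x y \<or> e = vedge x y"
  by (auto simp: boundary_def)

text \<open>Lying in the boundary is the sum modulo 2 of the memberships of the two adjacent cells,
  which is additive in the set.\<close>

lemma boundary_sym_diff: "sym_diff (boundary A) (boundary B) = boundary (sym_diff A B)"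
proof (rule edge_set_eqI)
  fix e assume "e \<in> sym_diff (boundary A) (boundary B)"
  then show "\<exists>x y. e = hedge x y \<or> e = vedge x y" using boundary_is_edge by blast
qed (auto dest: boundary_is_edge)

lemma grid_edges_iff:
  "e \<in> grid_edges m n \<longleftrightarrow>
     (\<exists>x y. e = hedge x y \<and> 1 \<le> x \<and> x < int m \<and> 1 \<le> y \<and> y \<le> int n) \<or>
     (\<exists>x y. e = vedge x y \<and> 1 \<le> x \<and> x \<le> int m \<and> 1 \<le> y \<and> y < int n)" (is "_ \<longleftrightarrow> ?H \<or> ?V")
proof
  assume "e \<in> grid_edges m n"
  then obtain a b c d where e: "e = {(a, b), (c, d)}"
    and ab: "1 \<le> a" "a \<le> int m" "1 \<le> b" "b \<le> int n"
    and cd: "1 \<le> c" "c \<le> int m" "1 \<le> d" "d \<le> int n"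
    and u: "\<bar>a - c\<bar> + \<bar>b - d\<bar> = 1"
    by (auto simp: grid_edges_def grid_vertices_def unit_adjacent_def)
  from u consider "c = a + 1 \<and> d = b" | "a = c + 1 \<and> d = b" | "c = a \<and> d = b + 1" | "c = a \<and> b = d + 1"
    by linarith
  then show "?H \<or> ?V"
  proof cases
    case 1
    then have "e = hedge a b \<and> 1 \<le> a \<and> a < int m \<and> 1 \<le> b \<and> b \<le> int n"
      using e ab cd by (auto simp: hedge_def)
    then show ?thesis by blast
  next
    case 2
    then have "e = hedge c d \<and> 1 \<le> c \<and> c < int m \<and> 1 \<le> d \<and> d \<le> int n"
      using e ab cd by (auto simp: hedge_def)
    then show ?thesis by blast
  next
    case 3
    then have "e = vedge a b \<and> 1 \<le> a \<and> a \<le> int m \<and> 1 \<le> b \<and> b < int n"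
      using e ab cd by (auto simp: vedge_def)
    then show ?thesis by blast
  next
    case 4
    then have "e = vedge c d \<and> 1 \<le> c \<and> c \<le> int m \<and> 1 \<le> d \<and> d < int n"
      using e ab cd by (auto simp: vedge_def)
    then show ?thesis by blast
  qed
next
  assume "?H \<or> ?V"
  then show "e \<in> grid_edges m n"
  proof
    assume ?H
    then obtain x y where "e = hedge x y" "1 \<le> x" "x < int m" "1 \<le> y" "y \<le> int n" by blast
    then show ?thesis
      unfolding grid_edges_def grid_vertices_def unit_adjacent_def hedge_def
      by (intro CollectI exI[of _ "(x, y)"] exI[of _ "(x + 1, y)"]) auto
  next
    assume ?V
    then obtain x y where "e = vedge x y" "1 \<le> x" "x \<le> int m" "1 \<le> y" "y < int n" by blast
    then show ?thesis
      unfolding grid_edges_def grid_vertices_def unit_adjacent_def vedge_def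
      by (intro CollectI exI[of _ "(x, y)"] exI[of _ "(x, y + 1)"]) auto
  qed
qed

lemma hedge_in_grid [simp]:
  "hedge x y \<in> grid_edges m n \<longleftrightarrow> 1 \<le> x \<and> x < int m \<and> 1 \<le> y \<and> y \<le> int n"
  by (auto simp: grid_edges_iff)

lemma vedge_in_grid [simp]:
  "vedge x y \<in> grid_edges m n \<longleftrightarrow> 1 \<le> x \<and> x \<le> int m \<and> 1 \<le> y \<and> y < int n"
  by (auto simp: grid_edges_iff)

lemma in_grid_cells [simp]:
  "(x, y) \<in> grid_cells m n \<longleftrightarrow> 1 \<le> x \<and> x < int m \<and> 1 \<le> y \<and> y < int n"
  by (auto simp: grid_cells_def)

lemma finite_grid_cells [simp]: "finite (grid_cells m n)"
  by (simp add: grid_cells_def)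

lemma boundary_subset_grid:
  assumes "A \<subseteq> grid_cells m n"
  shows "boundary A \<subseteq> grid_edges m n"
proof
  fix e assume e: "e \<in> boundary A"
  have A: "1 \<le> x \<and> x < int m \<and> 1 \<le> y \<and> y < int n" if "(x, y) \<in> A" for x y
    using that assms by auto
  from boundary_is_edge[OF e] obtain x y where "e = hedge x y \<or> e = vedge x y" by blast
  then show "e \<in> grid_edges m n"
    using e A[of x y] A[of "x - 1" y] A[of x "y - 1"] by auto
qed

lemma card_Int_of_bool: "finite S \<Longrightarrow> card (S \<inter> C) = (\<Sum>e\<in>S. of_bool (e \<in> C))"
  by (subst sum_of_bool_eq) (auto intro: arg_cong[where f = card])

text \<open>This is the signature of \<open>boundary A\<close> at a cell inside or outside
  \<open>A\<close>, split by neighbours so that two signatures can be compared term by term.\<close>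

definition boundary_sides :: "point set \<Rightarrow> int \<Rightarrow> int \<Rightarrow> nat" where
  "boundary_sides A x y = of_bool (((x, y) \<in> A) \<noteq> ((x + 1, y) \<in> A)) + of_bool (((x, y) \<in> A) \<noteq> ((x - 1, y) \<in> A))
            + of_bool (((x, y) \<in> A) \<noteq> ((x, y + 1) \<in> A)) + of_bool (((x, y) \<in> A) \<noteq> ((x, y - 1) \<in> A))"

lemma signature_boundary: "signature (boundary A) (x, y) = boundary_sides A x y"
proof -
  have "signature (boundary A) (x, y) = (\<Sum>e\<in>{hedge x y, hedge x (y + 1), vedge x y, vedge (x + 1) y}. of_bool (e \<in> boundary A))"
    unfolding signature_def cell_edges_eq by (rule card_Int_of_bool) simp
  also have "\<dots> = boundary_sides A x y" by (auto simp: boundary_sides_def)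
  finally show ?thesis .
qed

lemma same_signature_boundary:
  "same_signature m n (boundary A) (boundary B) \<longleftrightarrow>
     (\<forall>x y. (x, y) \<in> grid_cells m n \<longrightarrow> boundary_sides A x y = boundary_sides B x y)"
  by (auto simp: same_signature_def signature_boundary simp del: in_grid_cells)

subsection \<open>Cycles are boundaries\<close>

text \<open>A vertex of the path lies only on the edges to its successor and its predecessor; any
  other vertex lies on none.\<close>

lemma even_card_incident_closed_path:
  assumes "distinct vs" and "3 \<le> length vs"
  shows "even (card {e \<in> closed_path_edges vs. p \<in> e})"
proof (cases "p \<in> set vs")
  case False
  then have "{e \<in> closed_path_edges vs. p \<in> e} = {}"
    using assms(2) by (auto simp: closed_path_edges_def in_set_conv_nth)
      (metis Suc_le_lessD gr_implies_not0 mod_less_divisor not_gr_zero numeral_3_eq_3)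
  then show ?thesis by (simp only: card.empty even_zero)
next
  case True
  let ?n = "length vs"
  obtain i where i: "i < ?n" "p = vs ! i" using True by (auto simp: in_set_conv_nth)
  \<comment> \<open>\<open>j\<close> is the cyclic predecessor of \<open>i\<close>. With at least
    three vertices it differs from the successor, so the two edges at \<open>p\<close> are
    distinct.\<close>
  define j where "j = (if i = 0 then ?n - 1 else i - 1)"
  have j: "j < ?n" "Suc j mod ?n = i" using i assms(2) by (auto simp: j_def)
  have uniq: "k = j" if "k < ?n" "Suc k mod ?n = i" for k
    using that i assms(2) by (cases "Suc k = ?n") (auto simp: j_def)
  have nx: "Suc i mod ?n < ?n" by (rule mod_less_divisor) (use i in linarith)
  have neq: "Suc i mod ?n \<noteq> j" using i assms(2) by (cases "Suc i = ?n") (auto simp: j_def)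
  have "{e \<in> closed_path_edges vs. p \<in> e} = {{p, vs ! (Suc i mod ?n)}, {vs ! j, p}}"
  proof
    show "{e \<in> closed_path_edges vs. p \<in> e} \<subseteq> {{p, vs ! (Suc i mod ?n)}, {vs ! j, p}}"
    proof
      fix e assume "e \<in> {e \<in> closed_path_edges vs. p \<in> e}"
      then obtain k where k: "k < ?n" "e = {vs ! k, vs ! (Suc k mod ?n)}" "p \<in> e"
        by (auto simp: closed_path_edges_def)
      have "Suc k mod ?n < ?n" by (rule mod_less_divisor) (use k in linarith)
      with k i assms(1) have "k = i \<or> Suc k mod ?n = i"
        by (auto simp: nth_eq_iff_index_eq)
      then show "e \<in> {{p, vs ! (Suc i mod ?n)}, {vs ! j, p}}"
        using k i uniq by auto
    qed
    show "{{p, vs ! (Suc i mod ?n)}, {vs ! j, p}} \<subseteq> {e \<in> closed_path_edges vs. p \<in> e}"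
    proof -
      have "{p, vs ! (Suc i mod ?n)} \<in> closed_path_edges vs"
        unfolding closed_path_edges_def using i by blast
      moreover have "{vs ! j, p} \<in> closed_path_edges vs"
        unfolding closed_path_edges_def using i j by blast
      ultimately show ?thesis by blast
    qed
  qed
  moreover have "{p, vs ! (Suc i mod ?n)} \<noteq> {vs ! j, p}"
    using neq nx j i assms(1) by (auto simp: doubleton_eq_iff nth_eq_iff_index_eq)
  ultimately show ?thesis by simp
qed

lemma cycle_even_degree:
  assumes "is_cycle (grid_edges m n) C"
  shows "even (of_bool (hedge x y \<in> C) + of_bool (hedge (x - 1) y \<in> C)
             + of_bool (vedge x y \<in> C) + of_bool (vedge x (y - 1) \<in> C) :: nat)"
proof -
  obtain vs where vs: "3 \<le> length vs" "distinct vs" "C = closed_path_edges vs" "C \<subseteq> grid_edges m n"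
    using assms by (auto simp: is_cycle_def)
  let ?S = "{hedge x y, hedge (x - 1) y, vedge x y, vedge x (y - 1)}"
  have "{e \<in> C. (x, y) \<in> e} = ?S \<inter> C"
  proof
    show "{e \<in> C. (x, y) \<in> e} \<subseteq> ?S \<inter> C"
    proof
      fix e assume e: "e \<in> {e \<in> C. (x, y) \<in> e}"
      then have "e \<in> grid_edges m n" using vs by auto
      then consider a b where "e = hedge a b" | a b where "e = vedge a b"
        by (auto simp: grid_edges_iff)
      then show "e \<in> ?S \<inter> C" using e by cases auto
    qed
  qed auto
  then have "even (card (?S \<inter> C))"
    using even_card_incident_closed_path[OF vs(2,1), of "(x, y)"] vs(3) by simp
  moreover have "card (?S \<inter> C) = (\<Sum>e\<in>?S. of_bool (e \<in> C))"
    by (rule card_Int_of_bool) simp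
  moreover have "(\<Sum>e\<in>?S. of_bool (e \<in> C)) = (of_bool (hedge x y \<in> C) + of_bool (hedge (x - 1) y \<in> C)
             + of_bool (vedge x y \<in> C) + of_bool (vedge x (y - 1) \<in> C) :: nat)"
    by simp
  ultimately show ?thesis by simp
qed

text \<open>Whether a cell is inside is decided by the parity of the number of edges of the cycle to its left.\<close>

lemma cycle_is_boundary:
  assumes C: "is_cycle (grid_edges m n) C"
  obtains A where "A \<subseteq> grid_cells m n" and "C = boundary A"
proof -
  have sub: "C \<subseteq> grid_edges m n" using C by (auto simp: is_cycle_def)
  have hC: "1 \<le> x \<and> x < int m \<and> 1 \<le> y \<and> y \<le> int n" if "hedge x y \<in> C" for x y
    using that sub hedge_in_grid by blast
  have vC: "1 \<le> x \<and> x \<le> int m \<and> 1 \<le> y \<and> y < int n" if "vedge x y \<in> C" for x y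
    using that sub vedge_in_grid by blast
  define a where "a x y \<longleftrightarrow> odd (card {i \<in> {1..x}. vedge i y \<in> C})" for x y
  have a0: "\<not> a x y" if "x < 1" for x y using that by (simp add: a_def)
  have av: "vedge x y \<in> C \<longleftrightarrow> a x y \<noteq> a (x - 1) y" for x y
  proof (cases "x < 1")
    case True
    then show ?thesis using a0[of x y] a0[of "x - 1" y] vC by fastforce
  next
    case False
    let ?S = "{i \<in> {1..x - 1}. vedge i y \<in> C}"
    have "{i \<in> {1..x}. vedge i y \<in> C} = (if vedge x y \<in> C then insert x ?S else ?S)"
      using False by (auto, (metis order_le_less zle_diff1_eq)+)
    moreover have "card (insert x ?S) = Suc (card ?S)" 
      by (rule card_insert_disjoint, rule finite_subset[of _ "{1..x - 1}"]) auto
    ultimately have "card {i \<in> {1..x}. vedge i y \<in> C} = (if vedge x y \<in> C then Suc (card ?S) else card ?S)"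
      by presburger
    then show ?thesis unfolding a_def by presburger
  qed
  \<comment> \<open>The even degree of \<open>(x + 1, y)\<close>, with \<open>av\<close> for the two
    vertical edges there, carries the claim from one horizontal edge to the next; left of the grid
    both sides are false.\<close>
  have ah: "hedge x y \<in> C \<longleftrightarrow> a x y \<noteq> a x (y - 1)" for x y
  proof (cases "x < 0")
    case True
    then show ?thesis using a0[of x y] a0[of x "y - 1"] hC by fastforce
  next
    case False
    then have "0 \<le> x" by simp
    then show ?thesis
    proof (induction x rule: int_ge_induct)
      case base
      then show ?case using a0[of 0 y] a0[of 0 "y - 1"] hC[of 0 y] by auto
    next
      case (step x)
      show ?case
        using cycle_even_degree[OF C, of "x + 1" y] step.IH av[of "x + 1" y] av[of "x + 1" "y - 1"]
        by (auto split: if_splits)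
    qed
  qed
  have yl: "\<not> a x y" if "y < 1 \<or> int n \<le> y" for x y
  proof -
    have "{i \<in> {1..x}. vedge i y \<in> C} = {}" using vC that by fastforce
    then show ?thesis by (simp only: a_def card.empty even_zero not_not)
  qed
  \<comment> \<open>Beyond the right side there is no horizontal edge of \<open>C\<close> to cross,
    so the value stays what it is below the grid.\<close>
  have xl: "\<not> a x y" if x: "int m \<le> x" for x y
  proof (cases "y < 1")
    case True
    then show ?thesis using yl by blast
  next
    case False
    then have "0 \<le> y" by simp
    then show ?thesis
    proof (induction y rule: int_ge_induct)
      case base
      then show ?case using yl by simp
    next
      case (step y)
      then show ?case using ah[of x "y + 1"] hC[of x "y + 1"] x by fastforce
    qed
  qed
  define A where "A = {(x, y). a x y}"
  have "A \<subseteq> grid_cells m n"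
    using a0 yl xl by (auto simp: A_def grid_cells_def; meson linorder_not_less)
  moreover have "C = boundary A"
  proof (rule edge_set_eqI)
    fix e assume "e \<in> C"
    then have "e \<in> grid_edges m n" using sub by blast
    then show "\<exists>x y. e = hedge x y \<or> e = vedge x y" by (auto simp: grid_edges_iff)
  qed (auto simp: A_def ah av dest: boundary_is_edge)
  ultimately show ?thesis by (rule that)
qed

subsection \<open>The kernel of the adjacency operator of a rectangle modulo 2\<close>

text \<open>Sums modulo 2 of every second value of \<open>g\<close>: the solution of
  \<open>F (t + 1) = (F (t - 1) \<noteq> g t)\<close> for positive \<open>t\<close> that starts with
  two zeros.\<close>

fun second_sum :: "(int \<Rightarrow> bool) \<Rightarrow> nat \<Rightarrow> bool" where
  "second_sum g 0 = False"
| "second_sum g (Suc 0) = False"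
| "second_sum g (Suc (Suc k)) = (second_sum g k \<noteq> g (int k + 1))"

lemma int_induct_two_step [consumes 1, case_names zero one step]:
  fixes P :: "int \<Rightarrow> bool"
  assumes "0 \<le> t" and "P 0" and "P 1" and step: "\<And>t. 0 \<le> t \<Longrightarrow> P t \<Longrightarrow> P (t + 1) \<Longrightarrow> P (t + 2)"
  shows "P t"
proof -
  have "P t \<and> P (t + 1)" using assms(1)
  proof (induction t rule: int_ge_induct)
    case base
    then show ?case using assms by simp
  next
    case (step t)
    then show ?case using assms(4)[of t] by (simp add: add.assoc)
  qed
  then show ?thesis ..
qed

text \<open>The solution for positive arguments is reflected at 0. For an even \<open>F\<close> the
  recurrence at \<open>t = 0\<close> says that \<open>g 0\<close> is false, which explains the
  second hypothesis.\<close>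

lemma ex_even_second_sum:
  fixes g :: "int \<Rightarrow> bool"
  assumes "\<And>t. g (- t) = g t" and "\<not> g 0"
  obtains F :: "int \<Rightarrow> bool" where "\<And>t. F (- t) = F t" and "\<And>t. F (t + 1) = (F (t - 1) \<noteq> g t)"
proof -
  define F where "F t = second_sum g (nat \<bar>t\<bar>)" for t
  have ev: "F (- t) = F t" for t by (simp add: F_def)
  have pos: "F (t + 1) = (F (t - 1) \<noteq> g t)" if "1 \<le> t" for t
  proof -
    have "nat \<bar>t + 1\<bar> = Suc (Suc (nat (t - 1)))" and "nat \<bar>t - 1\<bar> = nat (t - 1)" "int (nat (t - 1)) + 1 = t"
      using that by linarith+
    then show ?thesis by (simp add: F_def)
  qed
  have "F (t + 1) = (F (t - 1) \<noteq> g t)" for t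
  proof -
    consider "1 \<le> t" | "t = 0" | "1 \<le> - t" by linarith
    then show ?thesis
    proof cases
      case 1 then show ?thesis by (rule pos)
    next
      case 2 then show ?thesis using ev[of 1] assms by simp
    next
      case 3
      then show ?thesis using pos[of "- t"] ev[of "t - 1"] ev[of "t + 1"] assms(1)[of t] by auto
    qed
  qed
  with ev show ?thesis by (rule that)
qed

lemma period_int_mult:
  fixes F :: "int \<Rightarrow> 'a"
  assumes "\<And>t. F (t + p) = F t"
  shows "F (t + k * p) = F t"
proof (induction k rule: int_induct[where k = 0])
  case base
  then show ?case by simp
next
  case (step1 i)
  then show ?case using assms[of "t + i * p"] by (simp add: algebra_simps)
next
  case (step2 i)
  then show ?case using assms[of "t + (i - 1) * p"] by (simp add: algebra_simps)
qed

lemma period_gcd: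
  fixes F :: "int \<Rightarrow> 'a"
  assumes "\<And>t. F (t + p) = F t" and "\<And>t. F (t + q) = F t"
  shows "F (t + gcd p q) = F t"
proof -
  obtain u v where "u * p + v * q = gcd p q" using bezout_int by blast
  then have "F (t + gcd p q) = F ((t + u * p) + v * q)" by (simp add: algebra_simps)
  also have "\<dots> = F t" using period_int_mult[of F, OF assms(1)] period_int_mult[of F, OF assms(2)] by metis
  finally show ?thesis .
qed

text \<open>Modulo 2 the condition on the neighbours is the discrete wave equation, and
  \<open>F (y + x) \<noteq> F (y - x)\<close> is its d'Alembert solution, determined by the empty
  column 0 and by column 1. The empty rows 0 and \<open>n\<close> correspond to evenness and period
  \<open>2 n\<close>, the empty column \<open>m\<close> to period \<open>2 m\<close>.\<close>

lemma kernel_form: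
  fixes m n :: nat and V :: "point set"
  assumes mn: "2 \<le> m" "2 \<le> n" and V: "V \<subseteq> grid_cells m n"
    and harm: "\<And>x y. (x, y) \<in> grid_cells m n \<Longrightarrow>
      (((x + 1, y) \<in> V) \<noteq> ((x - 1, y) \<in> V)) = (((x, y + 1) \<in> V) \<noteq> ((x, y - 1) \<in> V))"
  obtains F :: "int \<Rightarrow> bool" where "\<And>t. F (- t) = F t" and "\<And>t. F (t + 2 * int (gcd m n)) = F t"
    and "\<And>x y. 0 \<le> x \<Longrightarrow> x \<le> int m \<Longrightarrow> 0 \<le> y \<Longrightarrow> y \<le> int n \<Longrightarrow> (x, y) \<in> V \<longleftrightarrow> F (x + y) \<noteq> F (x - y)"
proof -
  define N where "N = int n"
  have N: "2 \<le> N" using mn by (simp add: N_def)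
  define w where "w x y \<longleftrightarrow> (x, y) \<in> V" for x y
  have w0: "\<not> w x y" if "x < 1 \<or> int m \<le> x \<or> y < 1 \<or> N \<le> y" for x y
    using that V by (auto simp: w_def N_def)
  \<comment> \<open>Reflections fold the line onto the interval from 0 to \<open>N\<close>; thus
    \<open>g\<close> continues the first column to an even function of period
    \<open>2 N\<close>.\<close>
  define fold where "fold y = (if y mod (2 * N) \<le> N then y mod (2 * N) else 2 * N - y mod (2 * N))" for y
  define g where "g y = w 1 (fold y)" for y
  have fold_id: "fold y = y" if "0 \<le> y" "y \<le> N" for y
    using that N by (simp add: fold_def)
  have g_per: "g (y + 2 * N) = g y" for y by (simp add: g_def fold_def)
  have g_ev: "g (- y) = g y" for y
  proof (cases "y mod (2 * N) = 0")
    case True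
    then have "(- y) mod (2 * N) = 0" by (simp add: zmod_zminus1_eq_if)
    with True show ?thesis by (simp add: g_def fold_def)
  next
    case False
    then have "(- y) mod (2 * N) = 2 * N - y mod (2 * N)" by (simp add: zmod_zminus1_eq_if)
    then show ?thesis by (auto simp: g_def fold_def)
  qed
  have g0: "\<not> g 0" "\<not> g N" using fold_id[of 0] fold_id[of N] N w0 by (auto simp: g_def)
  obtain F where Fev: "\<And>t. F (- t) = F t" and Frec: "\<And>t. F (t + 1) = (F (t - 1) \<noteq> g t)"
    using ex_even_second_sum[of g] g_ev g0(1) by blast
  \<comment> \<open>\<open>g\<close> is symmetric about \<open>N\<close> and false there, so both
    sides obey the same recurrence from the same start.\<close>
  have FN: "F (N + t) = F (N - t)" if "0 \<le> t" for t
    using that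
  proof (induction t rule: int_induct_two_step)
    case one
    then show ?case using Frec[of N] g0(2) by simp
  next
    case (step t)
    have "g (N + (t + 1)) = g (N - (t + 1))"
      using g_per[of "N - (t + 1) - 2 * N"] g_ev[of "N + (t + 1)"] by (simp add: algebra_simps)
    then show ?case
      using step Frec[of "N + (t + 1)"] Frec[of "N - (t + 1)"] by (simp add: algebra_simps) blast
  qed auto
  have FN': "F (N + t) = F (N - t)" for t
    using FN[of t] FN[of "- t"] by (cases "0 \<le> t") auto
  have per_n: "F (t + 2 * N) = F t" for t
    using FN'[of "N + t"] Fev[of t] by (simp add: algebra_simps)
  have wF: "\<forall>y. 0 \<le> y \<and> y \<le> N \<longrightarrow> w x y = (F (y + x) \<noteq> F (y - x))" if "0 \<le> x" "x \<le> int m" for x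
    using that
  proof (induction x rule: int_induct_two_step)
    case zero
    then show ?case using w0 by auto
  next
    case one
    show ?case
    proof (intro allI impI)
      fix y assume y: "0 \<le> y \<and> y \<le> N"
      then have "w 1 y = g y" by (simp add: g_def fold_id)
      then show "w 1 y = (F (y + 1) \<noteq> F (y - 1))" using Frec[of y] by auto
    qed
  next
    case (step x)
    show ?case
    proof (intro allI impI)
      fix y assume y: "0 \<le> y \<and> y \<le> N"
      consider "y = 0" | "y = N" | "0 < y" "y < N" using y by linarith
      then show "w (x + 2) y = (F (y + (x + 2)) \<noteq> F (y - (x + 2)))"
      proof cases
        case 1
        then show ?thesis using w0 Fev[of "x + 2"] by simp
      next
        case 2
        then show ?thesis using w0 FN'[of "x + 2"] by simp
      next
        case 3
        have "(x + 1, y) \<in> grid_cells m n" using 3 step.prems step.hyps N_def by simp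
        from harm[OF this] have "(w (x + 2) y \<noteq> w x y) = (w (x + 1) (y + 1) \<noteq> w (x + 1) (y - 1))"
          by (simp add: w_def add.assoc)
        moreover have "w x y = (F (y + x) \<noteq> F (y - x))" using step 3 by simp
        moreover have "w (x + 1) (y + 1) = (F ((y + 1) + (x + 1)) \<noteq> F ((y + 1) - (x + 1)))" using step 3 by simp
        moreover have "w (x + 1) (y - 1) = (F ((y - 1) + (x + 1)) \<noteq> F ((y - 1) - (x + 1)))" using step 3 by simp
        ultimately show ?thesis by (auto simp: algebra_simps)
      qed
    qed
  qed
  \<comment> \<open>The empty column \<open>m\<close> speaks only of \<open>t\<close> between 0 and
    \<open>N\<close>; the reflection of \<open>t\<close> to \<open>2 N - t\<close> and the period
    \<open>2 N\<close> then reach all integers.\<close>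
  have Fm0: "F (t + int m) = F (t - int m)" if "0 \<le> t" "t \<le> N" for t
    using wF[of "int m"] that w0[of "int m" t] by auto
  have Fm: "F (t + int m) = F (t - int m)" for t
  proof -
    define r where "r = t mod (2 * N)"
    have r: "0 \<le> r" "r < 2 * N" using N by (auto simp: r_def)
    have t: "t = r + (t div (2 * N)) * (2 * N)" unfolding r_def by (rule mod_div_mult_eq[symmetric])
    have eq: "F (r + int m) = F (r - int m)"
    proof (cases "r \<le> N")
      case True then show ?thesis using Fm0 r by blast
    next
      case False
      have "F (r + int m) = F (2 * N - r - int m)"
        using per_n[of "- r - int m"] Fev[of "r + int m"] by (simp add: algebra_simps)
      also have "\<dots> = F (2 * N - r + int m)" using Fm0[of "2 * N - r"] r False by simp
      also have "\<dots> = F (r - int m)"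
        using per_n[of "- r + int m"] Fev[of "r - int m"] by (simp add: algebra_simps)
      finally show ?thesis .
    qed
    have "F (t + int m) = F ((r + int m) + (t div (2 * N)) * (2 * N))"
      by (rule arg_cong[where f = F]) (use t in linarith)
    moreover have "F (t - int m) = F ((r - int m) + (t div (2 * N)) * (2 * N))"
      by (rule arg_cong[where f = F]) (use t in linarith)
    ultimately show ?thesis using eq period_int_mult[of F, OF per_n] by metis
  qed
  have per_m: "F (t + 2 * int m) = F t" for t using Fm[of "t + int m"] by (simp add: algebra_simps)
  have "gcd (2 * int m) (2 * N) = 2 * int (gcd m n)" by (simp add: N_def gcd_mult_distrib_int[symmetric])
  then have per_d: "F (t + 2 * int (gcd m n)) = F t" for t
    using period_gcd[of F "2 * int m" "2 * N" t] per_m per_n by simp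
  show ?thesis
  proof (rule that[of F])
    fix x y assume "0 \<le> x" "x \<le> int m" "0 \<le> y" "y \<le> int n"
    then show "(x, y) \<in> V \<longleftrightarrow> F (x + y) \<noteq> F (x - y)"
      using wF[of x] Fev[of "x - y"] by (auto simp: w_def N_def add.commute)
  qed (use Fev per_d in auto)
qed

subsection \<open>Counting the boundary edges of a kernel element\<close>

lemma sum_period_shift:
  fixes f :: "int \<Rightarrow> nat"
  assumes "\<And>t. f (t + p) = f t" and "0 \<le> p"
  shows "sum f {a..<a + p} = sum f {0..<p}"
proof -
  have step: "sum f {a + 1..<a + 1 + p} = sum f {a..<a + p}" for a
  proof -
    have "{a..<a + p + 1} = insert (a + p) {a..<a + p}" and "{a..<a + p + 1} = insert a {a + 1..<a + 1 + p}"
      using assms(2) by auto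
    then have "sum f (insert (a + p) {a..<a + p}) = sum f (insert a {a + 1..<a + 1 + p})"
      by simp
    then show ?thesis using assms(1) by simp
  qed
  show ?thesis
  proof (induction a rule: int_induct[where k = 0])
    case (step1 i) then show ?case using step[of i] by simp
  next
    case (step2 i) then show ?case using step[of "i - 1"] by simp
  qed simp
qed

lemma sum_periods:
  fixes f :: "int \<Rightarrow> nat"
  assumes "\<And>t. f (t + p) = f t" and "0 \<le> p"
  shows "sum f {a..<a + int k * p} = k * sum f {0..<p}"
proof (induction k)
  case (Suc k)
  have "0 \<le> int k * p" using assms(2) by simp
  then have "{a..<a + int (Suc k) * p} = {a..<a + int k * p} \<union> {a + int k * p..<a + int k * p + p}"
    using assms(2) ivl_disj_un_two(3)[of a "a + int k * p" "a + int k * p + p"] by (simp add: algebra_simps)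
  then have "sum f {a..<a + int (Suc k) * p} = sum f {a..<a + int k * p} + sum f {a + int k * p..<a + int k * p + p}"
    by (simp add: sum.union_disjoint)
  then show ?case using Suc sum_period_shift[of f p, OF assms] by simp
qed simp

text \<open>Fixing the first index, \<open>s - 2 y\<close> and \<open>s + 1 - 2 y\<close> together run through every residue twice.\<close>

lemma sum_rotated_lattice:
  fixes D :: "int \<Rightarrow> int \<Rightarrow> nat"
  assumes p1: "\<And>s t. D (s + 2 * d) t = D s t" and p2: "\<And>s t. D s (t + 2 * d) = D s t" and d: "0 \<le> d"
  shows "(\<Sum>y\<in>{0..<2 * d}. \<Sum>x\<in>{0..<2 * d}. D (x + y - 1) (x - y) + D (x + y - 1) (x - y - 1))
       = 2 * (\<Sum>s\<in>{0..<2 * d}. \<Sum>t\<in>{0..<2 * d}. D s t)"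
proof -
  have pairs: "(\<Sum>y\<in>{0..<k}. e (s + 1 - 2 * y) + e (s - 2 * y)) = sum e {s + 2 - 2 * k..<s + 2 - 2 * k + 2 * k}"
    if "0 \<le> k" for e :: "int \<Rightarrow> nat" and s k :: int
    using that
  proof (induction k rule: int_ge_induct)
    case (step k)
    have "{0..<k + 1} = insert k {0..<k}" using step by auto
    moreover have "{s + 2 - 2 * (k + 1)..<s + 2 - 2 * (k + 1) + 2 * (k + 1)} =
      insert (s - 2 * k) (insert (s + 1 - 2 * k) {s + 2 - 2 * k..<s + 2 - 2 * k + 2 * k})"
      using step by auto
    ultimately show ?case using step by simp
  qed simp
  have "(\<Sum>x\<in>{0..<2 * d}. D (x + y - 1) (x - y) + D (x + y - 1) (x - y - 1))
      = (\<Sum>s\<in>{0..<2 * d}. D s (s + 1 - 2 * y) + D s (s - 2 * y))" for y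
  proof -
    let ?f = "\<lambda>s. D s (s + 1 - 2 * y) + D s (s - 2 * y)"
    have per: "?f (s + 2 * d) = ?f s" for s
      using p1[of s] p2[of s "s + 1 - 2 * y"] p2[of s "s - 2 * y"] by (simp only: algebra_simps)
    have "(\<Sum>x\<in>{0..<2 * d}. D (x + y - 1) (x - y) + D (x + y - 1) (x - y - 1)) = sum ?f {y - 1..<y - 1 + 2 * d}"
      by (rule sum.reindex_bij_witness[of _ "\<lambda>s. s - y + 1" "\<lambda>x. x + y - 1"]) (auto simp: algebra_simps)
    also have "\<dots> = sum ?f {0..<2 * d}" by (rule sum_period_shift[of ?f, OF per]) (use d in simp)
    finally show ?thesis .
  qed
  then have "(\<Sum>y\<in>{0..<2 * d}. \<Sum>x\<in>{0..<2 * d}. D (x + y - 1) (x - y) + D (x + y - 1) (x - y - 1))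
    = (\<Sum>y\<in>{0..<2 * d}. \<Sum>s\<in>{0..<2 * d}. D s (s + 1 - 2 * y) + D s (s - 2 * y))" by simp
  also have "\<dots> = (\<Sum>s\<in>{0..<2 * d}. \<Sum>y\<in>{0..<2 * d}. D s (s + 1 - 2 * y) + D s (s - 2 * y))"
    by (rule sum.swap)
  also have "\<dots> = (\<Sum>s\<in>{0..<2 * d}. 2 * (\<Sum>t\<in>{0..<2 * d}. D s t))"
  proof (rule sum.cong[OF refl])
    fix s
    have "(\<Sum>y\<in>{0..<2 * d}. D s (s + 1 - 2 * y) + D s (s - 2 * y))
      = sum (D s) {s + 2 - 2 * (2 * d)..<s + 2 - 2 * (2 * d) + int 2 * (2 * d)}"
      using pairs[of "2 * d" "D s" s] d by simp
    also have "\<dots> = 2 * sum (D s) {0..<2 * d}" by (rule sum_periods) (use p2 d in auto)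
    finally show "(\<Sum>y\<in>{0..<2 * d}. D s (s + 1 - 2 * y) + D s (s - 2 * y)) = 2 * (\<Sum>t\<in>{0..<2 * d}. D s t)" .
  qed
  finally show ?thesis by (simp add: sum_distrib_left)
qed

lemma sum_disagreements:
  fixes H :: "'a \<Rightarrow> bool"
  assumes "finite S"
  shows "(\<Sum>s\<in>S. \<Sum>t\<in>S. of_bool (H s \<noteq> H t) :: nat) = 2 * (card {s \<in> S. H s} * (card S - card {s \<in> S. H s}))"
proof -
  let ?K = "{s \<in> S. H s}" and ?L = "{s \<in> S. \<not> H s}"
  have L: "card ?L = card S - card ?K"
  proof -
    have "?L = S - ?K" by auto
    then show ?thesis using assms by (simp add: card_Diff_subset)
  qed
  have inner: "(\<Sum>t\<in>S. of_bool (H s \<noteq> H t) :: nat) = (if H s then card ?L else card ?K)" for s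
    using assms by (auto simp: sum_of_bool_eq intro!: arg_cong[where f = card])
  have "(\<Sum>s\<in>S. \<Sum>t\<in>S. of_bool (H s \<noteq> H t) :: nat) = (\<Sum>s\<in>S. if H s then card ?L else card ?K)"
    by (rule sum.cong[OF refl inner])
  also have "\<dots> = card ?K * card ?L + card ?L * card ?K"
    using assms by (simp add: sum.If_cases Int_def)
  finally show ?thesis by (simp add: L)
qed


lemma sum_torus:
  fixes f :: "int \<Rightarrow> int \<Rightarrow> nat"
  assumes "\<And>x y. f (x + p) y = f x y" and "\<And>x y. f x (y + p) = f x y" and "0 \<le> p"
  shows "(\<Sum>x\<in>{a..<a + int k * p}. \<Sum>y\<in>{b..<b + int l * p}. f x y)
       = k * l * (\<Sum>y\<in>{0..<p}. \<Sum>x\<in>{0..<p}. f x y)"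
proof -
  have "(\<Sum>y\<in>{b..<b + int l * p}. f x y) = l * (\<Sum>y\<in>{0..<p}. f x y)" for x
    by (rule sum_periods) (use assms in auto)
  then have "(\<Sum>x\<in>{a..<a + int k * p}. \<Sum>y\<in>{b..<b + int l * p}. f x y)
    = (\<Sum>x\<in>{a..<a + int k * p}. l * (\<Sum>y\<in>{0..<p}. f x y))" by simp
  also have "\<dots> = k * (\<Sum>x\<in>{0..<p}. l * (\<Sum>y\<in>{0..<p}. f x y))"
    by (rule sum_periods) (use assms in auto)
  also have "\<dots> = k * l * (\<Sum>x\<in>{0..<p}. \<Sum>y\<in>{0..<p}. f x y)" by (simp add: sum_distrib_left mult.assoc)
  also have "(\<Sum>x\<in>{0..<p}. \<Sum>y\<in>{0..<p}. f x y) = (\<Sum>y\<in>{0..<p}. \<Sum>x\<in>{0..<p}. f x y)" by (rule sum.swap)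
  finally show ?thesis .
qed

text \<open>The reflection at 0 folds a period of length \<open>2 m\<close>; its fixed points 0 and
  \<open>m\<close> contribute nothing. This serves the coordinate in which edges have one position
  fewer. In the other coordinate the reflection has no fixed points, which is
  \<open>sum_unfold_half\<close>.\<close>

lemma sum_unfold_integer:
  fixes g :: "int \<Rightarrow> nat"
  assumes "\<And>t. g (- t) = g t" and "g 0 = 0" and "g m = 0" and "1 \<le> m"
  shows "sum g {1 - m..<1 - m + 2 * m} = 2 * sum g {1..<m}"
proof -
  have "{1 - m..<1 - m + 2 * m} = {- (m - 1)..- 1} \<union> ({1..<m} \<union> {0, m})" using assms(4) by auto
  also have "sum g \<dots> = sum g {- (m - 1)..- 1} + (sum g {1..<m} + sum g {0, m})"
    using assms(4) by (subst sum.union_disjoint; (subst sum.union_disjoint)?) auto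
  also have "sum g {0, m} = 0" using assms by simp
  also have "sum g {- (m - 1)..- 1} = sum g {1..<m}"
    by (rule sum.reindex_bij_witness[of _ uminus uminus]) (use assms in auto)
  finally show ?thesis by simp
qed

lemma sum_unfold_half:
  fixes g :: "int \<Rightarrow> nat"
  assumes "\<And>t. g (1 - t) = g t" and "1 \<le> n"
  shows "sum g {1 - n..<1 - n + 2 * n} = 2 * sum g {1..n}"
proof -
  have "{1 - n..<1 - n + 2 * n} = {1 - n..0} \<union> {1..n}" using assms(2) by auto
  also have "sum g \<dots> = sum g {1 - n..0} + sum g {1..n}" by (rule sum.union_disjoint) auto
  also have "sum g {1 - n..0} = sum g {1..n}"
    by (rule sum.reindex_bij_witness[of _ "\<lambda>t. 1 - t" "\<lambda>t. 1 - t"]) (use assms in auto)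
  finally show ?thesis by simp
qed

lemma card_pairs_of_bool:
  assumes "finite S" and "finite T"
  shows "card {(x, y). x \<in> S \<and> y \<in> T \<and> P x y} = (\<Sum>x\<in>S. \<Sum>y\<in>T. of_bool (P x y))"
proof -
  have "(\<Sum>x\<in>S. \<Sum>y\<in>T. of_bool (P x y) :: nat) = (\<Sum>z\<in>S \<times> T. of_bool (P (fst z) (snd z)))"
    by (simp add: sum.cartesian_product case_prod_unfold)
  also have "\<dots> = card {(x, y). x \<in> S \<and> y \<in> T \<and> P x y}"
    using assms by (subst sum_of_bool_eq) (auto intro!: arg_cong[where f = card])
  finally show ?thesis by simp
qed

text \<open>Reflections unfold four copies of the rectangle to a torus of sides \<open>2 m\<close>
  and \<open>2 n\<close>, made of \<open>m' * n'\<close> squares of side \<open>2 d\<close>. In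
  rotated coordinates each square counts, twice, the ordered pairs of residues modulo
  \<open>2 d\<close> on which \<open>H\<close> differs; \<open>H\<close> holds on \<open>2 k\<close>
  residues.\<close>

lemma card_boundary_kernel:
  fixes m n d m' n' :: nat and F :: "int \<Rightarrow> bool"
  assumes mn: "2 \<le> m" "2 \<le> n" and m: "m = d * m'" and n: "n = d * n'"
    and V: "V \<subseteq> grid_cells m n"
    and ev: "\<And>t. F (- t) = F t" and per: "\<And>t. F (t + 2 * int d) = F t"
    and VF: "\<And>x y. 0 \<le> x \<Longrightarrow> x \<le> int m \<Longrightarrow> 0 \<le> y \<Longrightarrow> y \<le> int n \<Longrightarrow> (x, y) \<in> V \<longleftrightarrow> F (x + y) \<noteq> F (x - y)"
  shows "\<exists>k \<le> d. card (boundary V) = 4 * (k * (d - k)) * (m' * n')"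
proof -
  define H where "H t \<longleftrightarrow> F t \<noteq> F (t + 1)" for t
  define D where "D s t = (of_bool (H s \<noteq> H t) :: nat)" for s t
  have Hper: "H (t + 2 * int d) = H t" for t using per[of t] per[of "t + 1"] by (simp add: H_def algebra_simps)
  \<comment> \<open>Evenness of \<open>F\<close> makes \<open>H\<close> symmetric about -1/2, which
    turns the reflections into symmetries of the counts.\<close>
  have Hev: "H (- 1 - t) = H t" for t
  proof -
    have "- 1 - t = - (t + 1)" and "- 1 - t + 1 = - t" by simp_all
    then have "F (- 1 - t) = F (t + 1)" and "F (- 1 - t + 1) = F t" using ev by metis+
    then show ?thesis by (auto simp: H_def)
  qed
  have Hev': "H (- t) = H (t - 1)" for t using Hev[of "t - 1"] by simp
  have Dper: "D (s + 2 * int d) t = D s t" "D s (t + 2 * int d) = D s t" for s t by (simp_all add: D_def Hper)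
  have Hm: "H (t + 2 * int m) = H t" "H (t + 2 * int n) = H t" for t
    using period_int_mult[of H, OF Hper, of t "int m'"] period_int_mult[of H, OF Hper, of t "int n'"]
    by (simp_all add: m n algebra_simps)
  have V1: "1 \<le> x \<and> x < int m \<and> 1 \<le> y \<and> y < int n" if "(x, y) \<in> V" for x y using that V by auto
  define Sh where "Sh = {(x, y). x \<in> {1..<int m} \<and> y \<in> {1..int n} \<and> H (x + y - 1) \<noteq> H (x - y)}"
  define Sv where "Sv = {(x, y). x \<in> {1..int m} \<and> y \<in> {1..<int n} \<and> H (x + y - 1) \<noteq> H (x - y - 1)}"
  have fin: "finite Sh" "finite Sv"
    by (rule finite_subset[of _ "{1..int m} \<times> {1..int n}"]; auto simp: Sh_def Sv_def)+
  have hedge_V: "hedge x y \<in> boundary V \<longleftrightarrow> (x, y) \<in> Sh" for x y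
  proof (cases "1 \<le> x \<and> x < int m \<and> 1 \<le> y \<and> y \<le> int n")
    case True
    then show ?thesis using VF[of x y] VF[of x "y - 1"]
      by (auto simp: Sh_def H_def algebra_simps)
  next
    case False
    then show ?thesis using V1[of x y] V1[of x "y - 1"] by (auto simp: Sh_def)
  qed
  have vedge_V: "vedge x y \<in> boundary V \<longleftrightarrow> (x, y) \<in> Sv" for x y
  proof (cases "1 \<le> x \<and> x \<le> int m \<and> 1 \<le> y \<and> y < int n")
    case True
    then show ?thesis using VF[of x y] VF[of "x - 1" y]
      by (auto simp: Sv_def H_def algebra_simps)
  next
    case False
    then show ?thesis using V1[of x y] V1[of "x - 1" y] by (auto simp: Sv_def)
  qed
  have "boundary V = (\<lambda>(x, y). hedge x y) ` Sh \<union> (\<lambda>(x, y). vedge x y) ` Sv"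
    by (rule edge_set_eqI) (auto dest: boundary_is_edge simp: hedge_V vedge_V simp del: hedge_in_boundary vedge_in_boundary)
  then have "card (boundary V) = card ((\<lambda>(x, y). hedge x y) ` Sh) + card ((\<lambda>(x, y). vedge x y) ` Sv)"
    using fin by (simp only:) (rule card_Un_disjoint; auto)
  also have "\<dots> = card Sh + card Sv"
    by (intro arg_cong2[where f = "(+)"] card_image) (auto simp: inj_on_def)
  finally have N: "card (boundary V) = card Sh + card Sv" .
  let ?Th = "\<lambda>x y. D (x + y - 1) (x - y)" and ?Tv = "\<lambda>x y. D (x + y - 1) (x - y - 1)"
  have Sh: "card Sh = (\<Sum>x\<in>{1..<int m}. \<Sum>y\<in>{1..int n}. ?Th x y)"
    unfolding Sh_def D_def by (rule card_pairs_of_bool) auto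
  have Sv: "card Sv = (\<Sum>x\<in>{1..int m}. \<Sum>y\<in>{1..<int n}. ?Tv x y)"
    unfolding Sv_def D_def by (rule card_pairs_of_bool) auto
  have h1: "(\<Sum>y\<in>{1 - int n..<1 - int n + 2 * int n}. ?Th x y) = 2 * (\<Sum>y\<in>{1..int n}. ?Th x y)" for x
  proof (rule sum_unfold_half)
    fix t show "?Th x (1 - t) = ?Th x t" by (auto simp: D_def algebra_simps)
  qed (use mn in simp)
  have h2: "(\<Sum>x\<in>{1 - int m..<1 - int m + 2 * int m}. \<Sum>y\<in>{1..int n}. ?Th x y) = 2 * card Sh"
    unfolding Sh
  proof (rule sum_unfold_integer)
    fix t
    have "?Th (- t) y = ?Th t y" for y
      using Hev'[of "t - y + 1"] Hev'[of "t + y"] by (auto simp: D_def algebra_simps)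
    then show "(\<Sum>y\<in>{1..int n}. ?Th (- t) y) = (\<Sum>y\<in>{1..int n}. ?Th t y)" by simp
  next
    have "?Th 0 y = 0" for y using Hev'[of y] by (auto simp: D_def algebra_simps)
    then show "(\<Sum>y\<in>{1..int n}. ?Th 0 y) = 0" by simp
  next
    have "?Th (int m) y = 0" for y
    proof -
      have "H (int m - y) = H (- (int m + y))" using Hm(1)[of "- (int m + y)"] by simp
      then show ?thesis using Hev'[of "int m + y"] by (simp add: D_def)
    qed
    then show "(\<Sum>y\<in>{1..int n}. ?Th (int m) y) = 0" by simp
  qed (use mn in simp)
  have v1: "(\<Sum>y\<in>{1 - int n..<1 - int n + 2 * int n}. ?Tv x y) = 2 * (\<Sum>y\<in>{1..<int n}. ?Tv x y)" for x
  proof (rule sum_unfold_integer)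
    fix t show "?Tv x (- t) = ?Tv x t" by (auto simp: D_def algebra_simps)
  next
    show "?Tv x (int n) = 0" using Hm(2)[of "x - int n - 1"] by (auto simp: D_def algebra_simps)
  qed (use mn in \<open>simp_all add: D_def\<close>)
  have v2: "(\<Sum>x\<in>{1 - int m..<1 - int m + 2 * int m}. \<Sum>y\<in>{1..<int n}. ?Tv x y) = 2 * card Sv"
    unfolding Sv
  proof (rule sum_unfold_half)
    fix t
    have "?Tv (1 - t) y = ?Tv t y" for y
      using Hev'[of "t - y"] Hev'[of "t + y"] by (auto simp: D_def algebra_simps)
    then show "(\<Sum>y\<in>{1..<int n}. ?Tv (1 - t) y) = (\<Sum>y\<in>{1..<int n}. ?Tv t y)" by simp
  qed (use mn in simp)
  have M: "1 - int m + 2 * int m = 1 - int m + int m' * (2 * int d)"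
    "1 - int n + 2 * int n = 1 - int n + int n' * (2 * int d)" by (simp_all add: m n)
  have th: "4 * card Sh = m' * n' * (\<Sum>y\<in>{0..<2 * int d}. \<Sum>x\<in>{0..<2 * int d}. ?Th x y)"
  proof -
    have "4 * card Sh = (\<Sum>x\<in>{1 - int m..<1 - int m + 2 * int m}. \<Sum>y\<in>{1 - int n..<1 - int n + 2 * int n}. ?Th x y)"
      unfolding h1 sum_distrib_left[symmetric] h2 by simp
    also have "\<dots> = m' * n' * (\<Sum>y\<in>{0..<2 * int d}. \<Sum>x\<in>{0..<2 * int d}. ?Th x y)"
      unfolding M
    proof (rule sum_torus)
      fix x y
      show "?Th (x + 2 * int d) y = ?Th x y"
        using Hper[of "x + y - 1"] Hper[of "x - y"] by (simp add: D_def algebra_simps)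
      show "?Th x (y + 2 * int d) = ?Th x y"
        using Hper[of "x + y - 1"] Hper[of "x - y - 2 * int d"] by (simp add: D_def algebra_simps)
    qed simp
    finally show ?thesis .
  qed
  have tv: "4 * card Sv = m' * n' * (\<Sum>y\<in>{0..<2 * int d}. \<Sum>x\<in>{0..<2 * int d}. ?Tv x y)"
  proof -
    have "4 * card Sv = (\<Sum>x\<in>{1 - int m..<1 - int m + 2 * int m}. \<Sum>y\<in>{1 - int n..<1 - int n + 2 * int n}. ?Tv x y)"
      unfolding v1 sum_distrib_left[symmetric] v2 by simp
    also have "\<dots> = m' * n' * (\<Sum>y\<in>{0..<2 * int d}. \<Sum>x\<in>{0..<2 * int d}. ?Tv x y)"
      unfolding M
    proof (rule sum_torus)
      fix x y
      show "?Tv (x + 2 * int d) y = ?Tv x y"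
        using Hper[of "x + y - 1"] Hper[of "x - y - 1"] by (simp add: D_def algebra_simps)
      show "?Tv x (y + 2 * int d) = ?Tv x y"
        using Hper[of "x + y - 1"] Hper[of "x - y - 1 - 2 * int d"] by (simp add: D_def algebra_simps)
    qed simp
    finally show ?thesis .
  qed
  define k where "k = card {t \<in> {0..<int d}. H t}"
  have "k \<le> card {0..<int d}" unfolding k_def by (rule card_mono) auto
  then have k: "k \<le> d" by simp
  \<comment> \<open>The reflection of \<open>t\<close> to \<open>2 d - 1 - t\<close> exchanges the
    two halves of the period.\<close>
  have K: "card {t \<in> {0..<2 * int d}. H t} = 2 * k"
  proof -
    have "{t \<in> {0..<2 * int d}. H t} = {t \<in> {0..<int d}. H t} \<union> {t \<in> {int d..<2 * int d}. H t}" by auto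
    also have "card \<dots> = k + card {t \<in> {int d..<2 * int d}. H t}"
      unfolding k_def by (rule card_Un_disjoint) (auto intro: finite_subset[of _ "{0..<2 * int d}"])
    also have "card {t \<in> {int d..<2 * int d}. H t} = k"
      unfolding k_def
    proof (rule bij_betw_same_card[of "\<lambda>t. 2 * int d - 1 - t"],
        rule bij_betw_byWitness[where f' = "\<lambda>t. 2 * int d - 1 - t"])
      have *: "H (2 * int d - 1 - t) = H t" for t
        using Hper[of "- 1 - t"] Hev[of t] by (simp add: algebra_simps)
      show "(\<lambda>t. 2 * int d - 1 - t) ` {t \<in> {int d..<2 * int d}. H t} \<subseteq> {t \<in> {0..<int d}. H t}"
        "(\<lambda>t. 2 * int d - 1 - t) ` {t \<in> {0..<int d}. H t} \<subseteq> {t \<in> {int d..<2 * int d}. H t}"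
        using * by auto
    qed auto
    finally show ?thesis by simp
  qed
  have "4 * card (boundary V) = m' * n' *
      (\<Sum>y\<in>{0..<2 * int d}. \<Sum>x\<in>{0..<2 * int d}. ?Th x y + ?Tv x y)"
    using th tv N by (simp add: sum.distrib distrib_left)
  also have "(\<Sum>y\<in>{0..<2 * int d}. \<Sum>x\<in>{0..<2 * int d}. ?Th x y + ?Tv x y)
      = 2 * (\<Sum>s\<in>{0..<2 * int d}. \<Sum>t\<in>{0..<2 * int d}. D s t)"
    by (rule sum_rotated_lattice) (use Dper in auto)
  also have "(\<Sum>s\<in>{0..<2 * int d}. \<Sum>t\<in>{0..<2 * int d}. D s t) = 2 * (2 * k * (2 * d - 2 * k))"
  proof -
    have "card {0..<2 * int d} = 2 * d" by simp
    then show ?thesis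
      unfolding D_def using sum_disagreements[of "{0..<2 * int d}" H] by (simp only: K mult.assoc finite_atLeastLessThan_int)
  qed
  finally have "card (boundary V) = 4 * (k * (d - k)) * (m' * n')"
    by (simp add: diff_mult_distrib2[symmetric] algebra_simps)
  then show ?thesis using k by blast
qed

subsection \<open>Cells on which two cycles with the same signature disagree\<close>

definition nbrs_in :: "point set \<Rightarrow> int \<Rightarrow> int \<Rightarrow> nat" where
  "nbrs_in S x y = of_bool ((x + 1, y) \<in> S) + of_bool ((x - 1, y) \<in> S)
                 + of_bool ((x, y + 1) \<in> S) + of_bool ((x, y - 1) \<in> S)"

lemma sum_shift_count:
  fixes S T :: "point set"
  assumes "finite S" and "finite T"
  shows "(\<Sum>(x, y)\<in>S. of_bool ((x + a, y + b) \<in> T) :: nat) = (\<Sum>(x, y)\<in>T. of_bool ((x - a, y - b) \<in> S))"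
proof -
  have "(\<Sum>(x, y)\<in>S. of_bool ((x + a, y + b) \<in> T) :: nat) = (\<Sum>(x, y)\<in>{(x, y) \<in> S. (x + a, y + b) \<in> T}. 1)"
    using assms(1) by (intro sum.mono_neutral_cong_right) auto
  also have "\<dots> = (\<Sum>(x, y)\<in>{(x, y) \<in> T. (x - a, y - b) \<in> S}. 1)"
    by (rule sum.reindex_bij_witness[of _ "\<lambda>(x, y). (x - a, y - b)" "\<lambda>(x, y). (x + a, y + b)"]) auto
  also have "\<dots> = (\<Sum>(x, y)\<in>T. of_bool ((x - a, y - b) \<in> S))"
    using assms(2) by (intro sum.mono_neutral_cong_left) auto
  finally show ?thesis .
qed

lemma nbrs_in_double_count:
  assumes "finite S" and "finite T"
  shows "(\<Sum>(x, y)\<in>S. nbrs_in T x y) = (\<Sum>(x, y)\<in>T. nbrs_in S x y)"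
  using sum_shift_count[OF assms, of 1 0] sum_shift_count[OF assms, of "- 1" 0]
    sum_shift_count[OF assms, of 0 1] sum_shift_count[OF assms, of 0 "- 1"]
  by (simp add: nbrs_in_def case_prod_unfold sum.distrib)

text \<open>A boundary edge has exactly one of its two cells in \<open>V\<close>, so it is counted
  once.\<close>

lemma card_boundary_eq_sum:
  assumes "finite V"
  shows "card (boundary V) = (\<Sum>(x, y)\<in>V. boundary_sides V x y)"
proof -
  have "boundary V = (\<Union>c\<in>V. cell_edges c \<inter> boundary V)"
  proof
    show "boundary V \<subseteq> (\<Union>c\<in>V. cell_edges c \<inter> boundary V)"
    proof
      fix e assume e: "e \<in> boundary V"
      from boundary_is_edge[OF e] obtain x y where "e = hedge x y \<or> e = vedge x y" by blast
      then have "\<exists>c\<in>V. e \<in> cell_edges c"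
      proof
        assume h: "e = hedge x y"
        then have "(x, y) \<in> V \<or> (x, y - 1) \<in> V" using e by auto
        then show ?thesis using h by (auto simp: cell_edges_eq intro: bexI[rotated])
      next
        assume v: "e = vedge x y"
        then have "(x, y) \<in> V \<or> (x - 1, y) \<in> V" using e by auto
        then show ?thesis using v by (auto simp: cell_edges_eq intro: bexI[rotated])
      qed
      with e show "e \<in> (\<Union>c\<in>V. cell_edges c \<inter> boundary V)" by blast
    qed
  qed blast
  then have "card (boundary V) = card (\<Union>c\<in>V. cell_edges c \<inter> boundary V)" by simp
  also have "\<dots> = (\<Sum>c\<in>V. card (cell_edges c \<inter> boundary V))"
  proof (rule card_UN_disjoint)
    show "\<forall>c\<in>V. \<forall>c'\<in>V. c \<noteq> c' \<longrightarrow> (cell_edges c \<inter> boundary V) \<inter> (cell_edges c' \<inter> boundary V) = {}"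
      by (auto simp: cell_edges_eq)
  qed (use assms in \<open>auto simp: cell_edges_eq\<close>)
  also have "\<dots> = (\<Sum>(x, y)\<in>V. boundary_sides V x y)"
    by (rule sum.cong) (auto simp: signature_boundary[unfolded signature_def])
  finally show ?thesis .
qed

context
  fixes m n :: nat and A B V :: "point set"
  assumes A: "A \<subseteq> grid_cells m n" and B: "B \<subseteq> grid_cells m n"
    and same: "\<And>x y. (x, y) \<in> grid_cells m n \<Longrightarrow> boundary_sides A x y = boundary_sides B x y"
  defines "V \<equiv> sym_diff A B"
begin

lemma disagreement_sub: "V \<subseteq> grid_cells m n" using A B by (auto simp: V_def)

text \<open>For each neighbour the terms of the two signatures have an even sum iff the neighbour
  and the cell have equal membership in \<open>V\<close>. Over four neighbours the membership of the
  cell itself cancels.\<close>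

lemma disagreement_harmonic:
  assumes "(x, y) \<in> grid_cells m n"
  shows "(((x + 1, y) \<in> V) \<noteq> ((x - 1, y) \<in> V)) = (((x, y + 1) \<in> V) \<noteq> ((x, y - 1) \<in> V))"
proof -
  define q where "q c = (of_bool (((x, y) \<in> A) \<noteq> (c \<in> A)) + of_bool (((x, y) \<in> B) \<noteq> (c \<in> B)) :: nat)" for c
  have q: "even (q c) \<longleftrightarrow> ((x, y) \<in> V) = (c \<in> V)" for c by (auto simp: q_def V_def)
  have "even (boundary_sides A x y + boundary_sides B x y)" using same[OF assms] by simp
  then have "even (q (x + 1, y) + q (x - 1, y) + q (x, y + 1) + q (x, y - 1))"
    by (simp add: boundary_sides_def q_def add_ac)
  then show ?thesis unfolding even_add q by blast
qed

text \<open>On a cell where the insides disagree the terms of the signatures coming from disagreeing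
  neighbours cancel, so the agreeing neighbours are balanced.\<close>

lemma disagreement_balanced:
  assumes "(x, y) \<in> V"
  shows "boundary_sides V x y = 2 * nbrs_in (A - V) x y"
proof -
  define a where "a c = (of_bool (((x, y) \<in> A) \<noteq> (c \<in> A)) :: nat)" for c
  define b where "b c = (of_bool (((x, y) \<in> B) \<noteq> (c \<in> B)) :: nat)" for c
  define u where "u c = (of_bool (((x, y) \<in> V) \<noteq> (c \<in> V)) :: nat)" for c
  define r where "r c = (of_bool (c \<in> A - V) :: nat)" for c
  have xy: "(x, y) \<in> A \<longleftrightarrow> (x, y) \<notin> B" using assms by (auto simp: V_def)
  have eq: "(x, y) \<in> A \<and> a c + 2 * r c = b c + u c \<or> (x, y) \<notin> A \<and> b c + 2 * r c = a c + u c" for c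
    using xy assms by (auto simp: a_def b_def u_def r_def V_def)
  have "boundary_sides A x y = boundary_sides B x y" using same disagreement_sub assms by blast
  then have "a (x + 1, y) + a (x - 1, y) + a (x, y + 1) + a (x, y - 1)
           = b (x + 1, y) + b (x - 1, y) + b (x, y + 1) + b (x, y - 1)"
    by (simp add: boundary_sides_def a_def b_def)
  note sums = this
  have "u (x + 1, y) + u (x - 1, y) + u (x, y + 1) + u (x, y - 1)
     = 2 * (r (x + 1, y) + r (x - 1, y) + r (x, y + 1) + r (x, y - 1))"
  proof (cases "(x, y) \<in> A")
    case True
    then have "a c + 2 * r c = b c + u c" for c using eq by blast
    from this[of "(x + 1, y)"] this[of "(x - 1, y)"] this[of "(x, y + 1)"] this[of "(x, y - 1)"] sums
    show ?thesis by (simp add: algebra_simps)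
  next
    case False
    then have "b c + 2 * r c = a c + u c" for c using eq by blast
    from this[of "(x + 1, y)"] this[of "(x - 1, y)"] this[of "(x, y + 1)"] this[of "(x, y - 1)"] sums
    show ?thesis by (simp add: algebra_simps)
  qed
  then show ?thesis by (simp only: boundary_sides_def nbrs_in_def u_def r_def)
qed

text \<open>At least three neighbours of the corner cell lie outside the grid, hence agree and are
  outside both cycles, whereas \<open>disagreement_balanced\<close> wants half of the agreeing
  neighbours inside.\<close>

lemma corner_not_in_disagreement:
  assumes "m = 2 \<or> n = 2"
  shows "(1, 1) \<notin> V"
proof
  assume "(1, 1) \<in> V"
  then have "boundary_sides V 1 1 = 2 * nbrs_in (A - V) 1 1" by (rule disagreement_balanced)
  moreover have out: "c \<notin> V \<and> c \<notin> A - V" if "c \<notin> grid_cells m n" for c using that disagreement_sub A by blast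
  ultimately show False
    using \<open>(1, 1) \<in> V\<close> assms out[of "(0, 1)"] out[of "(1, 0)"] out[of "(2, 1)"] out[of "(1, 2)"]
    by (auto simp: boundary_sides_def nbrs_in_def of_bool_def split: if_splits)
qed

end

subsection \<open>The number of differing edges modulo 8\<close>

text \<open>The half turn about \<open>(a / 2, b / 2)\<close> pairs the cells, and a pair
  contributes twice an even number; only a central cell needs separate control.\<close>

lemma dvd4_sum_rotation:
  fixes Z :: "point set" and f :: "int \<Rightarrow> int \<Rightarrow> nat"
  assumes fin: "finite Z" and rot: "\<And>x y. (x, y) \<in> Z \<Longrightarrow> (a - x, b - y) \<in> Z"
    and f: "\<And>x y. (x, y) \<in> Z \<Longrightarrow> f (a - x) (b - y) = f x y"
    and ev: "\<And>x y. (x, y) \<in> Z \<Longrightarrow> even (f x y)"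
    and fix4: "\<And>x y. (x, y) \<in> Z \<Longrightarrow> 2 * x = a \<Longrightarrow> 2 * y = b \<Longrightarrow> 4 dvd f x y"
  shows "4 dvd (\<Sum>(x, y)\<in>Z. f x y)"
proof -
  define L where "L = {(x, y) \<in> Z. 2 * x < a \<or> (2 * x = a \<and> 2 * y < b)}"
  define R where "R = {(x, y) \<in> Z. 2 * x > a \<or> (2 * x = a \<and> 2 * y > b)}"
  define E where "E = {(x, y) \<in> Z. 2 * x = a \<and> 2 * y = b}"
  have Z: "Z = L \<union> (R \<union> E)" by (auto simp: L_def R_def E_def)
  have fin': "finite L" "finite R" "finite E"
    using fin by (auto simp: L_def R_def E_def intro: finite_subset[of _ Z])
  have "(\<Sum>(x, y)\<in>Z. f x y) = (\<Sum>(x, y)\<in>L. f x y) + ((\<Sum>(x, y)\<in>R. f x y) + (\<Sum>(x, y)\<in>E. f x y))"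
    unfolding Z using fin'
    by (subst sum.union_disjoint; (subst sum.union_disjoint)?) (auto simp: L_def R_def E_def)
  also have "(\<Sum>(x, y)\<in>R. f x y) = (\<Sum>(x, y)\<in>L. f x y)"
    by (rule sum.reindex_bij_witness[of _ "\<lambda>(x, y). (a - x, b - y)" "\<lambda>(x, y). (a - x, b - y)"])
      (use rot f in \<open>auto simp: L_def R_def\<close>)
  finally have "(\<Sum>(x, y)\<in>Z. f x y) = 2 * (\<Sum>(x, y)\<in>L. f x y) + (\<Sum>(x, y)\<in>E. f x y)" by simp
  moreover have "2 * 2 dvd 2 * (\<Sum>(x, y)\<in>L. f x y)"
    by (intro mult_dvd_mono dvd_refl dvd_sum) (use ev in \<open>auto simp: L_def\<close>)
  moreover have "4 dvd (\<Sum>(x, y)\<in>E. f x y)" by (rule dvd_sum) (use fix4 in \<open>auto simp: E_def\<close>)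
  ultimately show ?thesis by simp
qed

text \<open>The weight \<open>[odd x] + [F (x + y)]\<close> splits the disagreeing neighbours of every cell into halves
  modulo 2, which turns the count of differing edges into a sum invariant under the half turn.\<close>

lemma card_boundary_dvd_8:
  fixes m n d m' n' :: nat and F :: "int \<Rightarrow> bool" and V A :: "point set"
  assumes m: "m = d * m'" and n: "n = d * n'" and odd: "odd m'" "odd n'" and d: "even d"
    and V: "V \<subseteq> grid_cells m n" and A: "A \<subseteq> grid_cells m n"
    and bal: "\<And>x y. (x, y) \<in> V \<Longrightarrow> boundary_sides V x y = 2 * nbrs_in (A - V) x y"
    and ev: "\<And>t. F (- t) = F t" and per: "\<And>t. F (t + 2 * int d) = F t"
    and VF: "\<And>x y. 0 \<le> x \<Longrightarrow> x \<le> int m \<Longrightarrow> 0 \<le> y \<Longrightarrow> y \<le> int n \<Longrightarrow> (x, y) \<in> V \<longleftrightarrow> F (x + y) \<noteq> F (x - y)"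
  shows "8 dvd card (boundary V)"
proof -
  define Z where "Z = {(x, y) \<in> V. odd x \<noteq> F (x + y)}"
  have fin: "finite V" "finite Z" "finite (A - V)"
    using V A finite_subset[OF _ finite_grid_cells[of m n]] by (auto simp: Z_def intro: finite_subset[of _ V])
  have "card (boundary V) = (\<Sum>(x, y)\<in>V. boundary_sides V x y)" by (rule card_boundary_eq_sum) (rule fin)
  also have "\<dots> = 2 * (\<Sum>(x, y)\<in>V. nbrs_in (A - V) x y)"
    using bal by (auto simp: sum_distrib_left intro!: sum.cong)
  also have "(\<Sum>(x, y)\<in>V. nbrs_in (A - V) x y) = (\<Sum>(x, y)\<in>A - V. nbrs_in V x y)"
    by (rule nbrs_in_double_count) (use fin in auto)
  finally have N: "card (boundary V) = 2 * (\<Sum>(x, y)\<in>A - V. nbrs_in V x y)" .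
  \<comment> \<open>Of the 0, 2 or 4 neighbours in \<open>V\<close> exactly half lie in
    \<open>Z\<close>, whatever the four values of \<open>F\<close> are.\<close>
  have pointwise: "nbrs_in V x y mod 4 = 2 * nbrs_in Z x y mod 4" if "(x, y) \<in> A - V" for x y
  proof -
    have xy: "1 \<le> x" "x < int m" "1 \<le> y" "y < int n" using that A by auto
    have "(x + 1, y) \<in> V \<longleftrightarrow> F (x + y + 1) \<noteq> F (x - y + 1)" "(x - 1, y) \<in> V \<longleftrightarrow> F (x + y - 1) \<noteq> F (x - y - 1)"
      "(x, y + 1) \<in> V \<longleftrightarrow> F (x + y + 1) \<noteq> F (x - y - 1)" "(x, y - 1) \<in> V \<longleftrightarrow> F (x + y - 1) \<noteq> F (x - y + 1)"
      using VF[of "x + 1" y] VF[of "x - 1" y] VF[of x "y + 1"] VF[of x "y - 1"] xy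
      by (simp_all add: algebra_simps)
    moreover have "(x + 1, y) \<in> Z \<longleftrightarrow> (x + 1, y) \<in> V \<and> even x \<noteq> F (x + y + 1)"
      "(x - 1, y) \<in> Z \<longleftrightarrow> (x - 1, y) \<in> V \<and> even x \<noteq> F (x + y - 1)"
      "(x, y + 1) \<in> Z \<longleftrightarrow> (x, y + 1) \<in> V \<and> odd x \<noteq> F (x + y + 1)"
      "(x, y - 1) \<in> Z \<longleftrightarrow> (x, y - 1) \<in> V \<and> odd x \<noteq> F (x + y - 1)"
      by (auto simp: Z_def algebra_simps)
    ultimately show ?thesis
      unfolding nbrs_in_def
      by (cases "F (x + y + 1)"; cases "F (x + y - 1)"; cases "F (x - y + 1)"; cases "F (x - y - 1)"; cases "even x"; simp)
  qed
  have "(\<Sum>(x, y)\<in>A - V. nbrs_in V x y) mod 4 = (\<Sum>(x, y)\<in>A - V. 2 * nbrs_in Z x y) mod 4"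
  proof -
    have "(\<Sum>(x, y)\<in>A - V. nbrs_in V x y) mod 4 = (\<Sum>c\<in>A - V. (case c of (x, y) \<Rightarrow> nbrs_in V x y) mod 4) mod 4"
      by (simp add: mod_sum_eq)
    also have "\<dots> = (\<Sum>c\<in>A - V. (case c of (x, y) \<Rightarrow> 2 * nbrs_in Z x y) mod 4) mod 4"
      by (rule arg_cong[where f = "\<lambda>s. s mod 4"], rule sum.cong) (use pointwise in auto)
    finally show ?thesis by (simp add: mod_sum_eq)
  qed
  \<comment> \<open>Counted from \<open>Z\<close>, twice the neighbours in \<open>A - V\<close>
    become sides of \<open>V\<close> by \<open>bal\<close>. This removes \<open>A\<close>, which
    need not be symmetric.\<close>
  also have "(\<Sum>(x, y)\<in>A - V. 2 * nbrs_in Z x y) = 2 * (\<Sum>(x, y)\<in>Z. nbrs_in (A - V) x y)"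
    using nbrs_in_double_count[OF fin(2,3)] by (simp add: sum_distrib_left case_prod_unfold)
  also have "\<dots> = (\<Sum>(x, y)\<in>Z. boundary_sides V x y)"
    using bal by (auto simp: sum_distrib_left Z_def intro!: sum.cong)
  finally have N4: "(\<Sum>(x, y)\<in>A - V. nbrs_in V x y) mod 4 = (\<Sum>(x, y)\<in>Z. boundary_sides V x y) mod 4" .
  obtain i j where ij: "m' = 2 * i + 1" "n' = 2 * j + 1" using odd by (auto elim!: oddE)
  \<comment> \<open>As \<open>m'\<close> and \<open>n'\<close> are odd, \<open>m + n\<close> and
    \<open>m - n\<close> are multiples of the period \<open>2 d\<close>; this makes
    \<open>F\<close>, and hence \<open>V\<close>, invariant under the half turn.\<close>
  have sum_mn: "int m + int n = int (i + j + 1) * (2 * int d)" "int m - int n = (int i - int j) * (2 * int d)"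
    by (simp_all add: m n ij algebra_simps)
  have rotF: "F (int m + int n - t) = F t" "F (int m - int n - t) = F t" for t
    using period_int_mult[of F, OF per, of "- t"] ev[of t] unfolding sum_mn by (simp_all add: add.commute)
  have Vrect: "(x, y) \<in> V \<longleftrightarrow> 0 \<le> x \<and> x \<le> int m \<and> 0 \<le> y \<and> y \<le> int n \<and> F (x + y) \<noteq> F (x - y)" for x y
    using VF[of x y] V by auto
  have rotV: "(int m - x, int n - y) \<in> V \<longleftrightarrow> (x, y) \<in> V" for x y
  proof -
    have "F ((int m - x) + (int n - y)) = F (x + y)" "F ((int m - x) - (int n - y)) = F (x - y)"
      using rotF(1)[of "x + y"] rotF(2)[of "x - y"] by (simp_all add: algebra_simps)
    then show ?thesis unfolding Vrect by auto
  qed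
  have "4 dvd (\<Sum>(x, y)\<in>Z. boundary_sides V x y)"
  proof (rule dvd4_sum_rotation[where a = "int m" and b = "int n"])
    fix x y assume xy: "(x, y) \<in> Z"
    then have xyV: "(x, y) \<in> V" by (simp add: Z_def)
    have "even (int m)" using m d by simp
    moreover have "F ((int m - x) + (int n - y)) = F (x + y)"
      using rotF(1)[of "x + y"] by (simp add: algebra_simps)
    ultimately show "(int m - x, int n - y) \<in> Z" using xy rotV by (simp add: Z_def)
    have "(int m - x + 1, int n - y) \<in> V \<longleftrightarrow> (x - 1, y) \<in> V" "(int m - x - 1, int n - y) \<in> V \<longleftrightarrow> (x + 1, y) \<in> V"
      "(int m - x, int n - y + 1) \<in> V \<longleftrightarrow> (x, y - 1) \<in> V" "(int m - x, int n - y - 1) \<in> V \<longleftrightarrow> (x, y + 1) \<in> V"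
      using rotV[of "x - 1" y] rotV[of "x + 1" y] rotV[of x "y - 1"] rotV[of x "y + 1"]
      by (simp_all add: algebra_simps)
    then show "boundary_sides V (int m - x) (int n - y) = boundary_sides V x y" by (simp add: boundary_sides_def rotV)
    show "even (boundary_sides V x y)" using bal[OF xyV] by simp
    \<comment> \<open>At the centre opposite neighbours are exchanged and \<open>F\<close> equates
      the two directions, so all four neighbours have the same membership: the cell has no sides or
      four.\<close>
    assume c: "2 * x = int m" "2 * y = int n"
    have "int m + int n - (x + y - 1) = x + y + 1" "int m - int n - (x - y - 1) = x - y + 1" using c by linarith+
    then have e1: "F (x + y + 1) = F (x + y - 1)" and e2: "F (x - y + 1) = F (x - y - 1)"
      using rotF(1)[of "x + y - 1"] rotF(2)[of "x - y - 1"] by metis+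
    have r: "1 \<le> x" "x < int m" "1 \<le> y" "y < int n" using xyV V by auto
    have "(x + 1, y) \<in> V \<longleftrightarrow> F (x + y + 1) \<noteq> F (x - y + 1)" "(x - 1, y) \<in> V \<longleftrightarrow> F (x + y - 1) \<noteq> F (x - y - 1)"
      "(x, y + 1) \<in> V \<longleftrightarrow> F (x + y + 1) \<noteq> F (x - y - 1)" "(x, y - 1) \<in> V \<longleftrightarrow> F (x + y - 1) \<noteq> F (x - y + 1)"
      using VF[of "x + 1" y] VF[of "x - 1" y] VF[of x "y + 1"] VF[of x "y - 1"] r
      by (simp_all add: algebra_simps)
    moreover have "(4 :: nat) dvd Suc (Suc (Suc (Suc 0)))" by presburger
    ultimately show "4 dvd boundary_sides V x y" using e1 e2 xyV by (auto simp: boundary_sides_def)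
  qed (rule fin)
  then have "4 dvd (\<Sum>(x, y)\<in>A - V. nbrs_in V x y)" using N4 by (simp only: mod_eq_0_iff_dvd[symmetric])
  then have "2 * 4 dvd card (boundary V)" unfolding N by (intro mult_dvd_mono dvd_refl)
  then show ?thesis by simp
qed

subsection \<open>The upper bound\<close>

lemma difference_le:
  fixes m n d m' n' s :: nat
  assumes mn: "2 \<le> m" "2 \<le> n" and d: "d = gcd m n" and m: "m = d * m'" and n: "n = d * n'"
    and s: "s \<in> difference_sizes m n"
  shows "s + delta m n * (m' * n') \<le> m * n"
proof -
  obtain C D where CD: "is_cycle (grid_edges m n) C" "is_cycle (grid_edges m n) D" "same_signature m n C D"
    "s = card (sym_diff C D)"
    using s by (auto simp: difference_sizes_def)
  obtain A where A: "A \<subseteq> grid_cells m n" "C = boundary A" using cycle_is_boundary[OF CD(1)] by blast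
  obtain B where B: "B \<subseteq> grid_cells m n" "D = boundary B" using cycle_is_boundary[OF CD(2)] by blast
  have same: "boundary_sides A x y = boundary_sides B x y" if "(x, y) \<in> grid_cells m n" for x y
    using CD(3) that unfolding A(2) B(2) same_signature_boundary by blast
  define V where "V = sym_diff A B"
  have sV: "s = card (boundary V)" using CD(4) by (simp only: A(2) B(2) V_def boundary_sym_diff)
  have V1: "V \<subseteq> grid_cells m n" using A(1) B(1) by (auto simp: V_def)
  have V2: "(((x + 1, y) \<in> V) \<noteq> ((x - 1, y) \<in> V)) = (((x, y + 1) \<in> V) \<noteq> ((x, y - 1) \<in> V))"
    if "(x, y) \<in> grid_cells m n" for x y
    unfolding V_def by (rule disagreement_harmonic[OF A(1) B(1) same that])
  have V3: "boundary_sides V x y = 2 * nbrs_in (A - V) x y" if "(x, y) \<in> V" for x y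
    using disagreement_balanced[OF A(1) B(1) same, of x y] that unfolding V_def by blast
  have V4: "(1, 1) \<notin> V" if "m = 2 \<or> n = 2"
    unfolding V_def by (rule corner_not_in_disagreement[OF A(1) B(1) same that])
  obtain F :: "int \<Rightarrow> bool" where ev: "\<And>t. F (- t) = F t" and per: "\<And>t. F (t + 2 * int d) = F t"
    and VF: "\<And>x y. 0 \<le> x \<Longrightarrow> x \<le> int m \<Longrightarrow> 0 \<le> y \<Longrightarrow> y \<le> int n \<Longrightarrow> (x, y) \<in> V \<longleftrightarrow> F (x + y) \<noteq> F (x - y)"
  proof (rule kernel_form[OF mn V1 V2, folded d])
    fix F :: "int \<Rightarrow> bool"
    assume "\<And>t. F (- t) = F t" and "\<And>t. F (t + 2 * int d) = F t"
      and "\<And>x y. 0 \<le> x \<Longrightarrow> x \<le> int m \<Longrightarrow> 0 \<le> y \<Longrightarrow> y \<le> int n \<Longrightarrow> (x, y) \<in> V \<longleftrightarrow> F (x + y) \<noteq> F (x - y)"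
    then show thesis by (rule that)
  qed
  obtain k where k: "k \<le> d" and card_V: "card (boundary V) = 4 * (k * (d - k)) * (m' * n')"
    using card_boundary_kernel[OF mn m n V1 ev per VF] by blast
  have pos: "0 < d" "0 < m'" "0 < n'" using mn m n by (auto intro!: gr0I)
  have mn_div: "m * n div d\<^sup>2 = m' * n'"
  proof -
    have "m * n = d\<^sup>2 * (m' * n')" unfolding m n power2_eq_square by (simp only: mult_ac)
    then show ?thesis using pos by simp
  qed
  have delta: "delta m n = (if odd d then 1 else if d mod 4 = 0 then 0
      else if d mod 4 = 2 \<and> 4 \<le> m \<and> 4 \<le> n \<and> even (m' * n') then 0 else 4)"
    unfolding delta_def Let_def d[symmetric] mn_div ..
  have "4 * (k * (d - k)) + delta m n \<le> d * d"
  proof -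
    define j where "j = d - k"
    have dj: "d = k + j" using k by (simp add: j_def)
    have square: "int (d * d) = 4 * (int k * int j) + (int j - int k)\<^sup>2"
      by (simp add: dj power2_eq_square algebra_simps)
    have ge: "4 * (k * j) + c * c \<le> d * d" if "int c \<le> \<bar>int j - int k\<bar>" for c
    proof -
      have "(int c)\<^sup>2 \<le> (int j - int k)\<^sup>2" using that abs_le_square_iff[of "int c" "int j - int k"] by simp
      then have "int (4 * (k * j) + c * c) \<le> int (d * d)" unfolding square by (simp add: power2_eq_square)
      then show ?thesis by (simp only: of_nat_le_iff)
    qed
    consider "odd d" | "delta m n = 0" | "d mod 4 = 2" "delta m n = 4" "\<not> (4 \<le> m \<and> 4 \<le> n \<and> even (m' * n'))"
    proof -
      have "d mod 4 = 0 \<or> d mod 4 = 2 \<or> odd d" by presburger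
      then show thesis using that delta by metis
    qed
    then show ?thesis
    proof cases
      case 1
      then have "int 1 \<le> \<bar>int j - int k\<bar>" using dj by presburger
      from ge[OF this] show ?thesis using 1 by (simp add: delta j_def)
    next
      case 2
      then show ?thesis using ge[of 0] by (simp add: j_def)
    next
      case 3
      show ?thesis
      proof (cases "j = k")
        case False
        have "even d" using 3(1) by presburger
        then have "even (j + k)" using dj by (simp add: add.commute)
        then have "j + 2 \<le> k \<or> k + 2 \<le> j" using False by presburger
        then have "int 2 \<le> \<bar>int j - int k\<bar>" by linarith
        from ge[OF this] show ?thesis using 3 by (simp add: j_def)
      next
        case True
        then have dk: "d = 2 * k" using dj by simp
        have odd_k: "odd k" using 3(1) dk by presburger
        have False
        proof (cases "even (m' * n')")
          case False
          then have "odd m'" "odd n'" by simp_all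
          have "even d" using dk by simp
          have "8 dvd card (boundary V)"
            by (rule card_boundary_dvd_8[OF m n \<open>odd m'\<close> \<open>odd n'\<close> \<open>even d\<close> V1 A(1) V3 ev per VF])
          \<comment> \<open>With \<open>k\<close> and \<open>m' * n'\<close> odd the size is an odd
            multiple of 4.\<close>
          then have "4 * 2 dvd 4 * (k * k * (m' * n'))" by (simp add: card_V dk)
          then have "2 dvd k * k * (m' * n')" by (subst (asm) dvd_times_left_cancel_iff) auto
          then show False using odd_k False by simp
        next
          case even: True
          have "even m" "even n" using m n dk by auto
          then have "m = 2 \<or> n = 2" using 3(3) even mn by presburger
          then have corner: "(1, 1) \<notin> V" and "d dvd 2"
            using V4 m n dvd_triv_left[of d m'] dvd_triv_left[of d n'] by metis+
          then have d2: "d = 2" using dk pos by (auto dest: dvd_imp_le)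
          \<comment> \<open>With evenness and period 4, equality at 0 and 2 gives period 2 and so an
            empty \<open>V\<close>, against the positive size found for
            \<open>k = 1\<close>.\<close>
          have F20: "F 2 = F 0" using corner VF[of 1 1] mn by simp
          have per2: "F (t + 2) = F t" for t
          proof -
            define q r where "q = t div 4" and "r = t mod 4"
            have t: "t = r + q * 4" by (simp add: q_def r_def)
            have per4: "F (u + 4) = F u" for u using per[of u] d2 by simp
            have "r = 0 \<or> r = 1 \<or> r = 2 \<or> r = 3" unfolding r_def by presburger
            then have "F (r + 2) = F r"
              using F20 per4[of 0] per4[of 1] per4[of "- 1"] ev[of 1] by auto
            moreover have "F (t + 2) = F (r + 2)"
              using period_int_mult[of F, OF per4, of "r + 2" q] t by (simp add: algebra_simps)
            moreover have "F t = F r" using period_int_mult[of F, OF per4, of r q] t by simp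
            ultimately show ?thesis by simp
          qed
          have "V = {}"
          proof -
            have "F (x + y) = F (x - y)" for x y
              using period_int_mult[of F, OF per2, of "x - y" y] by (simp add: algebra_simps)
            then have "(x, y) \<notin> V" for x y
              using VF[of x y] V1 by (cases "(x, y) \<in> grid_cells m n") auto
            then show ?thesis by auto
          qed
          then have "card (boundary V) = 0" by (simp add: boundary_def)
          then show False using card_V dk d2 pos by simp
        qed
        then show ?thesis ..
      qed
    qed
  qed
  then have "(4 * (k * (d - k)) + delta m n) * (m' * n') \<le> d * d * (m' * n')" by (rule mult_le_mono1)
  then show ?thesis unfolding sV card_V by (simp add: m n algebra_simps)
qed

subsection \<open>Surgery on cycles\<close>

fun path_edges :: "'a list \<Rightarrow> 'a set set" where
  "path_edges (x # y # zs) = insert {x, y} (path_edges (y # zs))"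
| "path_edges _ = {}"

lemma path_edges_append:
  "xs \<noteq> [] \<Longrightarrow> ys \<noteq> [] \<Longrightarrow> path_edges (xs @ ys) = insert {last xs, hd ys} (path_edges xs \<union> path_edges ys)"
proof (induction xs rule: path_edges.induct)
  case ("2_2" x)
  then show ?case by (cases ys) auto
qed auto

lemma path_edges_rev: "path_edges (rev xs) = path_edges xs"
proof (induction xs rule: path_edges.induct)
  case (1 x y zs)
  have "path_edges (rev (y # zs) @ [x]) = insert {last (rev (y # zs)), x} (path_edges (rev (y # zs)))"
    by (subst path_edges_append) auto
  then show ?case using 1 by (simp add: insert_commute last_rev)
qed auto

lemma path_edges_subset: "e \<in> path_edges xs \<Longrightarrow> e \<subseteq> set xs"
  by (induction xs rule: path_edges.induct) auto

lemma set_subset_path_edges: "2 \<le> length xs \<Longrightarrow> set xs \<subseteq> \<Union> (path_edges xs)"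
proof (induction xs rule: path_edges.induct)
  case (1 x y zs)
  then show ?case by (cases zs) auto
qed auto

lemma path_edges_conv_nth: "path_edges xs = {{xs ! i, xs ! Suc i} | i. Suc i < length xs}"
proof (induction xs rule: path_edges.induct)
  case (1 x y zs)
  have "{{(x # y # zs) ! i, (x # y # zs) ! Suc i} | i. Suc i < length (x # y # zs)}
      = insert {x, y} {{(y # zs) ! i, (y # zs) ! Suc i} | i. Suc i < length (y # zs)}" (is "?L = insert _ ?R")
  proof
    show "?L \<subseteq> insert {x, y} ?R"
    proof
      fix e assume "e \<in> ?L"
      then obtain i where "e = {(x # y # zs) ! i, (x # y # zs) ! Suc i}" "Suc i < length (x # y # zs)" by blast
      then show "e \<in> insert {x, y} ?R" by (cases i) auto
    qed
    show "insert {x, y} ?R \<subseteq> ?L"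
    proof
      fix e assume "e \<in> insert {x, y} ?R"
      then consider "e = {x, y}" | i where "e = {(y # zs) ! i, (y # zs) ! Suc i}" "Suc i < length (y # zs)" by blast
      then show "e \<in> ?L"
      proof cases
        case 1 then show ?thesis by (intro CollectI exI[of _ 0]) simp
      next
        case (2 i) then show ?thesis by (intro CollectI exI[of _ "Suc i"]) simp
      qed
    qed
  qed
  then show ?case using 1 by simp
qed auto

text \<open>Indices modulo the length are replaced by a path and one closing edge, the form in which
  cycles are cut and glued below.\<close>

lemma closed_path_edges_eq:
  assumes "vs \<noteq> []"
  shows "closed_path_edges vs = insert {last vs, hd vs} (path_edges vs)"
proof -
  let ?n = "length vs"
  have n: "0 < ?n" using assms by simp
  have ends: "last vs = vs ! (?n - 1)" "hd vs = vs ! 0" using assms by (simp_all add: last_conv_nth hd_conv_nth)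
  show ?thesis
  proof
    show "closed_path_edges vs \<subseteq> insert {last vs, hd vs} (path_edges vs)"
    proof
      fix e assume "e \<in> closed_path_edges vs"
      then obtain i where i: "e = {vs ! i, vs ! (Suc i mod ?n)}" "i < ?n" by (auto simp: closed_path_edges_def)
      show "e \<in> insert {last vs, hd vs} (path_edges vs)"
      proof (cases "Suc i < ?n")
        case True
        then show ?thesis using i by (auto simp: path_edges_conv_nth)
      next
        case False
        then have "?n = Suc i" using i(2) by linarith
        then have "i = ?n - 1" "Suc i mod ?n = 0" by simp_all
        then show ?thesis unfolding i(1) ends by simp
      qed
    qed
    show "insert {last vs, hd vs} (path_edges vs) \<subseteq> closed_path_edges vs"
    proof
      fix e assume "e \<in> insert {last vs, hd vs} (path_edges vs)"
      then consider "e = {last vs, hd vs}" | i where "e = {vs ! i, vs ! Suc i}" "Suc i < ?n"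
        by (auto simp: path_edges_conv_nth)
      then show "e \<in> closed_path_edges vs"
      proof cases
        case 1
        have "Suc (?n - 1) mod ?n = 0" using n by simp
        then show ?thesis unfolding closed_path_edges_def using 1 ends n
          by (intro CollectI exI[of _ "?n - 1"]) simp
      next
        case (2 i)
        then show ?thesis unfolding closed_path_edges_def by (intro CollectI exI[of _ i]) simp
      qed
    qed
  qed
qed

lemma closing_edge_notin_path:
  assumes "distinct vs" and "3 \<le> length vs"
  shows "{last vs, hd vs} \<notin> path_edges vs"
proof -
  obtain x y z zs where vs: "vs = x # y # z # zs"
    using assms(2) by (metis Suc_le_length_iff numeral_3_eq_3)
  have "last vs \<in> set (z # zs)" using vs by simp
  then have "last vs \<noteq> y" "last vs \<noteq> x" using assms(1) vs by auto
  then show ?thesis using assms(1) path_edges_subset[of "{last vs, x}" "y # z # zs"]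
    by (auto simp: vs doubleton_eq_iff split: if_splits)
qed

lemma is_cycleI:
  assumes "distinct vs" and "3 \<le> length vs" and "insert {last vs, hd vs} (path_edges vs) \<subseteq> E"
  shows "is_cycle E (insert {last vs, hd vs} (path_edges vs))"
proof -
  have "vs \<noteq> []" using assms(2) by auto
  then show ?thesis using assms closed_path_edges_eq[of vs] unfolding is_cycle_def by metis
qed

text \<open>Rotating the vertex list brings any edge to the closing position, and reversing it fixes
  the direction.\<close>

lemma cycle_opened_at_edge:
  assumes "is_cycle E C" and "{p, q} \<in> C"
  obtains vs where "distinct vs" "3 \<le> length vs" "hd vs = p" "last vs = q" "path_edges vs = C - {{p, q}}"
proof -
  obtain vs where vs: "3 \<le> length vs" "distinct vs" "C = closed_path_edges vs"
    using assms(1) by (auto simp: is_cycle_def)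
  have "\<exists>ws. distinct ws \<and> 3 \<le> length ws \<and> C = closed_path_edges ws \<and> {p, q} = {last ws, hd ws}"
  proof -
    have "vs \<noteq> []" using vs by auto
    have "{p, q} = {last vs, hd vs} \<or> {p, q} \<in> path_edges vs"
      using assms(2) vs(3) closed_path_edges_eq[OF \<open>vs \<noteq> []\<close>] by auto
    then show ?thesis
    proof
      assume "{p, q} = {last vs, hd vs}" then show ?thesis using vs by blast
    next
      assume "{p, q} \<in> path_edges vs"
      then obtain i where i: "{p, q} = {vs ! i, vs ! Suc i}" "Suc i < length vs"
        by (auto simp: path_edges_conv_nth)
      define xs ys where "xs = take (Suc i) vs" and "ys = drop (Suc i) vs"
      have xy: "vs = xs @ ys" "xs \<noteq> []" "ys \<noteq> []" using i by (auto simp: xs_def ys_def)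
      have l: "last xs = vs ! i" "hd ys = vs ! Suc i"
        using i by (auto simp: xs_def ys_def take_Suc_conv_app_nth hd_drop_conv_nth)
      have "closed_path_edges (ys @ xs) = closed_path_edges vs"
        using xy by (auto simp: closed_path_edges_eq path_edges_append)
      moreover have "distinct (ys @ xs)" "3 \<le> length (ys @ xs)" using vs xy by auto
      moreover have "{p, q} = {last (ys @ xs), hd (ys @ xs)}" using i l xy by auto
      ultimately show ?thesis using vs by metis
    qed
  qed
  then obtain ws where ws: "distinct ws" "3 \<le> length ws" "C = closed_path_edges ws" "{p, q} = {last ws, hd ws}" by blast
  then have ne: "ws \<noteq> []" by auto
  have pe: "path_edges ws = C - {{p, q}}"
    unfolding ws(3,4) closed_path_edges_eq[OF ne] using closing_edge_notin_path[OF ws(1,2)] by auto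
  show thesis
  proof (cases "hd ws = p")
    case True
    then have "last ws = q" using ws(4) by (auto simp: doubleton_eq_iff)
    then show ?thesis using that[OF ws(1,2) True _ pe] by blast
  next
    case False
    then have "hd ws = q" "last ws = p" using ws(4) by (auto simp: doubleton_eq_iff)
    then show ?thesis
      using that[of "rev ws"] ws(1,2) ne pe by (simp add: path_edges_rev hd_rev last_rev)
  qed
qed

text \<open>The effect of gluing a cell along one side: the edge is traded for the other three sides
  of the cell.\<close>

lemma cycle_push_edge:
  assumes C: "is_cycle UNIV C" and pq: "{p, q} \<in> C" and fresh: "r \<notin> \<Union> C" "s \<notin> \<Union> C" "r \<noteq> s"
  shows "is_cycle UNIV (C - {{p, q}} \<union> {{p, r}, {r, s}, {s, q}})"
proof -
  obtain vs where vs: "distinct vs" "3 \<le> length vs" "hd vs = p" "last vs = q" "path_edges vs = C - {{p, q}}"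
    using cycle_opened_at_edge[OF C pq] .
  have ne: "vs \<noteq> []" using vs(2) by auto
  have "set vs \<subseteq> \<Union> (path_edges vs)" by (rule set_subset_path_edges) (use vs(2) in linarith)
  then have "set vs \<subseteq> \<Union> C" unfolding vs(5) using pq by blast
  then have "distinct (vs @ [s, r])" using vs(1) fresh by auto
  moreover have "insert {last (vs @ [s, r]), hd (vs @ [s, r])} (path_edges (vs @ [s, r]))
      = C - {{p, q}} \<union> {{p, r}, {r, s}, {s, q}}"
  proof -
    have pe: "path_edges (vs @ [s, r]) = insert {last vs, s} (path_edges vs \<union> {{s, r}})"
      using ne by (subst path_edges_append) auto
    have ends: "last (vs @ [s, r]) = r" "hd (vs @ [s, r]) = p" using ne vs(3) by simp_all
    show ?thesis
      unfolding pe ends vs(4,5) insert_commute[of r p "{}"] insert_commute[of q s "{}"] insert_commute[of s r "{}"]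
      by blast
  qed
  ultimately show ?thesis using is_cycleI[of "vs @ [s, r]" UNIV] vs(2) by simp
qed

text \<open>The effect of filling a notch: the cell is glued along two adjacent sides, and the
  corner \<open>q\<close> moves to the opposite corner \<open>s\<close>.\<close>

lemma cycle_push_corner:
  assumes C: "is_cycle UNIV C" and pq: "{p, q} \<in> C" "{q, r} \<in> C" "p \<noteq> r" and fresh: "s \<notin> \<Union> C"
  shows "is_cycle UNIV (C - {{p, q}, {q, r}} \<union> {{p, s}, {s, r}})"
proof -
  obtain vs where vs: "distinct vs" "3 \<le> length vs" "hd vs = p" "last vs = q" "path_edges vs = C - {{p, q}}"
    using cycle_opened_at_edge[OF C pq(1)] .
  define us where "us = butlast vs"
  have ne: "vs \<noteq> []" using vs(2) by auto
  then have us: "vs = us @ [q]" using vs(4) by (auto simp: us_def)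
  have len: "2 \<le> length us" using vs(2) us by simp
  then have "us \<noteq> []" by auto
  then have pe: "path_edges vs = insert {last us, q} (path_edges us)" unfolding us by (subst path_edges_append) auto
  have q: "q \<notin> set us" using vs(1) us by simp
  \<comment> \<open>\<open>q\<close> occurs only at the end of the path, so its second edge in the
    cycle is the last edge of the path.\<close>
  have "{q, r} \<in> path_edges vs" using vs(5) pq by (auto simp: doubleton_eq_iff)
  moreover have "{q, r} \<notin> path_edges us" using path_edges_subset q by blast
  ultimately have r: "last us = r" using pe by (auto simp: doubleton_eq_iff)
  have pe_us: "path_edges us = C - {{p, q}, {q, r}}"
  proof -
    have "{r, q} \<notin> path_edges us" using path_edges_subset q by blast
    then show ?thesis using pe vs(5) r by (auto simp: insert_commute)
  qed
  have "set vs \<subseteq> \<Union> (path_edges vs)" by (rule set_subset_path_edges) (use vs(2) in linarith)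
  then have "set vs \<subseteq> \<Union> C" unfolding vs(5) using pq by blast
  then have dist: "distinct (us @ [s])" using vs(1) fresh us by auto
  have "hd us = p" using vs(3) us \<open>us \<noteq> []\<close> by simp
  have "insert {last (us @ [s]), hd (us @ [s])} (path_edges (us @ [s]))
      = C - {{p, q}, {q, r}} \<union> {{p, s}, {s, r}}"
  proof -
    have pe': "path_edges (us @ [s]) = insert {last us, s} (path_edges us)"
      using \<open>us \<noteq> []\<close> by (subst path_edges_append) auto
    have ends: "last (us @ [s]) = s" "hd (us @ [s]) = p" using \<open>hd us = p\<close> \<open>us \<noteq> []\<close> by simp_all
    show ?thesis
      unfolding pe' ends r pe_us insert_commute[of r s "{}"] insert_commute[of s p "{}"] by blast
  qed
  then show ?thesis using is_cycleI[OF dist, of UNIV] len by simp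
qed

lemma cycle_join:
  assumes C: "is_cycle UNIV C" "{p, q} \<in> C" and D: "is_cycle UNIV D" "{p', q'} \<in> D"
    and disj: "\<Union> C \<inter> \<Union> D = {}"
  shows "is_cycle UNIV ((C - {{p, q}}) \<union> (D - {{p', q'}}) \<union> {{p, p'}, {q, q'}})"
proof -
  obtain vs where vs: "distinct vs" "3 \<le> length vs" "hd vs = p" "last vs = q" "path_edges vs = C - {{p, q}}"
    using cycle_opened_at_edge[OF C] .
  have "{q', p'} \<in> D" using D(2) by (simp add: insert_commute)
  then obtain ws where ws: "distinct ws" "3 \<le> length ws" "hd ws = q'" "last ws = p'" "path_edges ws = D - {{q', p'}}"
    using cycle_opened_at_edge[OF D(1)] by metis
  have ne: "vs \<noteq> []" "ws \<noteq> []" using vs(2) ws(2) by auto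
  have "set vs \<subseteq> \<Union> (path_edges vs)" "set ws \<subseteq> \<Union> (path_edges ws)"
    by (rule set_subset_path_edges, use vs(2) ws(2) in linarith)+
  then have "set vs \<subseteq> \<Union> C" "set ws \<subseteq> \<Union> D" unfolding vs(5) ws(5) by blast+
  then have "distinct (vs @ ws)" using vs(1) ws(1) disj by auto
  moreover have "insert {last (vs @ ws), hd (vs @ ws)} (path_edges (vs @ ws))
      = (C - {{p, q}}) \<union> (D - {{p', q'}}) \<union> {{p, p'}, {q, q'}}"
  proof -
    have pe: "path_edges (vs @ ws) = insert {last vs, hd ws} (path_edges vs \<union> path_edges ws)"
      using ne by (rule path_edges_append)
    have ends: "last (vs @ ws) = p'" "hd (vs @ ws) = p" using ne vs(3) ws(4) by simp_all
    show ?thesis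
      unfolding pe ends vs(4,5) ws(3,5) insert_commute[of p' p "{}"] insert_commute[of q' p' "{}"] by blast
  qed
  ultimately show ?thesis using is_cycleI[of "vs @ ws" UNIV] vs(2) by simp
qed

lemma is_cycle_image:
  assumes "is_cycle UNIV C" and "inj f"
  shows "is_cycle UNIV ((`) f ` C)"
proof -
  obtain vs where vs: "3 \<le> length vs" "distinct vs" "C = closed_path_edges vs"
    using assms(1) by (auto simp: is_cycle_def)
  have "(`) f ` C = closed_path_edges (map f vs)"
  proof -
    have *: "f ` {vs ! i, vs ! (Suc i mod length vs)} = {map f vs ! i, map f vs ! (Suc i mod length (map f vs))}"
      if "i < length vs" for i
    proof -
      have "Suc i mod length vs < length vs" by (rule mod_less_divisor) (use that in linarith)
      then show ?thesis using that by simp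
    qed
    have "(`) f ` C = {f ` {vs ! i, vs ! (Suc i mod length vs)} | i. i < length vs}"
      unfolding vs(3) closed_path_edges_def by blast
    also have "\<dots> = closed_path_edges (map f vs)"
      unfolding closed_path_edges_def using * by (metis (no_types, lifting) length_map)
    finally show ?thesis .
  qed
  moreover have "distinct (map f vs)" using vs(2) assms(2) by (simp add: distinct_map inj_on_def)
  ultimately show ?thesis unfolding is_cycle_def using vs(1) by (intro exI[of _ "map f vs"]) simp
qed

subsection \<open>Regions bounded by a single cycle\<close>

text \<open>No grid is mentioned, so regions can be moved and joined before its size is known;
  \<open>cycle_region_is_cycle\<close> brings the grid back.\<close>

definition cycle_region :: "point set \<Rightarrow> bool" where
  "cycle_region A \<longleftrightarrow> is_cycle UNIV (boundary A)"

lemma cycle_region_is_cycle: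
  assumes "cycle_region A" and "A \<subseteq> grid_cells m n"
  shows "is_cycle (grid_edges m n) (boundary A)"
  using assms(1) boundary_subset_grid[OF assms(2)] unfolding cycle_region_def is_cycle_def by blast

lemma vertex_notin_boundary:
  assumes "(x, y) \<notin> A" "(x - 1, y) \<notin> A" "(x, y - 1) \<notin> A" "(x - 1, y - 1) \<notin> A"
  shows "(x, y) \<notin> \<Union> (boundary A)"
proof
  assume "(x, y) \<in> \<Union> (boundary A)"
  then obtain e where e: "e \<in> boundary A" "(x, y) \<in> e" by blast
  from boundary_is_edge[OF e(1)] obtain a b where "e = hedge a b \<or> e = vedge a b" by blast
  then show False using e assms by auto
qed

lemma hedge_vertices: "hedge x y = {(x, y), (x + 1, y)}" "hedge x y = {(x + 1, y), (x, y)}"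
  by (auto simp: hedge_def)

lemma vedge_vertices: "vedge x y = {(x, y), (x, y + 1)}" "vedge x y = {(x, y + 1), (x, y)}"
  by (auto simp: vedge_def)

lemma cycle_region_singleton: "cycle_region {(x, y)}"
proof -
  let ?vs = "[(x, y), (x + 1, y), (x + 1, y + 1), (x, y + 1)] :: point list"
  have "is_cycle UNIV (insert {last ?vs, hd ?vs} (path_edges ?vs))" by (rule is_cycleI) auto
  moreover have "boundary {(x, y)} = {hedge x y, hedge x (y + 1), vedge x y, vedge (x + 1) y}"
    by (rule edge_set_eqI) (auto dest: boundary_is_edge)
  then have "boundary {(x, y)} = insert {last ?vs, hd ?vs} (path_edges ?vs)"
    by (auto simp: hedge_def vedge_def insert_commute)
  ultimately show ?thesis by (simp add: cycle_region_def)
qed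

definition unit_vec :: "int \<Rightarrow> int \<Rightarrow> bool" where
  "unit_vec a b \<longleftrightarrow> (a, b) \<in> {(1, 0), (- 1, 0), (0, 1), (0, - 1)}"

text \<open>The cell has its only contact with the region along the side facing \<open>(-a, -b)\<close>.\<close>

definition touches :: "point set \<Rightarrow> int \<Rightarrow> int \<Rightarrow> int \<Rightarrow> int \<Rightarrow> bool" where
  "touches A x y a b \<longleftrightarrow> (x - a, y - b) \<in> A \<and> (x + a, y + b) \<notin> A \<and> (x - b, y + a) \<notin> A \<and> (x + b, y - a) \<notin> A
     \<and> (x + a - b, y + b + a) \<notin> A \<and> (x + a + b, y + b - a) \<notin> A"

lemma cycle_region_insert_touching:
  assumes A: "cycle_region A" and c: "(x, y) \<notin> A" and "unit_vec a b" and "touches A x y a b"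
  shows "cycle_region (insert (x, y) A)"
proof -
  consider "a = 1" "b = 0" | "a = - 1" "b = 0" | "a = 0" "b = 1" | "a = 0" "b = - 1"
    using assms(3) by (auto simp: unit_vec_def)
  then show ?thesis
  proof cases
    case 1
    then have t: "(x - 1, y) \<in> A" "(x + 1, y) \<notin> A" "(x, y + 1) \<notin> A" "(x, y - 1) \<notin> A"
      "(x + 1, y + 1) \<notin> A" "(x + 1, y - 1) \<notin> A" using assms(4) by (auto simp: touches_def)
    have "boundary (insert (x, y) A) = boundary A - {vedge x y} \<union> {hedge x y, vedge (x + 1) y, hedge x (y + 1)}"
      by (rule edge_set_eqI) (use t c in \<open>auto dest: boundary_is_edge\<close>)
    moreover have "is_cycle UNIV (boundary A - {{(x, y), (x, y + 1)}} \<union>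
        {{(x, y), (x + 1, y)}, {(x + 1, y), (x + 1, y + 1)}, {(x + 1, y + 1), (x, y + 1)}})"
      by (rule cycle_push_edge)
        (use A t c vertex_notin_boundary[of "x + 1" y A] vertex_notin_boundary[of "x + 1" "y + 1" A] in
          \<open>auto simp: cycle_region_def simp flip: vedge_vertices(1)\<close>)
    ultimately show ?thesis
      by (simp add: cycle_region_def hedge_vertices(1)[of x y] hedge_vertices(2)[of x "y + 1"] vedge_vertices(1))
  next
    case 2
    then have t: "(x + 1, y) \<in> A" "(x - 1, y) \<notin> A" "(x, y + 1) \<notin> A" "(x, y - 1) \<notin> A"
      "(x - 1, y + 1) \<notin> A" "(x - 1, y - 1) \<notin> A" using assms(4) by (auto simp: touches_def)
    have "boundary (insert (x, y) A) = boundary A - {vedge (x + 1) y} \<union> {hedge x y, vedge x y, hedge x (y + 1)}"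
      by (rule edge_set_eqI) (use t c in \<open>auto dest: boundary_is_edge\<close>)
    moreover have "is_cycle UNIV (boundary A - {{(x + 1, y), (x + 1, y + 1)}} \<union>
        {{(x + 1, y), (x, y)}, {(x, y), (x, y + 1)}, {(x, y + 1), (x + 1, y + 1)}})"
      by (rule cycle_push_edge)
        (use A t c vertex_notin_boundary[of x y A] vertex_notin_boundary[of x "y + 1" A] in
          \<open>auto simp: cycle_region_def simp flip: vedge_vertices(1)\<close>)
    ultimately show ?thesis
      by (simp add: cycle_region_def hedge_vertices(2)[of x y] hedge_vertices(1)[of x "y + 1"] vedge_vertices(1))
  next
    case 3
    then have t: "(x, y - 1) \<in> A" "(x, y + 1) \<notin> A" "(x + 1, y) \<notin> A" "(x - 1, y) \<notin> A"
      "(x + 1, y + 1) \<notin> A" "(x - 1, y + 1) \<notin> A" using assms(4) by (auto simp: touches_def)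
    have "boundary (insert (x, y) A) = boundary A - {hedge x y} \<union> {vedge x y, hedge x (y + 1), vedge (x + 1) y}"
      by (rule edge_set_eqI) (use t c in \<open>auto dest: boundary_is_edge\<close>)
    moreover have "is_cycle UNIV (boundary A - {{(x, y), (x + 1, y)}} \<union>
        {{(x, y), (x, y + 1)}, {(x, y + 1), (x + 1, y + 1)}, {(x + 1, y + 1), (x + 1, y)}})"
      by (rule cycle_push_edge)
        (use A t c vertex_notin_boundary[of x "y + 1" A] vertex_notin_boundary[of "x + 1" "y + 1" A] in
          \<open>auto simp: cycle_region_def simp flip: hedge_vertices(1)\<close>)
    ultimately show ?thesis
      by (simp add: cycle_region_def vedge_vertices(1)[of x y] vedge_vertices(2)[of "x + 1" y] hedge_vertices(1))
  next
    case 4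
    then have t: "(x, y + 1) \<in> A" "(x, y - 1) \<notin> A" "(x + 1, y) \<notin> A" "(x - 1, y) \<notin> A"
      "(x + 1, y - 1) \<notin> A" "(x - 1, y - 1) \<notin> A" using assms(4) by (auto simp: touches_def)
    have "boundary (insert (x, y) A) = boundary A - {hedge x (y + 1)} \<union> {vedge x y, hedge x y, vedge (x + 1) y}"
      by (rule edge_set_eqI) (use t c in \<open>auto dest: boundary_is_edge\<close>)
    moreover have "is_cycle UNIV (boundary A - {{(x, y + 1), (x + 1, y + 1)}} \<union>
        {{(x, y + 1), (x, y)}, {(x, y), (x + 1, y)}, {(x + 1, y), (x + 1, y + 1)}})"
      by (rule cycle_push_edge)
        (use A t c vertex_notin_boundary[of x y A] vertex_notin_boundary[of "x + 1" y A] in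
          \<open>auto simp: cycle_region_def simp flip: hedge_vertices(1)\<close>)
    ultimately show ?thesis
      by (simp add: cycle_region_def vedge_vertices(2)[of x y] vedge_vertices(1)[of "x + 1" y] hedge_vertices(1))
  qed
qed

text \<open>Cells are added in the order of increasing rank.\<close>

lemma cycle_region_by_rank:
  fixes rank :: "point \<Rightarrow> int"
  assumes fin: "finite A" and r\<^sub>0: "r\<^sub>0 \<in> A" and least: "\<And>c. c \<in> A \<Longrightarrow> rank r\<^sub>0 \<le> rank c"
    and step: "\<And>x y. (x, y) \<in> A \<Longrightarrow> (x, y) \<noteq> r\<^sub>0 \<Longrightarrow>
      \<exists>a b. unit_vec a b \<and> touches {c \<in> A. rank c \<le> rank (x, y)} x y a b \<and> rank (x - a, y - b) < rank (x, y)"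
  shows "cycle_region A"
proof -
  \<comment> \<open>Downward closed subsets are dismantled by removing a cell of largest rank. Cells
    of equal rank may still be present, which is why \<open>touches\<close> is tested against all
    ranks up to that of the cell.\<close>
  have "cycle_region S" if "finite S" "S \<subseteq> A" "r\<^sub>0 \<in> S" "\<forall>c\<in>S. \<forall>g\<in>A. rank g < rank c \<longrightarrow> g \<in> S" for S
    using that
  proof (induction "card S" arbitrary: S rule: less_induct)
    case less
    show ?case
    proof (cases "S = {r\<^sub>0}")
      case True
      then show ?thesis using cycle_region_singleton by (cases r\<^sub>0) simp
    next
      case False
      then have "finite (S - {r\<^sub>0})" "S - {r\<^sub>0} \<noteq> {}" using less.prems by auto
      then have "Max (rank ` (S - {r\<^sub>0})) \<in> rank ` (S - {r\<^sub>0})" by (intro Max_in) auto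
      then obtain c where c: "c \<in> S - {r\<^sub>0}" "rank c = Max (rank ` (S - {r\<^sub>0}))" by (metis imageE)
      have c_max: "rank g \<le> rank c" if "g \<in> S - {r\<^sub>0}" for g
        unfolding c(2) using that \<open>finite (S - {r\<^sub>0})\<close> by (intro Max_ge) auto
      obtain x y where xy: "c = (x, y)" by (cases c)
      have cA: "c \<in> A" "c \<noteq> r\<^sub>0" using c(1) less.prems by auto
      have below: "g \<in> S - {c} \<Longrightarrow> g \<in> A \<and> rank g \<le> rank c" for g
        using c(1) c_max less.prems least[OF cA(1)] by (cases "g = r\<^sub>0") auto
      obtain a b where ab: "unit_vec a b" "touches {g \<in> A. rank g \<le> rank c} x y a b" "rank (x - a, y - b) < rank c"
        using step[of x y] cA xy by auto
      have "(x - a, y - b) \<in> S - {c}" using ab less.prems c(1) by (auto simp: touches_def)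
      then have "touches (S - {c}) x y a b" using ab(2) below by (auto simp: touches_def)
      moreover have "cycle_region (S - {c})"
      proof (rule less.hyps)
        show "card (S - {c}) < card S" using c(1) less.prems by (intro psubset_card_mono) auto
        show "\<forall>s\<in>S - {c}. \<forall>g\<in>A. rank g < rank s \<longrightarrow> g \<in> S - {c}"
        proof (intro ballI impI)
          fix s g assume "s \<in> S - {c}" "g \<in> A" "rank g < rank s"
          then show "g \<in> S - {c}" using below[of s] less.prems by auto
        qed
      qed (use less.prems c(1) in auto)
      ultimately have "cycle_region (insert (x, y) (S - {c}))"
        by (intro cycle_region_insert_touching[OF _ _ ab(1)]) (use xy in auto)
      then show ?thesis using c(1) xy by (simp add: insert_absorb)
    qed
  qed
  then show ?thesis using fin r\<^sub>0 by blast
qed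

lemma cycle_region_insert_corner:
  assumes A: "cycle_region A" and a: "\<bar>a\<bar> = 1" and b: "\<bar>b\<bar> = 1"
    and inA: "(x - a, y) \<in> A" "(x, y - b) \<in> A" "(x - a, y - b) \<in> A"
    and out: "(x, y) \<notin> A" "(x + a, y) \<notin> A" "(x, y + b) \<notin> A" "(x + a, y + b) \<notin> A"
  shows "cycle_region (insert (x, y) A)"
proof -
  \<comment> \<open>\<open>(v, h)\<close> is the corner shared with the three cells of
    \<open>A\<close>, and \<open>(v', h')\<close> the opposite corner.\<close>
  define h where "h = (if b = 1 then y else y + 1)"
  define v where "v = (if a = 1 then x else x + 1)"
  define h' where "h' = (if b = 1 then y + 1 else y)"
  define v' where "v' = (if a = 1 then x + 1 else x)"
  have ab: "a = 1 \<or> a = - 1" "b = 1 \<or> b = - 1" using a b by linarith+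
  have boundary: "boundary (insert (x, y) A) = boundary A - {hedge x h, vedge v y} \<union> {hedge x h', vedge v' y}"
    by (rule edge_set_eqI)
      (use inA out ab in \<open>auto dest: boundary_is_edge simp: h_def v_def h'_def v'_def\<close>)
  have H: "hedge x u = {(v, u), (v', u)}" "hedge x u = {(v', u), (v, u)}" for u
    using ab by (auto simp: hedge_def v_def v'_def)
  have V: "vedge u y = {(u, h), (u, h')}" "vedge u y = {(u, h'), (u, h)}" for u
    using ab by (auto simp: vedge_def h_def h'_def)
  have "is_cycle UNIV (boundary A - {{(v', h), (v, h)}, {(v, h), (v, h')}} \<union> {{(v', h), (v', h')}, {(v', h'), (v, h')}})"
  proof (rule cycle_push_corner)
    show "is_cycle UNIV (boundary A)" using A by (simp add: cycle_region_def)
    show "{(v', h), (v, h)} \<in> boundary A" unfolding H(2)[symmetric] using inA out ab by (auto simp: h_def)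
    show "{(v, h), (v, h')} \<in> boundary A" unfolding V(1)[symmetric] using inA out ab by (auto simp: v_def)
    show "(v', h) \<noteq> (v, h')" using ab by (auto simp: v_def v'_def)
    show "(v', h') \<notin> \<Union> (boundary A)"
      by (rule vertex_notin_boundary) (use out ab in \<open>auto simp: v'_def h'_def\<close>)
  qed
  then have "is_cycle UNIV (boundary A - {hedge x h, vedge v y} \<union> {hedge x h', vedge v' y})"
    unfolding H(2)[symmetric] V(1)[symmetric] by (simp only: insert_commute)
  then show ?thesis unfolding cycle_region_def boundary .
qed

lemma vertex_in_boundary_near:
  assumes "(u, w) \<in> \<Union> (boundary A)"
  obtains x y where "(x, y) \<in> A" "x = u \<or> x = u - 1" "y = w \<or> y = w - 1"
  using assms vertex_notin_boundary[of u w A] by blast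

text \<open>The column \<open>s\<close> keeps the two boundaries free of common vertices, and the
  cell \<open>(s, y)\<close> trades the two facing sides for its bottom and top.\<close>

lemma cycle_region_link:
  assumes A: "cycle_region A" and B: "cycle_region B"
    and left: "\<And>x y. (x, y) \<in> A \<Longrightarrow> x < s" and right: "\<And>x y. (x, y) \<in> B \<Longrightarrow> s < x"
    and link: "(s - 1, y) \<in> A" "(s + 1, y) \<in> B"
  shows "cycle_region (A \<union> B \<union> {(s, y)})"
proof -
  have sA: "(s, z) \<notin> A" "(s + 1, z) \<notin> A" and sB: "(s, z) \<notin> B" "(s - 1, z) \<notin> B" for z
    using left[of s z] left[of "s + 1" z] right[of s z] right[of "s - 1" z] by auto
  have disj: "\<Union> (boundary A) \<inter> \<Union> (boundary B) = {}"
  proof -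
    have False if u: "(u, w) \<in> \<Union> (boundary A)" "(u, w) \<in> \<Union> (boundary B)" for u w
    proof -
      obtain x z where "(x, z) \<in> A" "x = u \<or> x = u - 1" using vertex_in_boundary_near[OF u(1)] .
      moreover obtain x' z' where "(x', z') \<in> B" "x' = u \<or> x' = u - 1" using vertex_in_boundary_near[OF u(2)] .
      ultimately show False using left[of x z] right[of x' z'] by linarith
    qed
    then show ?thesis by auto
  qed
  have memA: "hedge a b \<in> boundary A \<Longrightarrow> a < s" "vedge a b \<in> boundary A \<Longrightarrow> a \<le> s" for a b
    using left[of a b] left[of a "b - 1"] left[of "a - 1" b] by auto
  have memB: "hedge a b \<in> boundary B \<Longrightarrow> s < a" "vedge a b \<in> boundary B \<Longrightarrow> s < a" for a b
    using right[of a b] right[of a "b - 1"] right[of "a - 1" b] by auto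
  have "is_cycle UNIV ((boundary A - {{(s, y), (s, y + 1)}}) \<union> (boundary B - {{(s + 1, y), (s + 1, y + 1)}})
      \<union> {{(s, y), (s + 1, y)}, {(s, y + 1), (s + 1, y + 1)}})"
  proof (rule cycle_join)
    show "{(s, y), (s, y + 1)} \<in> boundary A" unfolding vedge_vertices(1)[symmetric] using link sA by simp
    show "{(s + 1, y), (s + 1, y + 1)} \<in> boundary B" unfolding vedge_vertices(1)[symmetric] using link sB by simp
  qed (use A B disj in \<open>auto simp: cycle_region_def\<close>)
  then have "is_cycle UNIV ((boundary A - {vedge s y}) \<union> (boundary B - {vedge (s + 1) y}) \<union> {hedge s y, hedge s (y + 1)})"
    by (simp only: vedge_vertices(1) hedge_vertices(1))
  moreover have "boundary (A \<union> B \<union> {(s, y)}) = (boundary A - {vedge s y}) \<union> (boundary B - {vedge (s + 1) y}) \<union> {hedge s y, hedge s (y + 1)}"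
  proof (rule edge_set_eqI)
    fix a b
    consider "a < s" | "a = s" | "s < a" by linarith
    then show "hedge a b \<in> boundary (A \<union> B \<union> {(s, y)}) \<longleftrightarrow>
        hedge a b \<in> (boundary A - {vedge s y}) \<union> (boundary B - {vedge (s + 1) y}) \<union> {hedge s y, hedge s (y + 1)}"
    proof cases
      case 1
      then show ?thesis using right[of a b] right[of a "b - 1"] by auto
    next
      case 2
      then show ?thesis using sA sB by auto
    next
      case 3
      then show ?thesis using left[of a b] left[of a "b - 1"] by auto
    qed
    consider "a < s" | "a = s" | "a = s + 1" | "s + 1 < a" by linarith
    then show "vedge a b \<in> boundary (A \<union> B \<union> {(s, y)}) \<longleftrightarrow>
        vedge a b \<in> (boundary A - {vedge s y}) \<union> (boundary B - {vedge (s + 1) y}) \<union> {hedge s y, hedge s (y + 1)}"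
    proof cases
      case 1
      then show ?thesis using right[of a b] right[of "a - 1" b] by auto
    next
      case 2
      then show ?thesis using link sA sB[of b] by auto
    next
      case 3
      then show ?thesis using link sA[of b] sB[of b] by auto
    next
      case 4
      then show ?thesis using left[of a b] left[of "a - 1" b] by auto
    qed
  qed (auto dest: boundary_is_edge)
  ultimately show ?thesis by (simp add: cycle_region_def)
qed

subsection \<open>Isometries\<close>

definition shifted :: "int \<Rightarrow> point set \<Rightarrow> point set" where
  "shifted s A = {(x, y). (x - s, y) \<in> A}"

definition mirrored :: "int \<Rightarrow> point set \<Rightarrow> point set" where
  "mirrored s A = {(x, y). (s - x, y) \<in> A}"

definition transposed :: "point set \<Rightarrow> point set" where
  "transposed A = {(x, y). (y, x) \<in> A}"

lemma in_shifted [simp]: "(x, y) \<in> shifted s A \<longleftrightarrow> (x - s, y) \<in> A" by (simp add: shifted_def)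
lemma in_mirrored [simp]: "(x, y) \<in> mirrored s A \<longleftrightarrow> (s - x, y) \<in> A" by (simp add: mirrored_def)
lemma in_transposed [simp]: "(x, y) \<in> transposed A \<longleftrightarrow> (y, x) \<in> A" by (simp add: transposed_def)

text \<open>Formulated for edges, so that each isometry only has to say what it does to
  \<open>hedge\<close> and \<open>vedge\<close>.\<close>

lemma boundary_isometry:
  assumes fg: "\<And>p. g (f p) = p" "\<And>p. f (g p) = p"
    and edges: "\<And>x y. \<exists>x' y'. f ` hedge x y = hedge x' y' \<or> f ` hedge x y = vedge x' y'"
      "\<And>x y. \<exists>x' y'. f ` vedge x y = hedge x' y' \<or> f ` vedge x y = vedge x' y'"
    and eq: "\<And>x y. g ` hedge x y \<in> boundary A \<longleftrightarrow> hedge x y \<in> boundary A'" "\<And>x y. g ` vedge x y \<in> boundary A \<longleftrightarrow> vedge x y \<in> boundary A'"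
  shows "cycle_region A \<Longrightarrow> cycle_region A'" and "card (boundary A') = card (boundary A)"
proof -
  have mem: "e \<in> (`) f ` boundary A \<longleftrightarrow> g ` e \<in> boundary A" for e
  proof
    assume "e \<in> (`) f ` boundary A"
    then obtain e' where "e' \<in> boundary A" "e = f ` e'" by blast
    then show "g ` e \<in> boundary A" using fg(1) by (simp add: image_image)
  next
    assume "g ` e \<in> boundary A"
    moreover have "e = f ` g ` e" using fg(2) by (simp add: image_image)
    ultimately show "e \<in> (`) f ` boundary A" by blast
  qed
  have boundary: "boundary A' = (`) f ` boundary A"
  proof (rule edge_set_eqI)
    fix e assume "e \<in> (`) f ` boundary A"
    then obtain e' where "e' \<in> boundary A" "e = f ` e'" by blast
    then show "\<exists>x y. e = hedge x y \<or> e = vedge x y" using boundary_is_edge edges by metis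
  qed (auto simp: mem eq dest: boundary_is_edge simp del: hedge_in_boundary vedge_in_boundary)
  have inj: "inj f" using fg(1) by (rule inj_on_inverseI)
  show "cycle_region A'" if "cycle_region A" using that is_cycle_image[OF _ inj] by (simp add: cycle_region_def boundary)
  have "inj ((`) f)" using inj by (simp add: inj_on_def inj_image_eq_iff[OF inj])
  then show "card (boundary A') = card (boundary A)" unfolding boundary by (rule card_image[OF inj_on_subset]) simp
qed

lemma boundary_shifted: "cycle_region A \<Longrightarrow> cycle_region (shifted s A)" "card (boundary (shifted s A)) = card (boundary A)"
proof -
  let ?f = "\<lambda>(x, y). (x + s, y)" and ?g = "\<lambda>(x, y). (x - s, y)"
  have im: "?f ` hedge x y = hedge (x + s) y" "?f ` vedge x y = vedge (x + s) y"
    "?g ` hedge x y = hedge (x - s) y" "?g ` vedge x y = vedge (x - s) y" for x y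
    by (auto simp: hedge_def vedge_def)
  have q: "?g ` hedge x y \<in> boundary A \<longleftrightarrow> hedge x y \<in> boundary (shifted s A)"
    "?g ` vedge x y \<in> boundary A \<longleftrightarrow> vedge x y \<in> boundary (shifted s A)" for x y
    unfolding im by (simp_all add: algebra_simps)
  have e: "\<exists>x' y'. ?f ` hedge x y = hedge x' y' \<or> ?f ` hedge x y = vedge x' y'"
    "\<exists>x' y'. ?f ` vedge x y = hedge x' y' \<or> ?f ` vedge x y = vedge x' y'" for x y
    unfolding im by blast+
  have i: "?g (?f u) = u" "?f (?g u) = u" for u by (cases u, simp)+
  show "cycle_region A \<Longrightarrow> cycle_region (shifted s A)" by (rule boundary_isometry(1)[OF i e q])
  show "card (boundary (shifted s A)) = card (boundary A)" by (rule boundary_isometry(2)[OF i e q])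
qed

lemma boundary_mirrored: "cycle_region A \<Longrightarrow> cycle_region (mirrored s A)" "card (boundary (mirrored s A)) = card (boundary A)"
proof -
  \<comment> \<open>Cells are named by lower-left corners, so sending cells from \<open>x\<close> to
    \<open>s - x\<close> sends vertices from \<open>x\<close> to \<open>s + 1 - x\<close>.\<close>
  let ?f = "\<lambda>(x, y). (s + 1 - x, y)"
  have im: "?f ` hedge x y = hedge (s - x) y" "?f ` vedge x y = vedge (s + 1 - x) y" for x y
    by (auto simp: hedge_def vedge_def)
  have q: "?f ` hedge x y \<in> boundary A \<longleftrightarrow> hedge x y \<in> boundary (mirrored s A)"
    "?f ` vedge x y \<in> boundary A \<longleftrightarrow> vedge x y \<in> boundary (mirrored s A)" for x y
    unfolding im by (auto simp: algebra_simps)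
  have e: "\<exists>x' y'. ?f ` hedge x y = hedge x' y' \<or> ?f ` hedge x y = vedge x' y'"
    "\<exists>x' y'. ?f ` vedge x y = hedge x' y' \<or> ?f ` vedge x y = vedge x' y'" for x y
    unfolding im by blast+
  have i: "?f (?f u) = u" "?f (?f u) = u" for u by (cases u, simp)+
  show "cycle_region A \<Longrightarrow> cycle_region (mirrored s A)" by (rule boundary_isometry(1)[OF i e q])
  show "card (boundary (mirrored s A)) = card (boundary A)" by (rule boundary_isometry(2)[OF i e q])
qed

lemma boundary_transposed: "cycle_region A \<Longrightarrow> cycle_region (transposed A)" "card (boundary (transposed A)) = card (boundary A)"
proof -
  let ?f = "\<lambda>(x, y). (y, x)"
  have im: "?f ` hedge x y = vedge y x" "?f ` vedge x y = hedge y x" for x y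
    by (auto simp: hedge_def vedge_def)
  have q: "?f ` hedge x y \<in> boundary A \<longleftrightarrow> hedge x y \<in> boundary (transposed A)"
    "?f ` vedge x y \<in> boundary A \<longleftrightarrow> vedge x y \<in> boundary (transposed A)" for x y
    unfolding im by auto
  have e: "\<exists>x' y'. ?f ` hedge x y = hedge x' y' \<or> ?f ` hedge x y = vedge x' y'"
    "\<exists>x' y'. ?f ` vedge x y = hedge x' y' \<or> ?f ` vedge x y = vedge x' y'" for x y
    unfolding im by blast+
  have i: "?f (?f u) = u" "?f (?f u) = u" for u by (cases u, simp)+
  show "cycle_region A \<Longrightarrow> cycle_region (transposed A)" by (rule boundary_isometry(1)[OF i e q])
  show "card (boundary (transposed A)) = card (boundary A)" by (rule boundary_isometry(2)[OF i e q])
qed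

subsection \<open>Assembling pairs of cycles from tiles\<close>

text \<open>The last four conditions provide, on each side of the tile, a cell inside both cycles; a
  link to the next tile can be attached there.\<close>

definition cycle_pair :: "nat \<Rightarrow> nat \<Rightarrow> nat \<Rightarrow> point set \<Rightarrow> point set \<Rightarrow> bool" where
  "cycle_pair p q N A B \<longleftrightarrow> A \<subseteq> grid_cells p q \<and> B \<subseteq> grid_cells p q \<and> cycle_region A \<and> cycle_region B
     \<and> (\<forall>x y. (x, y) \<in> grid_cells p q \<longrightarrow> boundary_sides A x y = boundary_sides B x y) \<and> card (boundary (sym_diff A B)) = N
     \<and> (\<exists>y. (1, y) \<in> A \<inter> B) \<and> (\<exists>y. (int p - 1, y) \<in> A \<inter> B)
     \<and> (\<exists>x. (x, 1) \<in> A \<inter> B) \<and> (\<exists>x. (x, int q - 1) \<in> A \<inter> B)"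

lemma cycle_pair_difference:
  assumes "cycle_pair p q N A B"
  shows "N \<in> difference_sizes p q"
proof -
  have "is_cycle (grid_edges p q) (boundary A)" "is_cycle (grid_edges p q) (boundary B)"
    using assms cycle_region_is_cycle by (auto simp: cycle_pair_def)
  moreover have "same_signature p q (boundary A) (boundary B)"
    using assms unfolding same_signature_boundary cycle_pair_def by blast
  moreover have "N = card (sym_diff (boundary A) (boundary B))" using assms by (simp only: cycle_pair_def boundary_sym_diff)
  ultimately show ?thesis unfolding difference_sizes_def by blast
qed

lemma cycle_pair_swap: "cycle_pair p q N A B \<Longrightarrow> cycle_pair p q N B A"
  by (auto simp: cycle_pair_def Un_commute)

lemma cycle_pair_mirrored:
  assumes "cycle_pair p q N A B"
  shows "cycle_pair p q N (mirrored (int p) A) (mirrored (int p) B)"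
proof -
  have sd: "sym_diff (mirrored (int p) A) (mirrored (int p) B) = mirrored (int p) (sym_diff A B)" by auto
  have boundary_sides: "boundary_sides (mirrored (int p) S) x y = boundary_sides S (int p - x) y" for S x y
    by (simp add: boundary_sides_def algebra_simps)
  have mem: "(x, y) \<in> S \<Longrightarrow> S \<subseteq> grid_cells p q \<Longrightarrow> 1 \<le> x \<and> x < int p \<and> 1 \<le> y \<and> y < int q" for x y S by auto
  show ?thesis
    unfolding cycle_pair_def sd boundary_mirrored(2)
  proof (intro conjI allI impI)
    show "mirrored (int p) A \<subseteq> grid_cells p q" "mirrored (int p) B \<subseteq> grid_cells p q"
      using assms mem[of "int p - _"] by (fastforce simp: cycle_pair_def)+
    fix x y assume "(x, y) \<in> grid_cells p q"
    then show "boundary_sides (mirrored (int p) A) x y = boundary_sides (mirrored (int p) B) x y"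
      using assms by (simp add: boundary_sides cycle_pair_def)
  next
    show "\<exists>x. (x, 1) \<in> mirrored (int p) A \<inter> mirrored (int p) B"
      "\<exists>x. (x, int q - 1) \<in> mirrored (int p) A \<inter> mirrored (int p) B"
      using assms by (auto simp: cycle_pair_def intro: exI[of _ "int p - _"])
  qed (use assms boundary_mirrored(1) in \<open>auto simp: cycle_pair_def\<close>)
qed

lemma cycle_pair_transposed:
  assumes "cycle_pair p q N A B"
  shows "cycle_pair q p N (transposed A) (transposed B)"
proof -
  have sd: "sym_diff (transposed A) (transposed B) = transposed (sym_diff A B)" by auto
  have boundary_sides: "boundary_sides (transposed S) x y = boundary_sides S y x" for S x y by (simp add: boundary_sides_def)
  show ?thesis
    unfolding cycle_pair_def sd boundary_transposed(2) boundary_sides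
    using assms boundary_transposed(1) by (auto simp: cycle_pair_def; blast)
qed

lemma card_boundary_separated:
  assumes fin: "finite V" "finite W"
    and left: "\<And>x y. (x, y) \<in> V \<Longrightarrow> x < s" and right: "\<And>x y. (x, y) \<in> W \<Longrightarrow> s < x"
  shows "card (boundary (V \<union> W)) = card (boundary V) + card (boundary W)"
proof -
  have disj: "V \<inter> W = {}" using left right by fastforce
  have outW: "(u, z) \<notin> W" if "u \<le> s" for u z using that right by force
  have outV: "(u, z) \<notin> V" if "s \<le> u" for u z using that left by force
  have V: "boundary_sides (V \<union> W) x y = boundary_sides V x y" if "(x, y) \<in> V" for x y
    using left[OF that] by (simp add: boundary_sides_def outW)
  have W: "boundary_sides (V \<union> W) x y = boundary_sides W x y" if "(x, y) \<in> W" for x y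
    using right[OF that] by (simp add: boundary_sides_def outV)
  have "card (boundary (V \<union> W)) = (\<Sum>(x, y)\<in>V \<union> W. boundary_sides (V \<union> W) x y)" by (rule card_boundary_eq_sum) (use fin in simp)
  also have "\<dots> = (\<Sum>(x, y)\<in>V. boundary_sides (V \<union> W) x y) + (\<Sum>(x, y)\<in>W. boundary_sides (V \<union> W) x y)"
    by (rule sum.union_disjoint[OF fin disj])
  also have "\<dots> = (\<Sum>(x, y)\<in>V. boundary_sides V x y) + (\<Sum>(x, y)\<in>W. boundary_sides W x y)"
    using V W by (intro arg_cong2[where f = "(+)"] sum.cong) auto
  finally show ?thesis using fin by (simp add: card_boundary_eq_sum)
qed

text \<open>Two tiles are put side by side, separated by a column of cells that contains a single cell of
  the region, the link. The roles of the two cycles must be exchanged along the common side, so that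
  the signatures agree in the separating column.\<close>

lemma cycle_pair_concat:
  assumes g1: "cycle_pair p q N A B" and g2: "cycle_pair r q M A' B'"
    and match: "\<And>y. (int p - 1, y) \<in> A \<longleftrightarrow> (1, y) \<in> B'" "\<And>y. (int p - 1, y) \<in> B \<longleftrightarrow> (1, y) \<in> A'"
  shows "\<exists>A'' B''. cycle_pair (p + r) q (N + M) A'' B'' \<and>
     (\<forall>y. (int (p + r) - 1, y) \<in> A'' \<longleftrightarrow> (int r - 1, y) \<in> A') \<and>
     (\<forall>y. (int (p + r) - 1, y) \<in> B'' \<longleftrightarrow> (int r - 1, y) \<in> B')"
proof -
  obtain y0 where y0: "(int p - 1, y0) \<in> A" "(int p - 1, y0) \<in> B" using g1 by (auto simp: cycle_pair_def)
  have y0': "(1, y0) \<in> A'" "(1, y0) \<in> B'" using y0 match by auto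
  have mem1: "S = A \<or> S = B \<Longrightarrow> (x, y) \<in> S \<Longrightarrow> 1 \<le> x \<and> x < int p \<and> 1 \<le> y \<and> y < int q" for S x y
    using g1 by (auto simp: cycle_pair_def)
  have mem2: "S = A' \<or> S = B' \<Longrightarrow> (x, y) \<in> S \<Longrightarrow> 1 \<le> x \<and> x < int r \<and> 1 \<le> y \<and> y < int q" for S x y
    using g2 by (auto simp: cycle_pair_def)
  have y0_range: "1 \<le> y0" "y0 < int q" and p: "2 \<le> int p" and r: "2 \<le> int r"
    using mem1[of A "int p - 1" y0] mem2[of A' 1 y0] y0 y0' by auto
  define J where "J S T = S \<union> shifted (int p) T \<union> {(int p, y0)}" for S T
  have J: "(x, y) \<in> J S T \<longleftrightarrow> (if x < int p then (x, y) \<in> S else if x = int p then y = y0 else (x - int p, y) \<in> T)"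
    if "S = A \<or> S = B" "T = A' \<or> T = B'" for S T x y
    using mem1[OF that(1), of x y] mem2[OF that(2), of "x - int p" y] by (auto simp: J_def)
  have JA: "(x, y) \<in> J A A' \<longleftrightarrow> (if x < int p then (x, y) \<in> A else if x = int p then y = y0 else (x - int p, y) \<in> A')"
    and JB: "(x, y) \<in> J B B' \<longleftrightarrow> (if x < int p then (x, y) \<in> B else if x = int p then y = y0 else (x - int p, y) \<in> B')"
    for x y by (rule J; simp)+
  have pcol: "(int p, y) \<notin> A" "(int p, y) \<notin> B" "(0, y) \<notin> A'" "(0, y) \<notin> B'" for y
    using mem1[of A "int p" y] mem1[of B "int p" y] mem2[of A' 0 y] mem2[of B' 0 y] by auto
  have "cycle_pair (p + r) q (N + M) (J A A') (J B B')"
    unfolding cycle_pair_def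
  proof (intro conjI allI impI)
    have sub: "J S T \<subseteq> grid_cells (p + r) q" if "S = A \<or> S = B" "T = A' \<or> T = B'" for S T
    proof (rule subrelI)
      fix x y assume *: "(x, y) \<in> J S T"
      consider "x < int p" | "x = int p" | "x > int p" by linarith
      then show "(x, y) \<in> grid_cells (p + r) q"
      proof cases
        case 1
        then have "(x, y) \<in> S" using * J[OF that] by simp
        then show ?thesis using mem1[OF that(1)] 1 by fastforce
      next
        case 2
        then have "y = y0" using * J[OF that] by simp
        then show ?thesis using 2 y0_range p r by simp
      next
        case 3
        then have "(x - int p, y) \<in> T" using * J[OF that] by simp
        then show ?thesis using mem2[OF that(2)] 3 by fastforce
      qed
    qed
    show "J A A' \<subseteq> grid_cells (p + r) q" "J B B' \<subseteq> grid_cells (p + r) q" by (rule sub; simp)+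
    have link: "cycle_region (J S T)"
      if "S = A \<or> S = B" "T = A' \<or> T = B'" "cycle_region S" "cycle_region T" "(int p - 1, y0) \<in> S" "(1, y0) \<in> T" for S T
      unfolding J_def
    proof (rule cycle_region_link)
      show "x < int p" if "(x, y) \<in> S" for x y using mem1 that \<open>S = A \<or> S = B\<close> by blast
      show "int p < x" if "(x, y) \<in> shifted (int p) T" for x y
        using mem2[OF \<open>T = A' \<or> T = B'\<close>, of "x - int p" y] that by simp
    qed (use that boundary_shifted(1) in auto)
    show "cycle_region (J A A')" "cycle_region (J B B')" by (rule link; use g1 g2 y0 y0' in \<open>simp add: cycle_pair_def\<close>)+
    fix x y assume xy: "(x, y) \<in> grid_cells (p + r) q"
    consider "x < int p - 1" | "x = int p - 1" | "x = int p" | "x = int p + 1" | "x > int p + 1" by linarith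
    then show "boundary_sides (J A A') x y = boundary_sides (J B B') x y"
    proof cases
      case 1
      then have "boundary_sides (J A A') x y = boundary_sides A x y" "boundary_sides (J B B') x y = boundary_sides B x y" by (simp_all add: boundary_sides_def JA JB)
      then show ?thesis using 1 xy g1 by (simp add: cycle_pair_def)
    next
      case 2
      \<comment> \<open>The link touches a cell of both \<open>A\<close> and \<open>B\<close>, so
        both counts drop by one in its row.\<close>
      have "boundary_sides A x y = boundary_sides B x y" using 2 xy g1 p by (simp add: cycle_pair_def)
      then show ?thesis using 2 y0 pcol by (cases "y = y0") (auto simp: boundary_sides_def JA JB)
    next
      case 3
      \<comment> \<open>By \<open>match\<close>, a cell of the separating column sees the same two
        values to its left and right, in opposite order.\<close>
      then show ?thesis using match by (auto simp: boundary_sides_def JA JB)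
    next
      case 4
      have "boundary_sides A' 1 y = boundary_sides B' 1 y" using 4 xy g2 r by (simp add: cycle_pair_def)
      then show ?thesis using 4 y0' pcol by (cases "y = y0") (auto simp: boundary_sides_def JA JB)
    next
      case 5
      then have "boundary_sides (J A A') x y = boundary_sides A' (x - int p) y" "boundary_sides (J B B') x y = boundary_sides B' (x - int p) y"
        by (simp_all add: boundary_sides_def JA JB algebra_simps)
      then show ?thesis using 5 xy g2 by (simp add: cycle_pair_def)
    qed
  next
    let ?V = "sym_diff A B" and ?W = "shifted (int p) (sym_diff A' B')"
    have V: "x < int p" if "(x, y) \<in> ?V" for x y using that mem1[of A x y] mem1[of B x y] by auto
    have W: "int p < x" if "(x, y) \<in> ?W" for x y using that mem2[of A' "x - int p" y] mem2[of B' "x - int p" y] by auto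
    have "sym_diff (J A A') (J B B') = ?V \<union> ?W"
    proof (rule set_eqI, clarify)
      fix x y
      consider "x < int p" | "x = int p" | "x > int p" by linarith
      then show "(x, y) \<in> sym_diff (J A A') (J B B') \<longleftrightarrow> (x, y) \<in> ?V \<union> ?W"
        using V[of x y] W[of x y] by cases (simp_all add: JA JB, blast+)
    qed
    moreover have "card (boundary (?V \<union> ?W)) = card (boundary ?V) + card (boundary ?W)"
    proof (rule card_boundary_separated)
      show "finite ?V" by (rule finite_subset[OF _ finite_grid_cells[of p q]]) (use g1 in \<open>auto simp: cycle_pair_def\<close>)
      show "finite ?W"
        by (rule finite_subset[OF _ finite_grid_cells[of "p + r" q]]) (use mem2 in fastforce)
    qed (use V W in blast)+
    ultimately show "card (boundary (sym_diff (J A A') (J B B'))) = N + M"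
      using g1 g2 by (simp add: cycle_pair_def boundary_shifted(2))
  next
    show "\<exists>y. (1, y) \<in> J A A' \<inter> J B B'" using g1 p by (auto simp: cycle_pair_def JA JB)
    obtain y where "(int r - 1, y) \<in> A' \<inter> B'" using g2 by (auto simp: cycle_pair_def)
    then have "(int (p + r) - 1, y) \<in> J A A' \<inter> J B B'" using r by (auto simp: JA JB)
    then show "\<exists>y. (int (p + r) - 1, y) \<in> J A A' \<inter> J B B'" by blast
    have ex: "\<exists>x. (x, w) \<in> J A A' \<inter> J B B'" if "\<exists>x. (x, w) \<in> A \<inter> B" for w
      using that mem1 by (auto simp: J_def)
    show "\<exists>x. (x, 1) \<in> J A A' \<inter> J B B'" "\<exists>x. (x, int q - 1) \<in> J A A' \<inter> J B B'"
      by (rule ex; use g1 in \<open>simp add: cycle_pair_def\<close>)+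
  qed
  moreover have "(int (p + r) - 1, y) \<in> J A A' \<longleftrightarrow> (int r - 1, y) \<in> A'"
    "(int (p + r) - 1, y) \<in> J B B' \<longleftrightarrow> (int r - 1, y) \<in> B'" for y
    using r by (auto simp: JA JB)
  ultimately show ?thesis by blast
qed

text \<open>Tiles alternate with mirror images whose two cycles are swapped. The last tile is an
  original for even \<open>a\<close>; otherwise its right column is the left column of the original
  with \<open>A\<close> and \<open>B\<close> exchanged.\<close>

lemma cycle_pair_replicate:
  assumes g: "cycle_pair p q N A B"
  shows "\<exists>A' B'. cycle_pair (p * Suc a) q (N * Suc a) A' B' \<and>
     (\<forall>y. (int (p * Suc a) - 1, y) \<in> A' \<longleftrightarrow> (if even a then (int p - 1, y) \<in> A else (1, y) \<in> B)) \<and>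
     (\<forall>y. (int (p * Suc a) - 1, y) \<in> B' \<longleftrightarrow> (if even a then (int p - 1, y) \<in> B else (1, y) \<in> A))"
proof (induction a)
  case 0
  then show ?case using g by auto
next
  case (Suc a)
  then obtain A' B' where IH: "cycle_pair (p * Suc a) q (N * Suc a) A' B'"
    "\<And>y. (int (p * Suc a) - 1, y) \<in> A' \<longleftrightarrow> (if even a then (int p - 1, y) \<in> A else (1, y) \<in> B)"
    "\<And>y. (int (p * Suc a) - 1, y) \<in> B' \<longleftrightarrow> (if even a then (int p - 1, y) \<in> B else (1, y) \<in> A)"
    by blast
  have eq: "p * Suc a + p = p * Suc (Suc a)" "N * Suc a + N = N * Suc (Suc a)" by simp_all
  show ?case
  proof (cases "even a")
    case True
    have "cycle_pair p q N (mirrored (int p) B) (mirrored (int p) A)" by (rule cycle_pair_mirrored[OF cycle_pair_swap[OF g]])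
    from cycle_pair_concat[OF IH(1) this] show ?thesis
      unfolding eq IH(2,3) using True by simp
  next
    case False
    from cycle_pair_concat[OF IH(1) g] show ?thesis
      unfolding eq IH(2,3) using False by simp
  qed
qed

lemma cycle_pair_tiling:
  assumes "cycle_pair p q N A B" and "0 < a" and "0 < b"
  shows "\<exists>A' B'. cycle_pair (p * a) (q * b) (N * a * b) A' B'"
proof -
  obtain A1 B1 where "cycle_pair (p * a) q (N * a) A1 B1"
    using cycle_pair_replicate[OF assms(1), of "a - 1"] assms(2) by auto
  from cycle_pair_replicate[OF cycle_pair_transposed[OF this], of "b - 1"]
  obtain A2 B2 where "cycle_pair (q * b) (p * a) (N * a * b) A2 B2" using assms(3) by auto
  from cycle_pair_transposed[OF this] show ?thesis by blast
qed

subsection \<open>A square tile\<close>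

text \<open>Coordinates rotated by 45 degrees. Cells \<open>U i j\<close> are the nodes of a lattice and \<open>V i j\<close>
  the centres of its meshes: \<open>V i j\<close> lies between \<open>U i j\<close>, \<open>U (i + 1) j\<close>, \<open>U i (j + 1)\<close>, \<open>U (i + 1) (j + 1)\<close>.\<close>

definition rotated_cells :: "int \<Rightarrow> (int \<Rightarrow> int \<Rightarrow> bool) \<Rightarrow> (int \<Rightarrow> int \<Rightarrow> bool) \<Rightarrow> point set" where
  "rotated_cells a P Q = {(i + j, j - i + a) | i j. P i j} \<union> {(i + j + 1, j - i + a) | i j. Q i j}"

lemma rotated_cells_U:
  assumes "x = i + j" and "y = j - i + a"
  shows "(x, y) \<in> rotated_cells a P Q \<longleftrightarrow> P i j"
proof
  assume "(x, y) \<in> rotated_cells a P Q"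
  then consider i' j' where "P i' j'" "x = i' + j'" "y = j' - i' + a"
    | i' j' where "x = i' + j' + 1" "y = j' - i' + a"
    by (auto simp: rotated_cells_def)
  then show "P i j"
  proof cases
    case (1 i' j')
    then have "i' = i" "j' = j" using assms by linarith+
    then show ?thesis using 1 by simp
  next
    case (2 i' j')
    then have "2 * j = 2 * j' + 1" using assms by linarith
    then have False by presburger
    then show ?thesis ..
  qed
qed (use assms in \<open>auto simp: rotated_cells_def\<close>)

lemma rotated_cells_V:
  assumes "x = i + j + 1" and "y = j - i + a"
  shows "(x, y) \<in> rotated_cells a P Q \<longleftrightarrow> Q i j"
proof
  assume "(x, y) \<in> rotated_cells a P Q"
  then consider i' j' where "Q i' j'" "x = i' + j' + 1" "y = j' - i' + a"
    | i' j' where "x = i' + j'" "y = j' - i' + a"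
    by (auto simp: rotated_cells_def)
  then show "Q i j"
  proof cases
    case (1 i' j')
    then have "i' = i" "j' = j" using assms by linarith+
    then show ?thesis using 1 by simp
  next
    case (2 i' j')
    then have "2 * j' = 2 * j + 1" using assms by linarith
    then have False by presburger
    then show ?thesis ..
  qed
qed (use assms in \<open>auto simp: rotated_cells_def\<close>)

lemma rotated_cases:
  fixes x y a :: int
  obtains (U) i j where "x = i + j" "y = j - i + a" | (V) i j where "x = i + j + 1" "y = j - i + a"
proof (cases "even (x + y + a)")
  case True
  then have "x = (x - y + a) div 2 + (x + y - a) div 2" "y = (x + y - a) div 2 - (x - y + a) div 2 + a"
    by presburger+
  then show ?thesis by (rule U)
next
  case False
  then have "x = (x - y + a) div 2 + (x + y - a) div 2 + 1" "y = (x + y - a) div 2 - (x - y + a) div 2 + a"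
    by presburger+
  then show ?thesis by (rule V)
qed

lemma rotated_nbrs_U:
  assumes "x = i + j" and "y = j - i + a"
  shows "(x + 1, y) \<in> rotated_cells a P Q \<longleftrightarrow> Q i j" "(x - 1, y) \<in> rotated_cells a P Q \<longleftrightarrow> Q (i - 1) (j - 1)"
    "(x, y + 1) \<in> rotated_cells a P Q \<longleftrightarrow> Q (i - 1) j" "(x, y - 1) \<in> rotated_cells a P Q \<longleftrightarrow> Q i (j - 1)"
    "(x + 1, y + 1) \<in> rotated_cells a P Q \<longleftrightarrow> P i (j + 1)" "(x - 1, y - 1) \<in> rotated_cells a P Q \<longleftrightarrow> P i (j - 1)"
    "(x + 1, y - 1) \<in> rotated_cells a P Q \<longleftrightarrow> P (i + 1) j" "(x - 1, y + 1) \<in> rotated_cells a P Q \<longleftrightarrow> P (i - 1) j"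
  by (rule rotated_cells_U rotated_cells_V; use assms in simp; fail)+

lemma rotated_nbrs_V:
  assumes "x = i + j + 1" and "y = j - i + a"
  shows "(x + 1, y) \<in> rotated_cells a P Q \<longleftrightarrow> P (i + 1) (j + 1)" "(x - 1, y) \<in> rotated_cells a P Q \<longleftrightarrow> P i j"
    "(x, y + 1) \<in> rotated_cells a P Q \<longleftrightarrow> P i (j + 1)" "(x, y - 1) \<in> rotated_cells a P Q \<longleftrightarrow> P (i + 1) j"
    "(x + 1, y + 1) \<in> rotated_cells a P Q \<longleftrightarrow> Q i (j + 1)" "(x - 1, y - 1) \<in> rotated_cells a P Q \<longleftrightarrow> Q i (j - 1)"
    "(x + 1, y - 1) \<in> rotated_cells a P Q \<longleftrightarrow> Q (i + 1) j" "(x - 1, y + 1) \<in> rotated_cells a P Q \<longleftrightarrow> Q (i - 1) j"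
  by (rule rotated_cells_U rotated_cells_V; use assms in simp; fail)+

text \<open>The region is a comb. Its teeth are the diagonals \<open>i = 1, 3, \<dots>, a - 1\<close> of \<open>U\<close>-cells,
  consecutive cells of which are connected through one of their two common neighbours; the choice
  of these neighbours is a chessboard pattern, and \<open>s\<close> selects the colour. The teeth hang on a
  zigzag path along the side \<open>j = b\<close>.\<close>

definition comb_U :: "int \<Rightarrow> int \<Rightarrow> int \<Rightarrow> int \<Rightarrow> bool" where
  "comb_U a b i j \<longleftrightarrow> odd i \<and> 0 \<le> j \<and> j \<le> b \<and> 1 \<le> i \<and> i \<le> a - 1 \<or> even i \<and> j = b + 1 \<and> 2 \<le> i \<and> i \<le> a - 2"

definition comb_V :: "int \<Rightarrow> int \<Rightarrow> int \<Rightarrow> int \<Rightarrow> int \<Rightarrow> bool" where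
  "comb_V s a b i j \<longleftrightarrow> 0 \<le> i \<and> i < a \<and> 0 \<le> j \<and> j < b \<and> even (i + j + s) \<or> j = b \<and> 1 \<le> i \<and> i \<le> a - 2"

definition comb :: "int \<Rightarrow> int \<Rightarrow> int \<Rightarrow> point set" where
  "comb s a b = rotated_cells a (comb_U a b) (comb_V s a b)"

text \<open>Distance from the cell \<open>U 1 b\<close> along the comb.\<close>

definition rank_U :: "int \<Rightarrow> int \<Rightarrow> int \<Rightarrow> int" where
  "rank_U b i j = (if j = b + 1 then 2 * (i - 1) else 2 * (i - 1) + 2 * (b - j))"

text \<open>Below the spine, \<open>V i j\<close> joins the \<open>U\<close>-cells
  \<open>j + 1\<close> and \<open>j\<close> of a tooth: of tooth \<open>i\<close> for odd
  \<open>i\<close>, and of tooth \<open>i + 1\<close> for even \<open>i\<close>.\<close>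

definition rank_V :: "int \<Rightarrow> int \<Rightarrow> int \<Rightarrow> int" where
  "rank_V b i j = (if j = b then 2 * i - 1 else if odd i then 2 * i - 3 + 2 * (b - j) else 2 * i - 1 + 2 * (b - j))"

text \<open>The parity tells \<open>U\<close>-cells from \<open>V\<close>-cells; rounding down lets
  the same formulas recover \<open>i\<close> and \<open>j\<close> for both.\<close>

definition rank :: "int \<Rightarrow> int \<Rightarrow> point \<Rightarrow> int" where
  "rank a b c = (case c of (x, y) \<Rightarrow> if even (x + y + a) then rank_U b ((x - y + a) div 2) ((x + y - a) div 2)
     else rank_V b ((x - y + a) div 2) ((x + y - a) div 2))"

lemma rank_U_eq: "rank a b (i + j, j - i + a) = rank_U b i j"
proof -
  have "even (i + j + (j - i + a) + a)" "(i + j - (j - i + a) + a) div 2 = i" "(i + j + (j - i + a) - a) div 2 = j"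
    by presburger+
  then show ?thesis by (simp only: rank_def case_prod_conv if_True)
qed

lemma rank_V_eq: "rank a b (i + j + 1, j - i + a) = rank_V b i j"
proof -
  have "odd (i + j + 1 + (j - i + a) + a)" "(i + j + 1 - (j - i + a) + a) div 2 = i"
    "(i + j + 1 + (j - i + a) - a) div 2 = j"
    by presburger+
  then show ?thesis by (simp only: rank_def case_prod_conv if_False)
qed

lemma rank_U_eq': "x = i + j \<Longrightarrow> y = j - i + a \<Longrightarrow> rank a b (x, y) = rank_U b i j"
  using rank_U_eq by simp

lemma rank_V_eq': "x = i + j + 1 \<Longrightarrow> y = j - i + a \<Longrightarrow> rank a b (x, y) = rank_V b i j"
  using rank_V_eq by simp

text \<open>The truncated comb is again in rotated coordinates, so the neighbour rules apply to
  it.\<close>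

lemma comb_below_rank:
  "{c \<in> comb s a b. rank a b c \<le> k} =
     rotated_cells a (\<lambda>i j. comb_U a b i j \<and> rank_U b i j \<le> k) (\<lambda>i j. comb_V s a b i j \<and> rank_V b i j \<le> k)"
  unfolding comb_def rotated_cells_def by (auto simp: rank_U_eq rank_V_eq)

lemma comb_subset:
  assumes "2 \<le> a" and "1 \<le> b" and "x = int p" "p = nat (a + b)"
  shows "comb s a b \<subseteq> grid_cells p p"
  using assms by (auto simp: comb_def rotated_cells_def comb_U_def comb_V_def)

text \<open>Truncation by rank removes the successors of a cell; what remains meets it only along
  the side towards its predecessor, and the vector given to \<open>touches\<close> points away from
  that predecessor.\<close>

lemma cycle_region_comb:
  assumes a: "2 \<le> a" "even a" and b: "1 \<le> b"
  shows "cycle_region (comb s a b)"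
proof (rule cycle_region_by_rank[where rank = "rank a b" and r\<^sub>0 = "(1 + b, b - 1 + a)"])
  have "comb s a b \<subseteq> grid_cells (nat (a + b)) (nat (a + b))" by (rule comb_subset[OF a(1) b refl]) simp
  then show "finite (comb s a b)" using finite_subset finite_grid_cells by blast
  have "comb_U a b 1 b" using a b by (auto simp: comb_U_def)
  then show "(1 + b, b - 1 + a) \<in> comb s a b" unfolding comb_def by (subst rotated_cells_U) auto
  have r0: "rank a b (1 + b, b - 1 + a) = 0" by (simp add: rank_U_eq rank_U_def)
  fix c assume "c \<in> comb s a b"
  then consider i j where "c = (i + j, j - i + a)" "comb_U a b i j" | i j where "c = (i + j + 1, j - i + a)" "comb_V s a b i j"
    by (auto simp: comb_def rotated_cells_def)
  then show "rank a b (1 + b, b - 1 + a) \<le> rank a b c"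
  proof cases
    case 1
    then show ?thesis by (auto simp: rank_U_eq rank_U_def r0 comb_U_def)
  next
    case (2 i j)
    show ?thesis
      unfolding 2(1) rank_V_eq r0 using 2(2) by (cases "i = 0") (auto simp: rank_V_def comb_V_def)
  qed
next
  fix x y assume "(x, y) \<in> comb s a b" and root: "(x, y) \<noteq> (1 + b, b - 1 + a)"
  then consider (U) i j where "x = i + j" "y = j - i + a" "comb_U a b i j"
    | (V) i j where "x = i + j + 1" "y = j - i + a" "comb_V s a b i j"
    by (auto simp: comb_def rotated_cells_def)
  then show "\<exists>a' b'. unit_vec a' b' \<and> touches {c \<in> comb s a b. rank a b c \<le> rank a b (x, y)} x y a' b' \<and>
      rank a b (x - a', y - b') < rank a b (x, y)"
  proof cases
    case U
    note n = rotated_nbrs_U[OF U(1,2)]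
    have r: "rank a b (x, y) = rank_U b i j" using U(1,2) rank_U_eq by simp
    have rr: "rank a b (x + 1, y) = rank_V b i j" "rank a b (x, y + 1) = rank_V b (i - 1) j"
      "rank a b (x - 1, y) = rank_V b (i - 1) (j - 1)"
      by (rule rank_V_eq'; use U(1,2) in simp)+
    consider (right) "odd i" "0 \<le> j" "j < b" "1 \<le> i" "i \<le> a - 1" "even (i + j + s)"
      | (up) "odd i" "0 \<le> j" "j < b" "1 \<le> i" "i \<le> a - 1" "odd (i + j + s)"
      | (top) "odd i" "j = b" "3 \<le> i" "i \<le> a - 1"
      | (spine) "even i" "j = b + 1" "2 \<le> i" "i \<le> a - 2"
    proof -
      have "i \<noteq> 1 \<or> j \<noteq> b" using root U(1,2) by auto
      then have "odd i \<and> j = b \<and> 1 \<le> i \<Longrightarrow> 3 \<le> i" by presburger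
      then show thesis using U(3) that unfolding comb_U_def by fastforce
    qed
    then show ?thesis
    proof cases
      case right
      have "touches {c \<in> comb s a b. rank a b c \<le> rank_U b i j} x y (- 1) 0"
        unfolding touches_def comb_below_rank using right a b
        by (simp add: n comb_U_def comb_V_def rank_U_def rank_V_def) blast
      then show ?thesis
        unfolding r using right a b rr by (intro exI[of _ "- 1"] exI[of _ 0]) (simp add: unit_vec_def rank_U_def rank_V_def)
    next
      case up
      have "touches {c \<in> comb s a b. rank a b c \<le> rank_U b i j} x y 0 (- 1)"
        unfolding touches_def comb_below_rank using up a b
        by (simp add: n comb_U_def comb_V_def rank_U_def rank_V_def)
      then show ?thesis
        unfolding r using up a b rr by (intro exI[of _ 0] exI[of _ "- 1"]) (simp add: unit_vec_def rank_U_def rank_V_def)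
    next
      case top
      have "touches {c \<in> comb s a b. rank a b c \<le> rank_U b i j} x y 0 (- 1)"
        unfolding touches_def comb_below_rank using top a b
        by (simp add: n comb_U_def comb_V_def rank_U_def rank_V_def)
      then show ?thesis
        unfolding r using top a b rr by (intro exI[of _ 0] exI[of _ "- 1"]) (simp add: unit_vec_def rank_U_def rank_V_def)
    next
      case spine
      have "touches {c \<in> comb s a b. rank a b c \<le> rank_U b i j} x y 1 0"
        unfolding touches_def comb_below_rank using spine a b
        by (simp add: n comb_U_def comb_V_def rank_U_def rank_V_def)
      then show ?thesis
        unfolding r using spine a b rr by (intro exI[of _ 1] exI[of _ 0]) (simp add: unit_vec_def rank_U_def rank_V_def)
    qed
  next
    case V
    note n = rotated_nbrs_V[OF V(1,2)]
    have r: "rank a b (x, y) = rank_V b i j" using V(1,2) rank_V_eq by simp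
    have rr: "rank a b (x + 1, y) = rank_U b (i + 1) (j + 1)" "rank a b (x, y + 1) = rank_U b i (j + 1)"
      "rank a b (x - 1, y) = rank_U b i j"
      by (rule rank_U_eq'; use V(1,2) in simp)+
    consider (spine_odd) "odd i" "j = b" "1 \<le> i" "i \<le> a - 2"
      | (spine_even) "even i" "j = b" "2 \<le> i" "i \<le> a - 2"
      | (odd) "odd i" "0 \<le> i" "i < a" "0 \<le> j" "j < b" "even (i + j + s)"
      | (even) "even i" "0 \<le> i" "i < a" "0 \<le> j" "j < b" "even (i + j + s)"
    proof -
      have "even i \<Longrightarrow> 1 \<le> i \<Longrightarrow> 2 \<le> i" by presburger
      then show thesis using V(3) that unfolding comb_V_def by blast
    qed
    then show ?thesis
    proof cases
      case spine_odd
      have "touches {c \<in> comb s a b. rank a b c \<le> rank_V b i j} x y 1 0"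
        unfolding touches_def comb_below_rank using spine_odd a b
        by (simp add: n comb_U_def comb_V_def rank_U_def rank_V_def)
      then show ?thesis
        unfolding r using spine_odd a b rr by (intro exI[of _ 1] exI[of _ 0]) (simp add: unit_vec_def rank_U_def rank_V_def)
    next
      case spine_even
      have "touches {c \<in> comb s a b. rank a b c \<le> rank_V b i j} x y 0 (- 1)"
        unfolding touches_def comb_below_rank using spine_even a b
        by (simp add: n comb_U_def comb_V_def rank_U_def rank_V_def)
      then show ?thesis
        unfolding r using spine_even a b rr by (intro exI[of _ 0] exI[of _ "- 1"]) (simp add: unit_vec_def rank_U_def rank_V_def)
    next
      case odd
      then have "1 \<le> i" by presburger
      have "touches {c \<in> comb s a b. rank a b c \<le> rank_V b i j} x y 0 (- 1)"
        unfolding touches_def comb_below_rank using odd \<open>1 \<le> i\<close> a b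
        by (simp add: n comb_U_def comb_V_def rank_U_def rank_V_def)
      then show ?thesis
        unfolding r using odd a b rr by (intro exI[of _ 0] exI[of _ "- 1"]) (simp add: unit_vec_def rank_U_def rank_V_def)
    next
      case even
      \<comment> \<open>Here evenness of \<open>a\<close> matters: an even diagonal always has a
        tooth to its right.\<close>
      then have "i + 1 < a" using a by presburger
      have "touches {c \<in> comb s a b. rank a b c \<le> rank_V b i j} x y (- 1) 0"
        unfolding touches_def comb_below_rank using even \<open>i + 1 < a\<close> a b
        by (simp add: n comb_U_def comb_V_def rank_U_def rank_V_def)
      then show ?thesis
        unfolding r using even a b rr by (intro exI[of _ "- 1"] exI[of _ 0]) (simp add: unit_vec_def rank_U_def rank_V_def)
    qed
  qed
qed


text \<open>Changing \<open>s\<close> swaps the colours of the array of \<open>V\<close>-cells.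
  Around a \<open>U\<close>-cell both colours occur equally often; a \<open>V\<close>-cell of the
  array has two neighbours in the comb and two outside, hence two sides in either case.\<close>

lemma boundary_sides_comb:
  assumes a: "2 \<le> a" "even a" and b: "1 \<le> b" and xy: "1 \<le> x" "x < a + b" "1 \<le> y" "y < a + b"
  shows "boundary_sides (comb 0 a b) x y = boundary_sides (comb 1 a b) x y"
proof (cases x y a rule: rotated_cases)
  case (U i j)
  have self: "(x, y) \<in> comb s a b \<longleftrightarrow> comb_U a b i j" for s
    unfolding comb_def by (rule rotated_cells_U) (use U in auto)
  define arr where "arr k l \<longleftrightarrow> 0 \<le> k \<and> k < a \<and> 0 \<le> l \<and> l < b" for k l
  define spine where "spine k l \<longleftrightarrow> l = b \<and> 1 \<le> k \<and> k \<le> a - 2" for k l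
  have V: "comb_V s a b k l \<longleftrightarrow> arr k l \<and> even (k + l + s) \<or> spine k l" for s k l
    by (auto simp: comb_V_def arr_def spine_def)
  have disj: "\<not> (arr k l \<and> spine k l)" for k l by (auto simp: arr_def spine_def)
  \<comment> \<open>The balance of colours fails only at the four corners of the array, and these
    \<open>U\<close>-cells lie just outside the grid.\<close>
  have corner: "(arr i j = arr (i - 1) j \<and> arr i (j - 1) = arr (i - 1) (j - 1)) \<or>
      (arr i j = arr i (j - 1) \<and> arr (i - 1) j = arr (i - 1) (j - 1))"
  proof (cases "i = 0 \<or> i = a")
    case True
    then have "0 < j" "j < b" using xy U by linarith+
    then show ?thesis by (auto simp: arr_def)
  next
    case False
    then show ?thesis by (auto simp: arr_def)
  qed
  have par: "even (i - 1 + j + s) \<longleftrightarrow> odd (i + j + s)" "even (i + (j - 1) + s) \<longleftrightarrow> odd (i + j + s)"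
    "even (i - 1 + (j - 1) + s) \<longleftrightarrow> even (i + j + s)" "even (i + j + 0) \<longleftrightarrow> odd (i + j + 1)" for s
    by presburger+
  show ?thesis
    unfolding boundary_sides_def self unfolding comb_def rotated_nbrs_U[OF U] V par
    using corner disj[of i j] disj[of "i - 1" j] disj[of i "j - 1"] disj[of "i - 1" "j - 1"]
    by (cases "even (i + j + 1)"; cases "comb_U a b i j"; cases "arr i j"; cases "arr (i - 1) j";
        cases "arr i (j - 1)"; cases "arr (i - 1) (j - 1)"; auto)
next
  case (V i j)
  have self: "(x, y) \<in> comb s a b \<longleftrightarrow> comb_V s a b i j" for s
    unfolding comb_def by (rule rotated_cells_V) (use V in auto)
  show ?thesis
  proof (cases "0 \<le> i \<and> i < a \<and> 0 \<le> j \<and> j < b")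
    case True
    then have "comb_U a b i j \<longleftrightarrow> odd i" "comb_U a b i (j + 1) \<longleftrightarrow> odd i"
      "comb_U a b (i + 1) j \<longleftrightarrow> even i" "comb_U a b (i + 1) (j + 1) \<longleftrightarrow> even i"
      using a unfolding comb_U_def by presburger+
    then show ?thesis
      unfolding boundary_sides_def self unfolding comb_def rotated_nbrs_V[OF V] by (cases "even i") auto
  next
    case False
    then have "comb_V s a b i j \<longleftrightarrow> j = b \<and> 1 \<le> i \<and> i \<le> a - 2" for s by (auto simp: comb_V_def)
    then show ?thesis
      unfolding boundary_sides_def self unfolding comb_def rotated_nbrs_V[OF V] by simp
  qed
qed

lemma sym_diff_comb:
  "sym_diff (comb 0 a b) (comb 1 a b) = rotated_cells a (\<lambda>i j. False) (\<lambda>i j. 0 \<le> i \<and> i < a \<and> 0 \<le> j \<and> j < b)"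
proof (rule set_eqI, clarify)
  fix x y
  show "(x, y) \<in> sym_diff (comb 0 a b) (comb 1 a b) \<longleftrightarrow>
      (x, y) \<in> rotated_cells a (\<lambda>i j. False) (\<lambda>i j. 0 \<le> i \<and> i < a \<and> 0 \<le> j \<and> j < b)"
  proof (cases x y a rule: rotated_cases)
    case (U i j)
    then show ?thesis unfolding comb_def Un_iff Diff_iff rotated_cells_U[OF U] by simp
  next
    case (V i j)
    then show ?thesis unfolding comb_def Un_iff Diff_iff rotated_cells_V[OF V] by (auto simp: comb_V_def)
  qed
qed

text \<open>All neighbours of a \<open>V\<close>-cell are \<open>U\<close>-cells, so each cell of
  the array contributes four sides.\<close>

lemma card_boundary_rotated_array:
  assumes "0 \<le> a" and "0 \<le> b"
  shows "card (boundary (rotated_cells a (\<lambda>i j. False) (\<lambda>i j. 0 \<le> i \<and> i < a \<and> 0 \<le> j \<and> j < b))) = 4 * (nat a * nat b)"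
    (is "card (boundary ?V) = _")
proof -
  have V: "?V = (\<lambda>(i, j). (i + j + 1, j - i + a)) ` ({0..<a} \<times> {0..<b})"
  proof
    show "(\<lambda>(i, j). (i + j + 1, j - i + a)) ` ({0..<a} \<times> {0..<b}) \<subseteq> ?V"
    proof (rule image_subsetI, clarify)
      fix i j assume "i \<in> {0..<a}" "j \<in> {0..<b}"
      then show "(i + j + 1, j - i + a) \<in> ?V" by (subst rotated_cells_V[OF refl refl]) simp
    qed
  qed (auto simp: rotated_cells_def)
  have "inj_on (\<lambda>(i, j). (i + j + 1, j - i + a)) ({0..<a} \<times> {0..<b})"
    by (auto simp: inj_on_def)
  then have card: "card ?V = nat a * nat b" unfolding V by (simp add: card_image)
  have "boundary_sides ?V x y = 4" if xy: "(x, y) \<in> ?V" for x y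
  proof -
    obtain i j where "x = i + j + 1" "y = j - i + a" using xy by (auto simp: rotated_cells_def)
    note n = rotated_nbrs_V[OF this]
    show ?thesis using xy by (simp add: boundary_sides_def n)
  qed
  then have "(\<Sum>(x, y)\<in>?V. boundary_sides ?V x y) = (\<Sum>c\<in>?V. 4)" by (intro sum.cong) auto
  moreover have "finite ?V" unfolding V by simp
  ultimately show ?thesis by (simp add: card_boundary_eq_sum card)
qed

lemma cycle_pair_comb:
  fixes a b :: nat
  assumes a: "2 \<le> a" "even a" and b: "1 \<le> b"
  shows "cycle_pair (a + b) (a + b) (4 * (a * b)) (comb 0 (int a) (int b)) (comb 1 (int a) (int b))"
proof -
  have ab: "2 \<le> int a" "even (int a)" "1 \<le> int b" using a b by auto
  have U: "comb_U (int a) (int b) i j \<Longrightarrow> (i + j, j - i + int a) \<in> comb 0 (int a) (int b) \<inter> comb 1 (int a) (int b)" for i j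
    by (auto simp: comb_def rotated_cells_def)
  \<comment> \<open>The ends of the first and the last tooth lie on the left, top, bottom and right
    sides of the tile.\<close>
  have "comb_U (int a) (int b) 1 0" "comb_U (int a) (int b) 1 (int b)" "comb_U (int a) (int b) (int a - 1) 0"
    "comb_U (int a) (int b) (int a - 1) (int b)"
    using a b by (auto simp: comb_U_def)
  note corners = this[THEN U]
  show ?thesis
    unfolding cycle_pair_def
  proof (intro conjI allI impI)
    show "comb 0 (int a) (int b) \<subseteq> grid_cells (a + b) (a + b)" "comb 1 (int a) (int b) \<subseteq> grid_cells (a + b) (a + b)"
      by (rule comb_subset[OF ab(1,3)]; simp)+
    show "cycle_region (comb 0 (int a) (int b))" "cycle_region (comb 1 (int a) (int b))" by (rule cycle_region_comb[OF ab])+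
    fix x y assume "(x, y) \<in> grid_cells (a + b) (a + b)"
    then show "boundary_sides (comb 0 (int a) (int b)) x y = boundary_sides (comb 1 (int a) (int b)) x y"
      by (intro boundary_sides_comb[OF ab]) auto
  next
    show "card (boundary (sym_diff (comb 0 (int a) (int b)) (comb 1 (int a) (int b)))) = 4 * (a * b)"
      unfolding sym_diff_comb by (subst card_boundary_rotated_array) auto
    show "\<exists>y. (1, y) \<in> comb 0 (int a) (int b) \<inter> comb 1 (int a) (int b)"
      using corners(1) by (intro exI[of _ "int a - 1"]) simp
    show "\<exists>y. (int (a + b) - 1, y) \<in> comb 0 (int a) (int b) \<inter> comb 1 (int a) (int b)"
      using corners(4) by (intro exI[of _ "int b + 1"]) (simp add: algebra_simps)
    show "\<exists>x. (x, 1) \<in> comb 0 (int a) (int b) \<inter> comb 1 (int a) (int b)"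
      using corners(3) by (intro exI[of _ "int a - 1"]) simp
    show "\<exists>x. (x, int (a + b) - 1) \<in> comb 0 (int a) (int b) \<inter> comb 1 (int a) (int b)"
      using corners(2) by (intro exI[of _ "int b + 1"]) (simp add: algebra_simps)
  qed
qed

subsection \<open>Strips of height four\<close>

definition flipped :: "point set \<Rightarrow> point set" where
  "flipped A = transposed (mirrored 4 (transposed A))"

lemma cycle_region_flipped: "cycle_region A \<Longrightarrow> cycle_region (flipped A)"
  unfolding flipped_def by (intro boundary_transposed boundary_mirrored)

text \<open>A block of 3 by 3 cells without two opposite corners. The flip exchanges the missing
  corners, so the cycles disagree on the four corner cells.\<close>

definition tile4 :: "point set" where
  "tile4 = {(3, 3), (1, 1), (2, 3), (2, 1), (3, 2), (1, 2), (2, 2)}"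

text \<open>An arch with two feet; it disagrees with its flip on the six cells with two odd
  coordinates.\<close>

definition tile6 :: "point set" where
  "tile6 = {(5, 1), (1, 1), (5, 2), (1, 2), (4, 1), (4, 2), (4, 3), (3, 3), (2, 3), (2, 2), (2, 1)}"

lemma flipped_eq_image: "flipped A = (\<lambda>(x, y). (x, 4 - y)) ` A"
  by (force simp: flipped_def)

lemma flipped_tile4: "flipped tile4 = {(3, 1), (1, 3), (2, 1), (2, 3), (3, 2), (1, 2), (2, 2)}"
  by (simp add: flipped_eq_image tile4_def)

lemma flipped_tile6: "flipped tile6 = {(5, 3), (1, 3), (5, 2), (1, 2), (4, 3), (4, 2), (4, 1), (3, 1), (2, 1), (2, 2), (2, 3)}"
  by (simp add: flipped_eq_image tile6_def)

lemma cycle_region_tile4: "cycle_region tile4"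
proof -
  note grow = cycle_region_insert_touching and touch = unit_vec_def touches_def
  have "cycle_region {(2, 2)}" by (rule cycle_region_singleton)
  then have "cycle_region {(1, 2), (2, 2)}" by (rule grow[where a = "- 1" and b = 0]) (auto simp: touch)
  then have "cycle_region {(3, 2), (1, 2), (2, 2)}" by (rule grow[where a = 1 and b = 0]) (auto simp: touch)
  then have "cycle_region {(2, 1), (3, 2), (1, 2), (2, 2)}" by (rule grow[where a = 0 and b = "- 1"]) (auto simp: touch)
  then have "cycle_region {(2, 3), (2, 1), (3, 2), (1, 2), (2, 2)}" by (rule grow[where a = 0 and b = 1]) (auto simp: touch)
  then have "cycle_region {(1, 1), (2, 3), (2, 1), (3, 2), (1, 2), (2, 2)}"
    by (rule cycle_region_insert_corner[where a = "- 1" and b = "- 1"]) auto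
  then show ?thesis unfolding tile4_def by (rule cycle_region_insert_corner[where a = 1 and b = 1]) auto
qed

lemma cycle_region_tile6: "cycle_region tile6"
proof -
  note grow = cycle_region_insert_touching and touch = unit_vec_def touches_def
  have "cycle_region {(2, 1)}" by (rule cycle_region_singleton)
  then have "cycle_region {(2, 2), (2, 1)}" by (rule grow[where a = 0 and b = 1]) (auto simp: touch)
  then have "cycle_region {(2, 3), (2, 2), (2, 1)}" by (rule grow[where a = 0 and b = 1]) (auto simp: touch)
  then have "cycle_region {(3, 3), (2, 3), (2, 2), (2, 1)}" by (rule grow[where a = 1 and b = 0]) (auto simp: touch)
  then have "cycle_region {(4, 3), (3, 3), (2, 3), (2, 2), (2, 1)}" by (rule grow[where a = 1 and b = 0]) (auto simp: touch)
  then have "cycle_region {(4, 2), (4, 3), (3, 3), (2, 3), (2, 2), (2, 1)}"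
    by (rule grow[where a = 0 and b = "- 1"]) (auto simp: touch)
  then have "cycle_region {(4, 1), (4, 2), (4, 3), (3, 3), (2, 3), (2, 2), (2, 1)}"
    by (rule grow[where a = 0 and b = "- 1"]) (auto simp: touch)
  then have "cycle_region {(1, 2), (4, 1), (4, 2), (4, 3), (3, 3), (2, 3), (2, 2), (2, 1)}"
    by (rule grow[where a = "- 1" and b = 0]) (auto simp: touch)
  then have "cycle_region {(5, 2), (1, 2), (4, 1), (4, 2), (4, 3), (3, 3), (2, 3), (2, 2), (2, 1)}"
    by (rule grow[where a = 1 and b = 0]) (auto simp: touch)
  then have "cycle_region {(1, 1), (5, 2), (1, 2), (4, 1), (4, 2), (4, 3), (3, 3), (2, 3), (2, 2), (2, 1)}"
    by (rule cycle_region_insert_corner[where a = "- 1" and b = "- 1"]) auto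
  then show ?thesis unfolding tile6_def by (rule cycle_region_insert_corner[where a = 1 and b = "- 1"]) auto
qed

lemma cycle_pair_tile4: "cycle_pair 4 4 16 tile4 (flipped tile4)"
  unfolding cycle_pair_def
proof (intro conjI allI impI)
  show "cycle_region tile4" "cycle_region (flipped tile4)" using cycle_region_tile4 cycle_region_flipped by auto
  fix x y :: int assume "(x, y) \<in> grid_cells 4 4"
  then have "1 \<le> x" "x < 4" "1 \<le> y" "y < 4" by simp_all
  then have "x \<in> {1, 2, 3}" "y \<in> {1, 2, 3}" by (simp, linarith)+
  moreover have "\<forall>x\<in>{1, 2, 3}. \<forall>y\<in>{1, 2, 3}. boundary_sides tile4 x y = boundary_sides (flipped tile4) x y"
    unfolding flipped_tile4 unfolding tile4_def boundary_sides_def by simp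
  ultimately show "boundary_sides tile4 x y = boundary_sides (flipped tile4) x y" by blast
next
  have "sym_diff tile4 (flipped tile4) = {(3, 1), (1, 3), (3, 3), (1, 1)}"
    unfolding flipped_tile4 unfolding tile4_def by (simp add: insert_Diff_if)
  then show "card (boundary (sym_diff tile4 (flipped tile4))) = 16" by (simp add: card_boundary_eq_sum boundary_sides_def)
qed (unfold flipped_tile4, auto simp: tile4_def)

lemma cycle_pair_tile6: "cycle_pair 6 4 24 tile6 (flipped tile6)"
  unfolding cycle_pair_def
proof (intro conjI allI impI)
  show "cycle_region tile6" "cycle_region (flipped tile6)" using cycle_region_tile6 cycle_region_flipped by auto
  fix x y :: int assume "(x, y) \<in> grid_cells 6 4"
  then have "1 \<le> x" "x < 6" "1 \<le> y" "y < 4" by simp_all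
  then have "x \<in> {1, 2, 3, 4, 5}" "y \<in> {1, 2, 3}" by (simp, linarith)+
  moreover have "\<forall>x\<in>{1, 2, 3, 4, 5}. \<forall>y\<in>{1, 2, 3}. boundary_sides tile6 x y = boundary_sides (flipped tile6) x y"
    unfolding flipped_tile6 unfolding tile6_def boundary_sides_def by simp
  ultimately show "boundary_sides tile6 x y = boundary_sides (flipped tile6) x y" by blast
next
  have "sym_diff tile6 (flipped tile6) = {(5, 3), (1, 3), (3, 1), (5, 1), (1, 1), (3, 3)}"
    unfolding flipped_tile6 unfolding tile6_def by (simp add: insert_Diff_if)
  then show "card (boundary (sym_diff tile6 (flipped tile6))) = 24" by (simp add: card_boundary_eq_sum boundary_sides_def)
qed (unfold flipped_tile6, auto simp: tile6_def)

text \<open>\<open>tile4\<close> has rows 1, 2 in its left and 2, 3 in its right column, and its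
  flip the reverse, so copies fit together without reflection.\<close>

lemma cycle_pair_strip_step:
  assumes "\<exists>A B. cycle_pair p 4 (4 * p) A B \<and> (\<forall>y. (int p - 1, y) \<in> A \<longleftrightarrow> y \<in> {2, 3}) \<and> (\<forall>y. (int p - 1, y) \<in> B \<longleftrightarrow> y \<in> {1, 2})"
  shows "\<exists>A B. cycle_pair (p + 4 * k) 4 (4 * (p + 4 * k)) A B \<and> (\<forall>y. (int (p + 4 * k) - 1, y) \<in> A \<longleftrightarrow> y \<in> {2, 3})
      \<and> (\<forall>y. (int (p + 4 * k) - 1, y) \<in> B \<longleftrightarrow> y \<in> {1, 2})"
proof (induction k)
  case 0
  then show ?case using assms by simp
next
  case (Suc k)
  then obtain A B where AB: "cycle_pair (p + 4 * k) 4 (4 * (p + 4 * k)) A B"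
    "\<And>y. (int (p + 4 * k) - 1, y) \<in> A \<longleftrightarrow> y \<in> {2, 3}" "\<And>y. (int (p + 4 * k) - 1, y) \<in> B \<longleftrightarrow> y \<in> {1, 2}"
    by blast
  have eq: "p + 4 * k + 4 = p + 4 * Suc k" "4 * (p + 4 * k) + 16 = 4 * (p + 4 * Suc k)" by simp_all
  have "(int 4 - 1, y) \<in> tile4 \<longleftrightarrow> y \<in> {2, 3}" "(int 4 - 1, y) \<in> flipped tile4 \<longleftrightarrow> y \<in> {1, 2}" for y
    unfolding flipped_tile4 unfolding tile4_def by auto
  moreover have "(int (p + 4 * k) - 1, y) \<in> A \<longleftrightarrow> (1, y) \<in> flipped tile4"
    "(int (p + 4 * k) - 1, y) \<in> B \<longleftrightarrow> (1, y) \<in> tile4" for y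
    unfolding AB(2,3) flipped_tile4 unfolding tile4_def by auto
  ultimately show ?case using cycle_pair_concat[OF AB(1) cycle_pair_tile4] unfolding eq by simp
qed

lemma cycle_pair_strip:
  assumes "even q" and "4 \<le> q"
  shows "\<exists>A B. cycle_pair q 4 (4 * q) A B"
proof -
  have right4: "(3, y) \<in> tile4 \<longleftrightarrow> y \<in> {2, 3}" "(3, y) \<in> flipped tile4 \<longleftrightarrow> y \<in> {1, 2}"
    and right6: "(5, y) \<in> tile6 \<longleftrightarrow> y \<in> {1, 2}" "(5, y) \<in> flipped tile6 \<longleftrightarrow> y \<in> {2, 3}" for y
    unfolding flipped_tile4 flipped_tile6 unfolding tile4_def tile6_def by auto
  \<comment> \<open>\<open>tile6\<close> starts the strips of width 2 modulo 4. Its right column is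
    that of \<open>flipped tile4\<close>, so its cycles are swapped.\<close>
  have "(\<exists>k. q = 4 + 4 * k) \<or> (\<exists>k. q = 6 + 4 * k)" using assms by presburger
  then show ?thesis
  proof (elim disjE exE)
    fix k assume "q = 4 + 4 * k"
    then show ?thesis using cycle_pair_strip_step[of 4 k] cycle_pair_tile4 right4 by auto
  next
    fix k assume "q = 6 + 4 * k"
    then show ?thesis using cycle_pair_strip_step[of 6 k] cycle_pair_swap[OF cycle_pair_tile6] right6 by auto
  qed
qed

subsection \<open>The bound is attained\<close>

lemma zero_in_difference_sizes:
  assumes "2 \<le> m" and "2 \<le> n"
  shows "0 \<in> difference_sizes m n"
proof -
  have "is_cycle (grid_edges m n) (boundary {(1, 1)})"
    by (rule cycle_region_is_cycle[OF cycle_region_singleton]) (use assms in simp)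
  then show ?thesis
    unfolding difference_sizes_def same_signature_def
    by (intro CollectI exI[of _ "boundary {(1, 1)}"]) simp
qed

lemma comb_tiling_difference:
  assumes "2 \<le> a" "even a" "1 \<le> b" "0 < m'" "0 < n'"
  shows "4 * (a * b) * m' * n' \<in> difference_sizes ((a + b) * m') ((a + b) * n')"
  using cycle_pair_tiling[OF cycle_pair_comb[OF assms(1-3)] assms(4,5)] cycle_pair_difference by blast

lemma strips_difference:
  assumes "even p" "4 \<le> p" "0 < k"
  shows "p * (4 * k) \<in> difference_sizes p (4 * k)" and "p * (4 * k) \<in> difference_sizes (4 * k) p"
proof -
  obtain A B where "cycle_pair p 4 (4 * p) A B" using cycle_pair_strip[OF assms(1,2)] by blast
  from cycle_pair_tiling[OF this, of 1 k] obtain A' B' where g: "cycle_pair p (4 * k) (p * (4 * k)) A' B'"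
    using assms(3) by (auto simp: mult_ac)
  show "p * (4 * k) \<in> difference_sizes p (4 * k)" by (rule cycle_pair_difference[OF g])
  show "p * (4 * k) \<in> difference_sizes (4 * k) p" by (rule cycle_pair_difference[OF cycle_pair_transposed[OF g]])
qed

lemma difference_attained:
  fixes m n d m' n' :: nat
  assumes mn: "2 \<le> m" "2 \<le> n" and d: "d = gcd m n" and m: "m = d * m'" and n: "n = d * n'"
  shows "\<exists>k \<in> difference_sizes m n. k + delta m n * (m' * n') = m * n"
proof -
  have pos: "0 < d" "0 < m'" "0 < n'" using mn m n by (auto intro!: gr0I)
  have "m * n = d\<^sup>2 * (m' * n')" unfolding m n power2_eq_square by (simp only: mult_ac)
  then have mn_div: "m * n div d\<^sup>2 = m' * n'" using pos by simp
  have delta: "delta m n = (if odd d then 1 else if d mod 4 = 0 then 0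
      else if d mod 4 = 2 \<and> 4 \<le> m \<and> 4 \<le> n \<and> even (m' * n') then 0 else 4)"
    unfolding delta_def Let_def d[symmetric] mn_div ..
  \<comment> \<open>The last condition says that \<open>delta\<close> is the square of
    \<open>a - b\<close>: the sides should be as equal as evenness of \<open>a\<close>
    permits.\<close>
  have tile: ?thesis if "2 \<le> a" "even a" "1 \<le> b" "a + b = d" "4 * (a * b) + delta m n = d * d" for a b
  proof (rule bexI)
    show "4 * (a * b) * m' * n' \<in> difference_sizes m n"
      using comb_tiling_difference[OF that(1-3) pos(2,3)] unfolding that(4) m n .
    have "4 * (a * b) * m' * n' + delta m n * (m' * n') = (4 * (a * b) + delta m n) * (m' * n')"
      by (simp add: algebra_simps)
    then show "4 * (a * b) * m' * n' + delta m n * (m' * n') = m * n"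
      unfolding that(5) by (simp add: m n algebra_simps)
  qed
  have zero: ?thesis if "delta m n = d * d"
    using zero_in_difference_sizes[OF mn] that by (intro bexI[of _ 0]) (simp_all add: m n algebra_simps)
  consider "d = 1" | "odd d" "d \<noteq> 1" | "d mod 4 = 0" | "d mod 4 = 2" "delta m n = 4"
    | "even d" "4 \<le> m" "4 \<le> n" "even (m' * n')" "delta m n = 0"
  proof -
    have "d mod 4 = 0 \<or> d mod 4 = 2 \<or> odd d" by presburger
    moreover have "even d" if "d mod 4 = 2" using that by presburger
    ultimately show thesis using that delta by metis
  qed
  then show ?thesis
  proof cases
    case 1
    then show ?thesis by (intro zero) (simp add: delta)
  next
    case 2
    \<comment> \<open>Whichever of \<open>h\<close> and \<open>h + 1\<close> is even becomes the
      even side of the comb.\<close>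
    then obtain h where h: "d = 2 * h + 1" "1 \<le> h" using pos by (auto elim!: oddE)
    have sq: "4 * (h * (h + 1)) + 1 = d * d" by (simp add: h algebra_simps)
    show ?thesis
    proof (cases "even h")
      case True
      then have "2 \<le> h" using h(2) by presburger
      then show ?thesis using tile[of h "h + 1"] True sq h 2 by (simp add: delta)
    next
      case False
      then show ?thesis using tile[of "h + 1" h] sq h 2 by (simp add: delta mult.commute)
    qed
  next
    case 3
    then obtain h where h: "d = 2 * h" "even h" by (metis dvd_def mod_0_imp_dvd mult.assoc num_double numeral_times_numeral)
    then have "2 \<le> h" using pos by presburger
    moreover have "delta m n = 0" using 3 h by (simp add: delta)
    ultimately show ?thesis using tile[of h h] h by simp
  next
    case 4
    \<comment> \<open>The half \<open>2 * h + 1\<close> is odd, so the sides are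
      \<open>2 * h\<close> and \<open>2 * h + 2\<close>. For \<open>d = 2\<close> no comb remains,
      but the claimed maximum is 0.\<close>
    then obtain h where h: "d = 4 * h + 2" using pos by (metis add.commute mod_mult_div_eq mult.commute)
    show ?thesis
    proof (cases "h = 0")
      case True
      then show ?thesis using h 4 by (intro zero) simp
    next
      case False
      then show ?thesis using tile[of "2 * h" "2 * h + 2"] h 4 by (simp add: algebra_simps)
    qed
  next
    case 5
    have even: "even m" "even n" using 5 m n by auto
    have "m * n \<in> difference_sizes m n"
    proof (cases "even n'")
      case True
      \<comment> \<open>Both \<open>d\<close> and \<open>n'\<close> are even, so strips of height 4
        fill the grid.\<close>
      then obtain k where k: "n = 4 * k" using 5(1) n by (auto elim!: evenE)
      show ?thesis using strips_difference(1)[OF even(1) 5(2), of k] mn unfolding k by simp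
    next
      case False
      then have "even m'" using 5 by simp
      then obtain k where k: "m = 4 * k" using 5(1) m by (auto elim!: evenE)
      show ?thesis using strips_difference(2)[OF even(2) 5(3), of k] mn unfolding k by (simp add: mult.commute)
    qed
    then show ?thesis using 5 by auto
  qed
qed

theorem theorem7:
  fixes m n d m' n' :: nat
  assumes "2 \<le> m" and "2 \<le> n"
    and "d = gcd m n" and "m = d * m'" and "n = d * n'"
  shows "\<exists>k \<in> difference_sizes m n.
           int k = int m * int n - int (delta m n) * int m' * int n' \<and>
           (\<forall>s \<in> difference_sizes m n. s \<le> k)"
proof -
  obtain k where k: "k \<in> difference_sizes m n" "k + delta m n * (m' * n') = m * n"
    using difference_attained[OF assms] by blast
  have "int k + int (delta m n) * (int m' * int n') = int m * int n"
    using arg_cong[OF k(2), of int] by simp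
  then have "int k = int m * int n - int (delta m n) * int m' * int n'" by (simp add: mult.assoc)
  moreover have "s \<le> k" if "s \<in> difference_sizes m n" for s
    using difference_le[OF assms that] k(2) by linarith
  ultimately show ?thesis using k(1) by blast
qed

end
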